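(* Let $F = G/H = \sum_{r,s} a_{r,s} z^r w^s$ (as in the context) have a strictly minimal, simple pole at $(z,w)$ with $wH_w(z,w)\ne 0$. Let $k$ be the order of vanishing of $\tilde f$ at $0$, and let $l_0$ be the order to which $G$ vanishes near $(z,w)$ on $\mathcal{V}$, that is, the largest $l$ such that $G(z',w') = O(|z-z'|^l + |w-w'|^l)$ as $(z',w')\to(z,w)$ in $\mathcal{V}$. Then there is a full asymptotic expansion $$a_{r,s} \sim \frac{1}{2\pi} z^{-r} w^{-s} \sum_{l\ge l_0} \mathcal{A}(k,l)\, b_l\, s^{-(l+1)/k},$$ where $\mathcal{A}(k,l)$ denotes $A(k,l)$ if $\operatorname{Im}\{c_k\}\ge 0$ and $\overline{A(k,l)}$ otherwise. The expansion is uniform as $(z,w)$ varies over a compact set of strictly minimal poles with $(r,s)\in\mathbf{dir}(z,w)$ and with $k$ and $l_0$ not changing.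
   Context: $F(z,w) = \sum a_{r,s} z^r w^s$ converges near the origin and $F = G/H$ with $G,H$ analytic in a neighborhood of the closed polydisk $D(z,w)=\{(z',w'):|z'|\le |z|,|w'|\le|w|\}$. $\mathcal{V}$ is the zero set of $H$. $(z,w)\in\mathcal{V}$ is a simple pole if $\nabla H(z,w)\ne0$, strictly minimal if $\mathcal{V}\cap D(z,w)=\{(z,w)\}$. $(r,s)\in\mathbf{dir}(z,w)$ means $(r,s)$ is a scalar multiple of $(zH_z,wH_w)$ at $(z,w)$. Near $(z,w)$, $\mathcal{V}$ is parametrized by $w' = g(z')$ with $g$ analytic and $g(z)=w$. Define $\psi(u) = -\lim_{v\to g(u)} (v-g(u))F(u,v)/v$. For real $\theta$ near $0$ set $\tilde\psi(\theta) = \psi(ze^{i\theta})$ and $\tilde f(\theta) = \log\big(g(ze^{i\theta})/g(z)\big) + i\frac{r}{s}\theta$. Let $c_j = \tilde f^{(j)}(0)/j!$, $c_k$ the first nonvanishing one. Define $y(x) = \tilde f(x)^{1/k} = c_k^{1/k}x\left(1+\frac{\tilde f(x)-c_kx^k}{c_kx^k}\right)^{1/k}$ where the argument of $c_k^{1/k}$ is taken in $[-\pi/(2k),\pi/(2k)]$; let $\eta$ be the inverse function of $y$, and let $b_j$ be the Taylor coefficients at $0$ of $(\tilde\psi\circ\eta)\cdot\eta'$. For $k\ge2$: if $k$ is odd, $A(k,l) = \frac1k\Gamma\!\left(\frac{l+1}{k}\right)\left(1+e^{\operatorname{sign}\operatorname{Arg}(c_k)\, i\pi(l-\frac{l+1}{k})}\right)$;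 if $k$ and $l$ are even, $A(k,l) = \frac2k\Gamma\!\left(\frac{l+1}{k}\right)$; if $k$ is even and $l$ is odd, $A(k,l)=0$. The asymptotic expansion $f\sim\sum_l \beta_l g_l$ (with $g_{l+1}=o(g_l)$) means $f-\sum_{l\le N}\beta_l g_l = o(g_N)$ for each $N$.
   Formalization: For odd k, the factor sign Arg(c_k) in the exponent of A(k,l) is replaced by −1; this corrects the constant for odd k with Im c_k > 0, where the printed formula gives the complex conjugate of the true value, and leaves all other cases unchanged. *)

theory Defs
  imports "HOL-Complex_Analysis.Complex_Analysis" "HOL-Library.Landau_Symbols"
begin

section \<open>Analytic functions of two complex variables\<close>

definition has_power_series ::
  "(nat \<Rightarrow> nat \<Rightarrow> complex) \<Rightarrow> (complex \<times> complex \<Rightarrow> complex) \<Rightarrow> complex \<times> complex \<Rightarrow> bool" where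
  "has_power_series a f p \<longleftrightarrow>
     (\<exists>\<rho>>0. \<forall>x y. norm x < \<rho> \<and> norm y < \<rho> \<longrightarrow>
        ((\<lambda>(m, n). a m n * x ^ m * y ^ n) has_sum f (fst p + x, snd p + y)) UNIV)"

text \<open>As for \<open>analytic_on\<close> in one variable, every point of the set has a full neighbourhood
  on which the function is given by a power series, so analyticity on a closed set is analyticity
  in an open neighbourhood of it. Values outside that neighbourhood are irrelevant.\<close>

definition analytic2_on :: "(complex \<times> complex \<Rightarrow> complex) \<Rightarrow> (complex \<times> complex) set \<Rightarrow> bool" where
  "analytic2_on f S \<longleftrightarrow> (\<forall>p\<in>S. \<exists>a. has_power_series a f p)"

definition partial1 :: "(complex \<times> complex \<Rightarrow> complex) \<Rightarrow> complex \<times> complex \<Rightarrow> complex" where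
  "partial1 f p = deriv (\<lambda>u. f (u, snd p)) (fst p)"

definition partial2 :: "(complex \<times> complex \<Rightarrow> complex) \<Rightarrow> complex \<times> complex \<Rightarrow> complex" where
  "partial2 f p = deriv (\<lambda>v. f (fst p, v)) (snd p)"

section \<open>The singular variety\<close>

definition polydisk :: "complex \<times> complex \<Rightarrow> (complex \<times> complex) set" where
  "polydisk p = {(u, v). norm u \<le> norm (fst p) \<and> norm v \<le> norm (snd p)}"

definition zero_set :: "(complex \<times> complex \<Rightarrow> complex) \<Rightarrow> (complex \<times> complex) set" where
  "zero_set H = {p. H p = 0}"

definition simple_pole :: "(complex \<times> complex \<Rightarrow> complex) \<Rightarrow> complex \<times> complex \<Rightarrow> bool" where
  "simple_pole H p \<longleftrightarrow> p \<in> zero_set H \<and> (partial1 H p, partial2 H p) \<noteq> (0, 0)"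

definition strictly_minimal :: "(complex \<times> complex \<Rightarrow> complex) \<Rightarrow> complex \<times> complex \<Rightarrow> bool" where
  "strictly_minimal H p \<longleftrightarrow> zero_set H \<inter> polydisk p = {p}"

definition dir :: "(complex \<times> complex \<Rightarrow> complex) \<Rightarrow> complex \<times> complex \<Rightarrow> (real \<times> real) set" where
  "dir H p = {(r, s). \<exists>c. complex_of_real r = c * (fst p * partial1 H p) \<and>
                            complex_of_real s = c * (snd p * partial2 H p)}"

definition parametrizes ::
  "(complex \<Rightarrow> complex) \<Rightarrow> (complex \<times> complex \<Rightarrow> complex) \<Rightarrow> complex \<times> complex \<Rightarrow> bool" where
  "parametrizes g H p \<longleftrightarrow> g analytic_on {fst p} \<and> g (fst p) = snd p \<and>
     (\<forall>\<^sub>F q in nhds p. q \<in> zero_set H \<longleftrightarrow> snd q = g (fst q))"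

definition vanishes_to_order_on ::
  "(complex \<times> complex \<Rightarrow> complex) \<Rightarrow> (complex \<times> complex) set \<Rightarrow> complex \<times> complex \<Rightarrow> nat \<Rightarrow> bool" where
  "vanishes_to_order_on G V p l \<longleftrightarrow>
     (\<lambda>q. norm (G q)) \<in> O[at p within V](\<lambda>q. norm (fst p - fst q) ^ l + norm (snd p - snd q) ^ l)"

definition is_vanishing_order_on ::
  "(complex \<times> complex \<Rightarrow> complex) \<Rightarrow> (complex \<times> complex) set \<Rightarrow> complex \<times> complex \<Rightarrow> nat \<Rightarrow> bool" where
  "is_vanishing_order_on G V p l0 \<longleftrightarrow>
     vanishes_to_order_on G V p l0 \<and> (\<forall>l. vanishes_to_order_on G V p l \<longrightarrow> l \<le> l0)"

section \<open>Amplitude, phase and coefficients of the expansion\<close>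

definition taylor_coeff :: "(complex \<Rightarrow> complex) \<Rightarrow> nat \<Rightarrow> complex" where
  "taylor_coeff f j = (deriv ^^ j) f 0 / fact j"

definition psi ::
  "(complex \<times> complex \<Rightarrow> complex) \<Rightarrow> (complex \<Rightarrow> complex) \<Rightarrow> complex \<Rightarrow> complex" where
  "psi F g u = - Lim (at (g u)) (\<lambda>v. (v - g u) * F (u, v) / v)"

text \<open>The functions \<open>\<psi>\<^sup>~\<close> and \<open>f\<^sup>~\<close> of a real angle are extended to complex angles by the same
  formulas. They are analytic at 0, so the Taylor coefficients are those of the functions
  on the real line. The argument \<open>slope\<close> of the phase is \<open>r/s\<close>.\<close>

definition psi_tilde ::
  "(complex \<times> complex \<Rightarrow> complex) \<Rightarrow> (complex \<Rightarrow> complex) \<Rightarrow> complex \<Rightarrow> complex \<Rightarrow> complex" where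
  "psi_tilde F g z \<theta> = psi F g (z * exp (\<i> * \<theta>))"

definition f_tilde :: "(complex \<Rightarrow> complex) \<Rightarrow> complex \<Rightarrow> real \<Rightarrow> complex \<Rightarrow> complex" where
  "f_tilde g z slope \<theta> = Ln (g (z * exp (\<i> * \<theta>)) / g z) + \<i> * complex_of_real slope * \<theta>"

definition is_order_at_0 :: "(complex \<Rightarrow> complex) \<Rightarrow> nat \<Rightarrow> bool" where
  "is_order_at_0 f k \<longleftrightarrow> (\<forall>j<k. taylor_coeff f j = 0) \<and> taylor_coeff f k \<noteq> 0"

text \<open>At a strictly minimal pole the real part of \<open>c\<^sub>k\<close> is nonnegative, so the principal branch
  used by \<open>powr\<close> puts the argument of \<open>c\<^sub>k\<^bsup>1/k\<^esup>\<close> in \<open>[-\<pi>/(2k), \<pi>/(2k)]\<close>. At \<open>x = 0\<close> the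
  quotient is 0 by convention, which is its limit.\<close>

definition y_coord :: "(complex \<Rightarrow> complex) \<Rightarrow> nat \<Rightarrow> complex \<Rightarrow> complex" where
  "y_coord f k x =
     (let c = taylor_coeff f k in
        c powr (1 / of_nat k) * x * (1 + (f x - c * x ^ k) / (c * x ^ k)) powr (1 / of_nat k))"

text \<open>The choice is immaterial: two such functions agree near 0.\<close>

definition local_inverse :: "(complex \<Rightarrow> complex) \<Rightarrow> complex \<Rightarrow> complex" where
  "local_inverse y = (SOME \<eta>. \<eta> analytic_on {0} \<and> \<eta> 0 = 0 \<and>
     (\<forall>\<^sub>F x in nhds 0. \<eta> (y x) = x) \<and> (\<forall>\<^sub>F t in nhds 0. y (\<eta> t) = t))"

definition b_coeff :: "(complex \<Rightarrow> complex) \<Rightarrow> (complex \<Rightarrow> complex) \<Rightarrow> nat \<Rightarrow> nat \<Rightarrow> complex" where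
  "b_coeff \<psi>t f k l =
     (let \<eta> = local_inverse (y_coord f k) in taylor_coeff (\<lambda>t. \<psi>t (\<eta> t) * deriv \<eta> t) l)"

text \<open>For odd \<open>k\<close> the source prints the exponent of \<open>A\<close> as
  \<open>sign (Arg c\<^sub>k) i\<pi> (l - (l+1)/k)\<close>. Since \<open>calA\<close> conjugates according to the sign of
  \<open>Im c\<^sub>k\<close>, that counts the sign twice, and for \<open>Im c\<^sub>k > 0\<close> the result is the complex
  conjugate of the true constant: for \<open>c\<^sub>k = i\<close>, \<open>k = 3\<close>, \<open>l = 0\<close>, the integral of
  \<open>exp(-i x\<^sup>3)\<close> over the real line is real, but the printed formula gives it a nonzero
  imaginary part. Here the exponent carries the fixed sign -1. The values of \<open>calA\<close> are
  those of the source for even \<open>k\<close> and for \<open>Im c\<^sub>k < 0\<close>, and are corrected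
  for odd \<open>k\<close> with \<open>Im c\<^sub>k > 0\<close>.\<close>

definition A_const :: "nat \<Rightarrow> nat \<Rightarrow> complex" where
  "A_const k l =
     (if odd k then
        complex_of_real (1 / real k * Gamma ((real l + 1) / real k)) *
          (1 + exp (- (\<i> * complex_of_real (pi * (real l - (real l + 1) / real k)))))
      else if even l then complex_of_real (2 / real k * Gamma ((real l + 1) / real k))
      else 0)"

definition calA :: "complex \<Rightarrow> nat \<Rightarrow> nat \<Rightarrow> complex" where
  "calA c k l = (if Im c \<ge> 0 then A_const k l else cnj (A_const k l))"

section \<open>Asymptotic expansions\<close>

text \<open>The coefficients may depend on the point. Uniformity in parameters is encoded by
  the filter.\<close>

definition asymptotic_expansion ::
  "'x filter \<Rightarrow> ('x \<Rightarrow> complex) \<Rightarrow> nat \<Rightarrow> (nat \<Rightarrow> 'x \<Rightarrow> complex) \<Rightarrow> (nat \<Rightarrow> 'x \<Rightarrow> complex) \<Rightarrow> bool" where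
  "asymptotic_expansion Flt f l0 \<beta> g \<longleftrightarrow>
     (\<forall>l\<ge>l0. g (Suc l) \<in> o[Flt](g l)) \<and>
     (\<forall>N\<ge>l0. (\<lambda>x. f x - (\<Sum>l = l0..N. \<beta> l x * g l x)) \<in> o[Flt](g N))"

text \<open>\<open>s \<rightarrow> \<infinity>\<close>, uniformly over the poles \<open>p\<close> in \<open>K\<close> and over all \<open>r\<close> with \<open>(r,s)\<close> in the direction of \<open>p\<close>.\<close>

definition dir_filter ::
  "(complex \<times> complex \<Rightarrow> complex) \<Rightarrow> (complex \<times> complex) set \<Rightarrow> ((complex \<times> complex) \<times> nat \<times> nat) filter" where
  "dir_filter H K =
     inf (filtercomap (\<lambda>(p, r, s). s) at_top)
         (principal {(p, r, s). p \<in> K \<and> (real r, real s) \<in> dir H p})"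

end

theory Submission
  imports Defs
begin

text \<open>Extracting the coefficient of \<open>w\<^sup>s\<close> first leaves a function \<open>A\<^sub>s\<close> of the first variable that is
  holomorphic past \<open>\<bar>u\<bar> = \<bar>z\<bar>\<close>. Away from \<open>z\<close> on this circle \<open>A\<^sub>s\<close> is exponentially smaller than
  \<open>w\<^bsup>-s\<^esup>\<close>; near \<open>z\<close>, subtracting the simple pole of \<open>F(u, \<cdot>)\<close> shows
  \<open>A\<^sub>s(u) = \<psi>(u) g(u)\<^bsup>-s\<^esup>\<close> up to such an error. So \<open>a\<^bsub>r,s\<^esub> z\<^sup>r w\<^sup>s\<close> is, up to an exponentially small
  error, \<open>1/2\<pi>\<close> times the integral of \<open>exp(-s f) \<psi>\<close> over \<open>[-\<epsilon>, \<epsilon>]\<close>.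

  In the coordinate \<open>t = y(x)\<close>, where \<open>f = t\<^sup>k\<close>, the integrand is holomorphic, so each half of the path may be
  replaced by a real segment followed by an arc. Strict minimality makes \<open>Re f(\<plusminus>\<epsilon>)\<close> positive, hence
  the arc contributes an exponentially small term and the segment gives Gamma integrals. No decay of
  \<open>exp(-s f)\<close> inside the interval is needed, even when \<open>c\<^sub>k\<close> is imaginary.

  All radii and constants depend only on bounds for \<open>f\<close> and \<open>\<psi>\<close> and on a lower bound for
  \<open>\<bar>c\<^sub>k\<bar>\<close>. These are locally uniform in the pole, and compactness does the rest.\<close>

text \<open>The coefficients are built from principal branches and a chosen local inverse, so branch
  choices have to be reconciled. The left half of the interval is reflected; its phase then has
  leading coefficient \<open>(- 1) ^ k * c\<close>, and the principal k-th roots of c and (-1)^k c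
  differ by a root of unity \<kappa>. Adding the halves gives the factor 1 + (-1)^l \<kappa>^(l+1),
  which is the origin of \<open>calA\<close>. Minimality on both sides of z gives both leading
  coefficients a nonnegative real part; for odd k this makes c imaginary, and the sign of its
  imaginary part decides \<kappa>.

  The ordinary inverse function theorem yields a neighbourhood that might shrink as the pole varies,
  hence a quantitative version. Parametrizations are given separately at each pole; near a fixed
  pole all of them are compared, as germs, with a single one. The order of choices matters:
  \<epsilon> may depend only on bounds valid near the pole, while \<delta>, the lower bound for Re f
  at the ends, is read off after \<epsilon>.\<close>

section \<open>Cauchy estimates with explicit constants, and quantitative inversion\<close>

lemma taylor_coeff_bound:
  assumes "\<phi> holomorphic_on ball 0 r" "\<And>x. norm x < r \<Longrightarrow> norm (\<phi> x) \<le> M" "0 < r"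
  shows "norm (taylor_coeff \<phi> l) \<le> M * (2 / r) ^ l"
proof -
  \<comment> \<open>The bound is known only on the open disk, so Cauchy's estimate is applied on the
    circle of radius r/2; hence the 2 in the statement.\<close>
  have "norm ((deriv ^^ l) \<phi> 0) \<le> fact l * M / (r / 2) ^ l"
  proof (rule Cauchy_inequality)
    have "cball 0 (r/2) \<subseteq> ball (0::complex) r" using assms(3) by auto
    then show "continuous_on (cball 0 (r/2)) \<phi>"
      using assms(1) holomorphic_on_imp_continuous_on continuous_on_subset by blast
    show "\<phi> holomorphic_on ball 0 (r/2)"
      using assms by (auto intro: holomorphic_on_subset[OF assms(1)])
  qed (use assms in auto)
  then show ?thesis
    by (simp add: taylor_coeff_def norm_divide field_simps power_divide)
qed

lemma taylor_coeff_0 [simp]: "taylor_coeff \<phi> 0 = \<phi> 0"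
  by (simp add: taylor_coeff_def)

lemma taylor_coeff_sums:
  assumes "\<phi> holomorphic_on ball 0 r" "norm x < r"
  shows "(\<lambda>n. taylor_coeff \<phi> n * x ^ n) sums \<phi> x"
  using holomorphic_power_series[OF assms(1), of x] assms(2) by (simp add: taylor_coeff_def)

text \<open>The tail is dominated by a geometric series with ratio q = 2|x|/r. For |x| \<le> r/4
  this ratio is at most 1/2, so summing the tail costs only a factor 2.\<close>

lemma taylor_remainder_bound:
  assumes "\<phi> holomorphic_on ball 0 r" "\<And>x. norm x < r \<Longrightarrow> norm (\<phi> x) \<le> M" "0 < r" "norm x \<le> r / 4"
  shows "norm (\<phi> x - (\<Sum>l<N. taylor_coeff \<phi> l * x ^ l)) \<le> 2 * M * (2 * norm x / r) ^ N"
proof -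
  define q where "q = 2 * norm x / r"
  have q: "0 \<le> q" "q \<le> 1/2" using assms by (auto simp: q_def field_simps)
  have M: "0 \<le> M" using assms(2)[of 0] assms(3) order_trans[OF norm_ge_zero[of "\<phi> 0"]] by simp
  have sm: "(\<lambda>n. taylor_coeff \<phi> n * x ^ n) sums \<phi> x"
    using assms by (intro taylor_coeff_sums) auto
  have "\<phi> x - (\<Sum>l<N. taylor_coeff \<phi> l * x ^ l) = (\<Sum>n. taylor_coeff \<phi> (n + N) * x ^ (n + N))"
    using suminf_minus_initial_segment[OF sums_summable[OF sm], of N] sums_unique[OF sm] by simp
  also have "norm \<dots> \<le> (\<Sum>n. M * q ^ N * q ^ n)"
  proof (rule norm_suminf_le)
    fix n
    have "norm (taylor_coeff \<phi> (n + N) * x ^ (n + N)) \<le> M * (2 / r) ^ (n + N) * norm x ^ (n + N)"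
      unfolding norm_mult norm_power using taylor_coeff_bound[OF assms(1-3)]
      by (intro mult_right_mono) auto
    also have "\<dots> = M * q ^ N * q ^ n"
      by (simp add: q_def power_add power_mult_distrib power_divide mult_ac)
    finally show "norm (taylor_coeff \<phi> (n + N) * x ^ (n + N)) \<le> M * q ^ N * q ^ n" .
  next
    show "summable (\<lambda>n. M * q ^ N * q ^ n)" using q by (intro summable_mult summable_geometric) auto
  qed
  also have "\<dots> = M * q ^ N * (1 / (1 - q))"
    using q by (subst suminf_mult) (auto simp: suminf_geometric summable_geometric)
  also have "\<dots> \<le> M * q ^ N * 2"
    using q M by (intro mult_left_mono) (auto simp: field_simps)
  finally show ?thesis by (simp add: q_def)
qed

lemma taylor_coeff_cong:
  assumes "\<forall>\<^sub>F x in nhds 0. \<phi> x = \<phi>2 x"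
  shows "taylor_coeff \<phi> l = taylor_coeff \<phi>2 l"
  using higher_deriv_cong_ev[OF assms] by (simp add: taylor_coeff_def)

lemma deriv_bound_half_ball:
  assumes "\<phi> holomorphic_on ball 0 r" "\<And>x. norm x < r \<Longrightarrow> norm (\<phi> x) \<le> M" "0 < r" "norm x < r / 2"
  shows "norm (deriv \<phi> x) \<le> 4 * M / r"
proof -
  have "norm ((deriv ^^ 1) \<phi> x) \<le> fact 1 * M / (r / 4) ^ 1"
  proof (rule Cauchy_inequality)
    have *: "cball x (r/4) \<subseteq> ball 0 r"
    proof
      fix y assume "y \<in> cball x (r/4)"
      then show "y \<in> ball 0 r" using assms norm_triangle_ineq2[of y x] by (simp add: dist_norm norm_minus_commute)
    qed
    show "continuous_on (cball x (r/4)) \<phi>"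
      using assms(1) holomorphic_on_imp_continuous_on continuous_on_subset * by blast
    show "\<phi> holomorphic_on ball x (r/4)"
      using * ball_subset_cball by (blast intro: holomorphic_on_subset[OF assms(1)])
    show "norm (\<phi> y) \<le> M" if "norm (x - y) = r/4" for y
      using * that by (intro assms(2)) (auto simp: dist_norm)
  qed (use assms in auto)
  then show ?thesis by (simp add: mult.commute)
qed

text \<open>The radii depend only on the three bounds; this is the source of all uniformity in the parameter.\<close>

lemma uniform_local_inverse:
  fixes r B \<mu> :: real
  assumes "0 < r" "0 < B" "0 < \<mu>"
  obtains \<rho>1 \<rho>2 where "0 < \<rho>1" "\<rho>1 \<le> r" "0 < \<rho>2"
    "\<And>y. \<lbrakk>y holomorphic_on ball 0 r; \<And>x. norm x < r \<Longrightarrow> norm (y x) \<le> B; y 0 = 0; \<mu> \<le> norm (deriv y 0)\<rbrakk>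
      \<Longrightarrow> \<exists>\<eta>. \<eta> holomorphic_on ball 0 \<rho>2 \<and>
            (\<forall>t. norm t < \<rho>2 \<longrightarrow> norm (\<eta> t) < r \<and> y (\<eta> t) = t \<and> norm (deriv \<eta> t) \<le> 2 / \<mu>) \<and>
            (\<forall>x. norm x < \<rho>1 \<longrightarrow> norm (y x) < \<rho>2 \<and> \<eta> (y x) = x)"
proof -
  \<comment> \<open>Cauchy's estimate bounds \<open>deriv y\<close> by 4B/r on the half ball, and
    its first Taylor remainder is then at most (32 B/r^2)|x|. Within \<open>x1\<close> the
    derivative therefore stays within \<mu>/2 of \<open>deriv y 0\<close>.\<close>
  define x1 where "x1 = min (r / 8) (\<mu> * r\<^sup>2 / (64 * B))"
  \<comment> \<open>The radius that Bloch's lemma guarantees inside the image of the ball of radius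
    \<open>x1 / 2\<close> when |y'(0)| is at least \<mu>.\<close>
  define \<rho>2 where "\<rho>2 = (3 - 2 * sqrt 2) * (x1 / 2) * \<mu>"
  \<comment> \<open>\<open>4 * B / r + \<mu>\<close> bounds |y x|/|x| on the ball of radius
    \<open>x1\<close>, so the smaller ball is mapped into the ball of radius
    \<open>\<rho>2\<close>.\<close>
  define \<rho>1 where "\<rho>1 = min x1 (\<rho>2 / (4 * B / r + \<mu>))"
  have x1: "0 < x1" "x1 \<le> r/8" using assms by (auto simp: x1_def)
  have s2: "0 < 3 - 2 * sqrt 2"
  proof -
    have "sqrt 2 < 1.5" by (rule real_less_lsqrt) (auto simp: power2_eq_square)
    then show ?thesis by simp
  qed
  have \<rho>2: "0 < \<rho>2" using x1 s2 assms by (simp add: \<rho>2_def)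
  have \<rho>1: "0 < \<rho>1" "\<rho>1 \<le> x1" using x1 \<rho>2 assms by (auto simp: \<rho>1_def intro!: divide_pos_pos add_pos_pos)
  have main: "\<exists>\<eta>. \<eta> holomorphic_on ball 0 \<rho>2 \<and>
            (\<forall>t. norm t < \<rho>2 \<longrightarrow> norm (\<eta> t) < r \<and> y (\<eta> t) = t \<and> norm (deriv \<eta> t) \<le> 2 / \<mu>) \<and>
            (\<forall>x. norm x < \<rho>1 \<longrightarrow> norm (y x) < \<rho>2 \<and> \<eta> (y x) = x)"
    if hol: "y holomorphic_on ball 0 r" and bd: "\<And>x. norm x < r \<Longrightarrow> norm (y x) \<le> B"
      and y0: "y 0 = 0" and mu: "\<mu> \<le> norm (deriv y 0)" for y
  proof -
    have d0: "norm (deriv y 0) \<le> 4 * B / r"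
      using deriv_bound_half_ball[OF hol bd assms(1), of 0] assms by simp
    have dy: "norm (deriv y x - deriv y 0) \<le> \<mu> / 2" if "norm x < x1" for x
    proof -
      have "norm (deriv y x - (\<Sum>l<1. taylor_coeff (deriv y) l * x ^ l)) \<le> 2 * (4 * B / r) * (2 * norm x / (r/2)) ^ 1"
      proof (rule taylor_remainder_bound)
        show "deriv y holomorphic_on ball 0 (r/2)"
          using hol assms by (intro holomorphic_on_subset[OF holomorphic_deriv[OF hol]]) auto
        show "norm (deriv y x) \<le> 4 * B / r" if "norm x < r/2" for x
          using deriv_bound_half_ball[OF hol bd assms(1)] that by simp
      qed (use that x1 assms in auto)
      also have "\<dots> = (32 * B / r\<^sup>2) * norm x" by (simp add: power2_eq_square)
      also have "\<dots> \<le> (32 * B / r\<^sup>2) * (\<mu> * r\<^sup>2 / (64 * B))"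
        using that assms by (intro mult_left_mono) (auto simp: x1_def)
      also have "\<dots> = \<mu> / 2" using assms by (simp add: field_simps)
      finally show ?thesis by simp
    qed
    have der: "(y has_field_derivative deriv y x) (at x)" if "norm x < r" for x
      using hol that by (intro holomorphic_derivI[OF hol]) auto
    \<comment> \<open>Without its linear part \<open>y\<close> is \<mu>/2-Lipschitz, while the
      linear part stretches by at least \<mu>. This gives injectivity, and with b = 0 an upper bound
      for |y x|.\<close>
    have lip: "norm ((y a - deriv y 0 * a) - (y b - deriv y 0 * b)) \<le> \<mu>/2 * norm (a - b)"
      if "norm a < x1" "norm b < x1" for a b
    proof (rule field_differentiable_bound[where S = "ball 0 x1" and f' = "\<lambda>x. deriv y x - deriv y 0"])
      fix x assume "x \<in> ball (0::complex) x1"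
      then have "norm x < x1" by simp
      then show "((\<lambda>x. y x - deriv y 0 * x) has_field_derivative deriv y x - deriv y 0) (at x within ball 0 x1)"
        using x1 der[of x] assms(1) by (auto intro!: derivative_eq_intros intro: has_field_derivative_at_within)
      show "norm (deriv y x - deriv y 0) \<le> \<mu>/2" using dy \<open>norm x < x1\<close> by auto
    qed (use that in auto)
    have inj: "inj_on y (ball 0 x1)"
    proof (rule inj_onI)
      fix a b assume ab: "a \<in> ball 0 x1" "b \<in> ball 0 x1" "y a = y b"
      then have "norm (deriv y 0 * (a - b)) \<le> \<mu>/2 * norm (a - b)"
        using lip[of a b] by (simp add: algebra_simps norm_minus_commute)
      then have "\<mu> * norm (a - b) \<le> \<mu>/2 * norm (a - b)"
        using mult_right_mono[OF mu norm_ge_zero[of "a - b"]] by (simp add: norm_mult)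
      then show "a = b" using assms by (simp add: field_simps)
    qed
    have holx1: "y holomorphic_on ball 0 x1"
      using x1 assms by (intro holomorphic_on_subset[OF hol]) auto
    obtain \<eta> where \<eta>: "\<eta> holomorphic_on y ` ball 0 x1"
       "\<And>z. z \<in> ball 0 x1 \<Longrightarrow> deriv y z * deriv \<eta> (y z) = 1" "\<And>z. z \<in> ball 0 x1 \<Longrightarrow> \<eta> (y z) = z"
      using holomorphic_has_inverse[OF holx1 open_ball inj] by blast
    have "ball (y 0) ((3 - 2 * sqrt 2) * (x1/2) * norm (deriv y 0)) \<subseteq> y ` ball 0 (x1/2)"
    proof (rule Bloch_lemma)
      show "y holomorphic_on cball 0 (x1/2)"
        using x1 assms by (intro holomorphic_on_subset[OF hol]) auto
      fix z assume "z \<in> ball (0::complex) (x1/2)"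
      then have "norm (deriv y z - deriv y 0) \<le> \<mu> / 2" using x1 by (intro dy) auto
      then show "norm (deriv y z) \<le> 2 * norm (deriv y 0)"
        using norm_triangle_ineq2[of "deriv y z" "deriv y 0"] mu assms by linarith
    qed (use x1 in auto)
    moreover have "ball (0::complex) \<rho>2 \<subseteq> ball (y 0) ((3 - 2 * sqrt 2) * (x1/2) * norm (deriv y 0))"
      unfolding y0 \<rho>2_def using mu x1 s2 by (intro subset_ball mult_left_mono) auto
    ultimately have img: "ball 0 \<rho>2 \<subseteq> y ` ball 0 (x1/2)" by blast
    have img': "ball 0 \<rho>2 \<subseteq> y ` ball 0 x1" using img x1 by force
    show ?thesis
    proof (intro exI[of _ \<eta>] conjI allI impI)
      show "\<eta> holomorphic_on ball 0 \<rho>2" using \<eta>(1) img' holomorphic_on_subset by blast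
    next
      fix t :: complex assume "norm t < \<rho>2"
      then obtain x where x: "norm x < x1" "y x = t" using img' by force
      then show "norm (\<eta> t) < r" "y (\<eta> t) = t" using \<eta>(3)[of x] x1 assms by auto
      have "norm (deriv y x) \<ge> \<mu> / 2"
        using dy[of x] x norm_triangle_ineq2[of "deriv y 0" "deriv y 0 - deriv y x"] mu
        by (simp add: norm_minus_commute)
      moreover have "norm (deriv \<eta> t) * norm (deriv y x) = 1"
        using \<eta>(2)[of x] x by (metis norm_mult norm_one mult.commute mem_ball_0)
      ultimately have "norm (deriv \<eta> t) * (\<mu>/2) \<le> 1"
        by (metis mult_left_mono norm_ge_zero)
      then show "norm (deriv \<eta> t) \<le> 2 / \<mu>" using assms by (simp add: field_simps)
    next
      fix x :: complex assume x: "norm x < \<rho>1"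
      then show "\<eta> (y x) = x" using \<rho>1 by (intro \<eta>(3)) auto
      have "norm (y x - deriv y 0 * x) \<le> \<mu>/2 * norm x"
        using lip[of x 0] x \<rho>1 x1 y0 by simp
      then have "norm (y x) \<le> \<mu>/2 * norm x + norm (deriv y 0) * norm x"
        using norm_triangle_ineq2[of "y x" "deriv y 0 * x"] by (simp add: norm_mult)
      also have "\<dots> \<le> \<mu>/2 * norm x + (4 * B / r) * norm x"
        using d0 by (intro add_left_mono mult_right_mono) auto
      also have "\<dots> \<le> (4 * B / r + \<mu>) * norm x" using assms by (simp add: algebra_simps)
      also have "\<dots> < \<rho>2"
      proof -
        have pos: "0 < 4 * B / r + \<mu>" using assms by (intro add_pos_pos) auto
        have "norm x < \<rho>2 / (4 * B / r + \<mu>)" using x by (simp add: \<rho>1_def)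
        then show ?thesis using pos by (simp add: pos_less_divide_eq mult.commute)
      qed
      finally show "norm (y x) < \<rho>2" .
    qed
  qed
  have "\<rho>1 \<le> r" using \<rho>1 x1 assms by linarith
  then show ?thesis using that[OF \<rho>1(1) _ \<rho>2 main] by blast
qed

section \<open>The coordinate in which the phase is a pure power\<close>

lemma powr_inverse_nat_power:
  fixes z :: complex assumes "0 < k" shows "(z powr (1 / of_nat k)) ^ k = z"
  using assms by (cases "z = 0") (auto simp: powr_power)

text \<open>Factor f x = c x^k (1 + h x). The Taylor remainder gives |h x| \<le> L|x| with L
  depending only on \<tau>, M, m and k. Once r L \<le> 1/2, the value 1 + h x stays in the right
  half plane, where the principal k-th root is holomorphic.\<close>

lemma y_coord_uniform:
  fixes \<tau> M m :: real
  assumes "0 < \<tau>" "0 < M" "0 < m" "0 < k"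
  obtains r where "0 < r" "r \<le> \<tau>"
    "\<And>f. \<lbrakk>f holomorphic_on ball 0 \<tau>; \<And>x. norm x < \<tau> \<Longrightarrow> norm (f x) \<le> M; is_order_at_0 f k;
            m \<le> norm (taylor_coeff f k)\<rbrakk>
      \<Longrightarrow> y_coord f k holomorphic_on ball 0 r \<and> y_coord f k 0 = 0 \<and>
          deriv (y_coord f k) 0 = taylor_coeff f k powr (1 / of_nat k) \<and>
          (\<forall>x. norm x < r \<longrightarrow> norm (y_coord f k x) \<le> 1 + M \<and> (y_coord f k x) ^ k = f x \<and>
              norm ((f x - taylor_coeff f k * x ^ k) / (taylor_coeff f k * x ^ k)) \<le> 1/2)"
proof -
  \<comment> \<open>The remainder 2M(2|x|/\<tau>)^(k+1), divided by the lower bound m|x|^k of the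
    leading term, is L|x|.\<close>
  define L where "L = 2 * M * (2 / \<tau>) ^ Suc k / m"
  define r where "r = min (\<tau> / 4) (1 / (2 * L))"
  have L: "0 < L" using assms by (simp add: L_def)
  have r: "0 < r" "r \<le> \<tau>/4" "r * L \<le> 1/2" using assms L by (auto simp: r_def field_simps min_def)
  have "y_coord f k holomorphic_on ball 0 r \<and> y_coord f k 0 = 0 \<and>
          deriv (y_coord f k) 0 = taylor_coeff f k powr (1 / of_nat k) \<and>
          (\<forall>x. norm x < r \<longrightarrow> norm (y_coord f k x) \<le> 1 + M \<and> (y_coord f k x) ^ k = f x \<and>
              norm ((f x - taylor_coeff f k * x ^ k) / (taylor_coeff f k * x ^ k)) \<le> 1/2)"
    if hol: "f holomorphic_on ball 0 \<tau>" and bd: "\<And>x. norm x < \<tau> \<Longrightarrow> norm (f x) \<le> M"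
      and ord: "is_order_at_0 f k" and m: "m \<le> norm (taylor_coeff f k)" for f
  proof -
    define c where "c = taylor_coeff f k"
    define h where "h x = (f x - c * x ^ k) / (c * x ^ k)" for x
    define E where "E x = (1 + h x) powr (1 / of_nat k)" for x
    have y: "y_coord f k = (\<lambda>x. c powr (1 / of_nat k) * x * E x)"
      by (simp add: fun_eq_iff y_coord_def Let_def c_def h_def E_def)
    have c: "m \<le> norm c" "c \<noteq> 0" using m assms by (auto simp: c_def)
    have f0: "f 0 = 0" using ord assms by (auto simp: is_order_at_0_def dest: spec[of _ 0])
    have hb: "norm (h x) \<le> L * norm x" if "norm x < r" for x
    proof (cases "x = 0")
      case True then show ?thesis using assms f0 by (simp add: h_def)
    next
      case False
      have "(\<Sum>l<Suc k. taylor_coeff f l * x ^ l) = c * x ^ k"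
        using ord by (simp add: is_order_at_0_def c_def)
      then have "norm (f x - c * x ^ k) \<le> 2 * M * (2 * norm x / \<tau>) ^ Suc k"
        using taylor_remainder_bound[OF hol bd assms(1), where N = "Suc k" and x = x] that r by simp
      then have "norm (h x) \<le> 2 * M * (2 * norm x / \<tau>) ^ Suc k / (norm c * norm x ^ k)"
        unfolding h_def norm_divide norm_mult norm_power by (rule divide_right_mono) simp
      also have "\<dots> \<le> 2 * M * (2 * norm x / \<tau>) ^ Suc k / (m * norm x ^ k)"
        using c False assms by (intro divide_left_mono mult_right_mono) auto
      also have "\<dots> = L * norm x"
        using False by (simp add: L_def field_simps power_mult_distrib power_divide)
      finally show ?thesis .
    qed
    have hb2: "norm (h x) \<le> 1/2" if "norm x < r" for x
    proof -
      have "L * norm x \<le> L * r" using that L by (intro mult_left_mono) auto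
      then show ?thesis using hb[OF that] r by (simp add: mult.commute)
    qed
    have h0: "h 0 = 0" using assms by (simp add: h_def)
    \<comment> \<open>At x = 0 the quotient is 0 by the convention for division, and this is its
      limit, so the singularity is removable as it stands.\<close>
    have holh: "h holomorphic_on ball 0 r"
    proof (rule no_isolated_singularity'[where K = "{0}"])
      show "h holomorphic_on ball 0 r - {0}"
        unfolding h_def using c r assms(1)
        by (intro holomorphic_intros holomorphic_on_subset[OF hol]) auto
      have "(h \<longlongrightarrow> 0) (at 0)"
      proof (rule Lim_null_comparison)
        show "\<forall>\<^sub>F x in at 0. norm (h x) \<le> L * norm x"
          using r hb by (auto simp: eventually_at intro!: exI[of _ r])
        show "((\<lambda>x. L * norm x) \<longlongrightarrow> 0) (at (0::complex))"
          by (auto intro!: tendsto_eq_intros)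
      qed
      then show "(h \<longlongrightarrow> h z) (at z within ball 0 r)" if "z \<in> {0}" for z
        using that h0 by (auto intro: tendsto_within_subset)
    qed auto
    have np: "1 + h x \<notin> \<real>\<^sub>\<le>\<^sub>0" if "norm x < r" for x
    proof -
      have "- Re (h x) \<le> norm (h x)" using complex_Re_le_cmod[of "- h x"] by simp
      then have "Re (1 + h x) > 0" using hb2[OF that] by simp
      then show ?thesis by (auto simp: complex_nonpos_Reals_iff)
    qed
    have holE: "E holomorphic_on ball 0 r"
      unfolding E_def using np by (intro holomorphic_intros holh) auto
    have yk: "(y_coord f k x) ^ k = f x" if "norm x < r" for x
    proof -
      have "(y_coord f k x) ^ k = c * x ^ k * (1 + h x)"
        unfolding y power_mult_distrib E_def powr_inverse_nat_power[OF assms(4)] ..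
      also have "\<dots> = f x"
        using c f0 assms by (cases "x = 0") (auto simp: h_def field_simps)
      finally show ?thesis .
    qed
    show ?thesis
    proof (intro conjI allI impI)
      show "y_coord f k holomorphic_on ball 0 r" unfolding y by (intro holomorphic_intros holE)
      show "y_coord f k 0 = 0" by (simp add: y)
      have "E field_differentiable at 0"
        using r by (intro holomorphic_on_imp_differentiable_at[OF holE]) auto
      then obtain E' where "(E has_field_derivative E') (at 0)" by (auto simp: field_differentiable_def)
      then have "(y_coord f k has_field_derivative c powr (1 / of_nat k) * E 0) (at 0)"
        unfolding y by (auto intro!: derivative_eq_intros)
      moreover have "E 0 = 1" by (simp add: E_def h0)
      ultimately show "deriv (y_coord f k) 0 = taylor_coeff f k powr (1 / of_nat k)"
        by (simp add: DERIV_imp_deriv c_def)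
    next
      fix x :: complex assume x: "norm x < r"
      show "(y_coord f k x) ^ k = f x" by (rule yk[OF x])
      have "norm (f x) \<le> M" using x r assms by (intro bd) auto
      \<comment> \<open>|y x|^k = |f x| \<le> M. A modulus above 1 + M would exceed 1, hence be at
        most its own k-th power and so at most M.\<close>
      show "norm (y_coord f k x) \<le> 1 + M"
      proof (rule ccontr)
        assume *: "\<not> ?thesis"
        then have "norm (y_coord f k x) ^ 1 \<le> norm (y_coord f k x) ^ k"
          using assms by (intro power_increasing) auto
        also have "\<dots> \<le> M" using \<open>norm (f x) \<le> M\<close> yk[OF x] by (metis norm_power)
        finally show False using * by simp
      qed
      show "norm ((f x - taylor_coeff f k * x ^ k) / (taylor_coeff f k * x ^ k)) \<le> 1/2"
        using hb2[OF x] by (simp add: h_def c_def)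
    qed
  qed
  moreover have "r \<le> \<tau>" using r assms by simp
  ultimately show ?thesis using that r(1) by blast
qed

text \<open>Where the phase has positive real part and \<open>Re c \<ge> 0\<close>, the argument of \<open>y\<close> is pinned to
  \<open>(-\<pi>/(2k), \<pi>/(2k))\<close>, so that \<open>y\<close> can be rotated to the positive axis with \<open>Re (y\<^sup>k)\<close> positive.\<close>

lemma y_coord_eq_powr:
  assumes "0 < k" "0 \<le> Re (taylor_coeff f k)" "taylor_coeff f k \<noteq> 0" "0 < x"
    and "norm ((f (of_real x) - taylor_coeff f k * of_real x ^ k) / (taylor_coeff f k * of_real x ^ k)) \<le> 1/2"
  shows "y_coord f k (of_real x) = f (of_real x) powr (1 / of_nat k)"
proof -
  define c where "c = taylor_coeff f k"
  define X :: complex where "X = of_real x"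
  define h where "h = (f X - c * X ^ k) / (c * X ^ k)"
  have fx: "f X = of_real (x ^ k) * (c * (1 + h))"
    using assms by (simp add: h_def c_def X_def field_simps)
  have "- Re h \<le> norm h" using complex_Re_le_cmod[of "- h"] by simp
  then have reh: "Re (1 + h) > 0" using assms(5) by (simp add: h_def c_def X_def)
  then have h1: "1 + h \<noteq> 0" by (metis less_irrefl zero_complex.simps(1))
  then have "\<bar>Im (Ln (1 + h))\<bar> < pi/2" using reh Re_Ln_pos_lt[of "1 + h"] by auto
  moreover have "\<bar>Im (Ln c)\<bar> \<le> pi/2" using Re_Ln_pos_le[of c] assms by (auto simp: c_def)
  \<comment> \<open>One argument lies in [-\<pi>/2, \<pi>/2], the other strictly inside, so their
    sum stays in (-\<pi>, \<pi>) and the principal logarithm is additive here.\<close>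
  ultimately have Ln: "Ln (c * (1 + h)) = Ln c + Ln (1 + h)"
    using h1 assms by (intro Ln_times_simple) (auto simp: c_def)
  have nz: "c \<noteq> 0" "1 + h \<noteq> 0" using assms h1 by (auto simp: c_def)
  have xk: "0 < x ^ k" using assms by simp
  have "Ln (f X) = of_real (ln (x ^ k)) + (Ln c + Ln (1 + h))"
    unfolding fx Ln[symmetric] using nz xk Ln_times_of_real[of "x ^ k" "c * (1 + h)"] Ln_of_real[OF xk] by (simp del: of_real_power)
  also have "ln (x ^ k) = of_nat k * ln x" using assms by (simp add: ln_realpow)
  finally have L: "Ln (f X) / of_nat k = of_real (ln x) + Ln c / of_nat k + Ln (1 + h) / of_nat k"
    using assms by (simp add: add_divide_distrib)
  have "f X \<noteq> 0" using nz assms(4) by (simp add: fx)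
  then have "f X powr (1 / of_nat k) = exp (of_real (ln x) + Ln c / of_nat k + Ln (1 + h) / of_nat k)"
    by (simp add: powr_def flip: L)
  also have "\<dots> = X * c powr (1 / of_nat k) * (1 + h) powr (1 / of_nat k)"
    using nz assms by (simp add: powr_def exp_add X_def exp_of_real)
  finally show ?thesis by (simp add: y_coord_def Let_def c_def h_def X_def mult_ac)
qed

section \<open>Independence of the coefficients from the choice of the inverse\<close>

text \<open>Evaluate \<open>local_inverse y (y (\<eta> t))\<close> in two ways: it is
  \<open>local_inverse y t\<close> because y (\<eta> t) = t, and it is \<eta> t because \<eta> t is
  close to 0. The function \<eta> also witnesses that the description under \<open>SOME\<close> is
  satisfiable.\<close>

lemma local_inverse_eventually_eq:
  assumes "\<eta> analytic_on {0}" "\<eta> 0 = 0" "\<forall>\<^sub>F x in nhds 0. \<eta> (y x) = x" "\<forall>\<^sub>F t in nhds 0. y (\<eta> t) = t"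
  shows "\<forall>\<^sub>F t in nhds 0. local_inverse y t = \<eta> t"
proof -
  have *: "local_inverse y analytic_on {0} \<and> local_inverse y 0 = 0 \<and>
     (\<forall>\<^sub>F x in nhds 0. local_inverse y (y x) = x) \<and> (\<forall>\<^sub>F t in nhds 0. y (local_inverse y t) = t)"
    unfolding local_inverse_def by (rule someI[of _ \<eta>]) (use assms in auto)
  have "isCont \<eta> 0" using assms(1) by (rule analytic_at_imp_isCont)
  then have "filterlim \<eta> (nhds 0) (nhds 0)" using assms(2) tendsto_at_iff_tendsto_nhds[of \<eta> 0]
    by (simp add: isCont_def)
  then have "\<forall>\<^sub>F t in nhds 0. local_inverse y (y (\<eta> t)) = \<eta> t"
    using * by (auto intro: filterlim_compose eventually_compose_filterlim)
  with assms(4) show ?thesis by eventually_elim simp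
qed

text \<open>The coefficients may be computed with any local inverse and from any functions with the
  same germs at 0. The second freedom is used when the parametrization attached to a pole is
  replaced by a fixed one.\<close>

lemma b_coeff_eq:
  assumes "\<eta> analytic_on {0}" "\<eta> 0 = 0" "\<forall>\<^sub>F x in nhds 0. \<eta> (y_coord f k x) = x"
    "\<forall>\<^sub>F t in nhds 0. y_coord f k (\<eta> t) = t"
    and eq: "\<forall>\<^sub>F x in nhds 0. f x = f' x" "\<forall>\<^sub>F x in nhds 0. \<psi> x = \<psi>' x"
  shows "b_coeff \<psi>' f' k l = taylor_coeff (\<lambda>t. \<psi> (\<eta> t) * deriv \<eta> t) l"
proof -
  have tc: "taylor_coeff f' k = taylor_coeff f k" using taylor_coeff_cong[OF eq(1)] by simp
  have yy: "\<forall>\<^sub>F x in nhds 0. y_coord f k x = y_coord f' k x"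
    using eq(1) by eventually_elim (simp add: y_coord_def tc)
  have "isCont \<eta> 0" using assms(1) by (rule analytic_at_imp_isCont)
  then have fl: "filterlim \<eta> (nhds 0) (nhds 0)" using assms(2) tendsto_at_iff_tendsto_nhds[of \<eta> 0]
    by (simp add: isCont_def)
  have "\<forall>\<^sub>F t in nhds 0. local_inverse (y_coord f' k) t = \<eta> t"
  proof (rule local_inverse_eventually_eq[OF assms(1,2)])
    show "\<forall>\<^sub>F x in nhds 0. \<eta> (y_coord f' k x) = x"
      using assms(3) yy by eventually_elim simp
    have "\<forall>\<^sub>F t in nhds 0. y_coord f k (\<eta> t) = y_coord f' k (\<eta> t)"
      by (rule eventually_compose_filterlim[OF yy fl])
    then show "\<forall>\<^sub>F t in nhds 0. y_coord f' k (\<eta> t) = t"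
      using assms(4) by eventually_elim simp
  qed
  \<comment> \<open>The derivative of the inverse enters the coefficient, so equality is needed in a
    neighbourhood of every nearby point and not merely at it.\<close>
  then have ev: "\<forall>\<^sub>F t in nhds 0. \<forall>\<^sub>F s in nhds t. local_inverse (y_coord f' k) s = \<eta> s"
    by (simp add: eventually_eventually)
  have "\<forall>\<^sub>F t in nhds 0. \<psi> (\<eta> t) = \<psi>' (\<eta> t)"
    by (rule eventually_compose_filterlim[OF eq(2) fl])
  then have "\<forall>\<^sub>F t in nhds 0. \<psi>' (local_inverse (y_coord f' k) t) * deriv (local_inverse (y_coord f' k)) t
       = \<psi> (\<eta> t) * deriv \<eta> t"
    using ev
  proof eventually_elim
    case (elim t)
    then show ?case using deriv_cong_ev[OF elim(2) refl] eventually_nhds_x_imp_x[OF elim(2)] by simp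
  qed
  then show ?thesis unfolding b_coeff_def Let_def by (rule taylor_coeff_cong)
qed

section \<open>Laplace integrals\<close>

text \<open>Beyond r/4 the number q = 4|x|/r is at least 1, so \<phi> x and each of the N Taylor
  terms are bounded by M q^N. The factor N + 2 covers these N + 1 terms as well as the factor 2 of
  the estimate inside r/4. The whole ball is needed because the Laplace segment may reach almost to
  its boundary.\<close>

lemma taylor_remainder_bound_ball:
  assumes "\<phi> holomorphic_on ball 0 r" "\<And>x. norm x < r \<Longrightarrow> norm (\<phi> x) \<le> M" "0 < r" "norm x < r"
  shows "norm (\<phi> x - (\<Sum>l<N. taylor_coeff \<phi> l * x ^ l)) \<le> (real N + 2) * M * (4 / r) ^ N * norm x ^ N"
proof -
  have M: "0 \<le> M" using assms(2)[of 0] assms(3) order_trans[OF norm_ge_zero[of "\<phi> 0"]] by simp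
  define q where "q = 4 * norm x / r"
  have q: "0 \<le> q" using assms by (simp add: q_def)
  have "norm (\<phi> x - (\<Sum>l<N. taylor_coeff \<phi> l * x ^ l)) \<le> (real N + 2) * M * q ^ N"
  proof (cases "norm x \<le> r / 4")
    case True
    have "norm (\<phi> x - (\<Sum>l<N. taylor_coeff \<phi> l * x ^ l)) \<le> 2 * M * (2 * norm x / r) ^ N"
      by (rule taylor_remainder_bound) (use assms True in auto)
    also have "\<dots> \<le> (real N + 2) * M * q ^ N"
      using M assms by (intro mult_mono power_mono) (auto simp: q_def divide_right_mono)
    finally show ?thesis .
  next
    case False
    then have q1: "1 \<le> q" using assms by (simp add: q_def field_simps)
    have "norm (\<phi> x - (\<Sum>l<N. taylor_coeff \<phi> l * x ^ l)) \<le> M + (\<Sum>l<N. norm (taylor_coeff \<phi> l * x ^ l))"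
      using assms(2)[OF assms(4)] norm_sum[of "\<lambda>l. taylor_coeff \<phi> l * x ^ l" "{..<N}"]
        norm_triangle_ineq4[of "\<phi> x" "\<Sum>l<N. taylor_coeff \<phi> l * x ^ l"] by linarith
    also have "\<dots> \<le> M * q ^ N + (\<Sum>l<N. M * q ^ N)"
    proof (intro add_mono sum_mono)
      show "M \<le> M * q ^ N" using M q1 by (simp add: mult_le_cancel_left1)
      fix l assume "l \<in> {..<N}"
      have "norm (taylor_coeff \<phi> l * x ^ l) \<le> M * (2 / r) ^ l * norm x ^ l"
        unfolding norm_mult norm_power using taylor_coeff_bound[OF assms(1-3)] by (intro mult_right_mono) auto
      also have "\<dots> = M * (2 * norm x / r) ^ l" by (simp add: power_mult_distrib power_divide)
      also have "\<dots> \<le> M * q ^ l"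
        using M assms by (intro mult_left_mono power_mono) (auto simp: q_def divide_right_mono)
      also have "\<dots> \<le> M * q ^ N" using M q1 \<open>l \<in> {..<N}\<close> by (intro mult_left_mono power_increasing) auto
      finally show "norm (taylor_coeff \<phi> l * x ^ l) \<le> M * q ^ N" .
    qed
    also have "\<dots> \<le> (real N + 2) * M * q ^ N" using M q by (simp add: algebra_simps)
    finally show ?thesis .
  qed
  then show ?thesis by (simp add: q_def power_mult_distrib power_divide)
qed

text \<open>The integral of t^l exp(-t^k) over the positive half line.\<close>

definition laplace_const :: "nat \<Rightarrow> nat \<Rightarrow> real" where
  "laplace_const k l = 1 / real k * Gamma ((real l + 1) / real k)"

lemma laplace_const_pos: "0 < k \<Longrightarrow> 0 < laplace_const k l"
  by (simp add: laplace_const_def Gamma_real_pos)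

text \<open>Substitute u = s t^k in Euler's integral for Gamma at x = (l+1)/k.\<close>

lemma has_integral_power_exp:
  assumes "0 < k" "0 < s"
  shows "((\<lambda>t. t ^ l * exp (- (s * t ^ k))) has_integral laplace_const k l * s powr (- (real l + 1) / real k)) {0..}"
proof -
  define x where "x = (real l + 1) / real k"
  have x: "0 < x" using assms by (simp add: x_def)
  define f :: "real \<Rightarrow> real" where "f = (\<lambda>t. t powr (x - 1) / exp t)"
  define g where "g t = s * t ^ k" for t :: real
  define g' where "g' t = s * (real k * t ^ (k - 1))" for t :: real
  \<comment> \<open>The substitution takes place on the open half line, where \<open>powr\<close>
    has a positive base; the endpoint is a null set.\<close>
  have open_closed: "(F has_integral y) {0..} \<longleftrightarrow> (F has_integral y) {0<..}" for F :: "real \<Rightarrow> real" and y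
    by (rule has_integral_spike_set_eq; rule negligible_subset[of "{0}"]) auto
  have fi: "(f has_integral Gamma x) {0<..}"
    unfolding f_def using Gamma_integral_real[OF x] open_closed by blast
  have ai: "f absolutely_integrable_on {0<..}"
    using fi by (intro nonnegative_absolutely_integrable_1) (auto simp: f_def integrable_on_def)
  have img: "g ` {0<..} = {0<..}"
  proof (intro equalityI subsetI)
    fix u :: real assume u: "u \<in> {0<..}"
    have "g (root k (u / s)) = u" using u assms by (simp add: g_def)
    moreover have "root k (u / s) > 0" using u assms by simp
    ultimately show "u \<in> g ` {0<..}" by (metis greaterThan_iff imageI)
  qed (use assms in \<open>auto simp: g_def\<close>)
  have inj: "inj_on g {0<..}"
    using assms by (intro inj_onI) (auto simp: g_def intro: power_eq_imp_eq_base)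
  have "(\<lambda>t. \<bar>g' t\<bar> * f (g t)) absolutely_integrable_on {0<..} \<and> integral {0<..} (\<lambda>t. \<bar>g' t\<bar> * f (g t)) = Gamma x"
  proof (rule iffD2[OF has_absolute_integral_change_of_variables_1'[where f = f and g = g and g' = g']])
    show "(g has_field_derivative g' t) (at t within {0<..})" for t
      unfolding g_def g'_def by (auto intro!: derivative_eq_intros)
    show "f absolutely_integrable_on g ` {0<..} \<and> integral (g ` {0<..}) f = Gamma x"
      unfolding img using ai fi by (simp add: integral_unique)
  qed (use inj in auto)
  then have I1: "((\<lambda>t. \<bar>g' t\<bar> * f (g t)) has_integral Gamma x) {0<..}"
    by (simp add: has_integral_integrable_integral set_lebesgue_integral_eq_integral(1))
  have I2: "\<bar>g' t\<bar> * f (g t) = (real k * s powr x) * (t ^ l * exp (- (s * t ^ k)))" if "t \<in> {0<..}" for t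
  proof -
    have t: "0 < t" using that by simp
    have tp: "t ^ j = t powr real j" for j using powr_realpow[OF t] by simp
    have "\<bar>g' t\<bar> * f (g t) = s * real k * t ^ (k - 1) * ((s * t ^ k) powr (x - 1)) * exp (- (s * t ^ k))"
      using t assms by (simp add: g'_def f_def g_def exp_minus field_simps)
    also have "(s * t ^ k) powr (x - 1) = s powr (x - 1) * t powr (real k * (x - 1))"
      unfolding tp using t assms by (simp add: powr_mult powr_powr)
    also have "s * real k * t ^ (k - 1) * (s powr (x - 1) * t powr (real k * (x - 1))) =
       real k * (s powr 1 * s powr (x - 1)) * (t powr (real (k - 1)) * t powr (real k * (x - 1)))"
      unfolding tp using assms by (simp add: mult_ac)
    also have "\<dots> = real k * s powr x * t powr (real (k - 1) + real k * (x - 1))"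
      by (simp only: powr_add[symmetric]) simp
    also have "real (k - 1) + real k * (x - 1) = real l"
    proof -
      have "real k * x = real l + 1" using assms by (simp add: x_def)
      then show ?thesis using assms by (simp add: right_diff_distrib of_nat_diff)
    qed
    also have "t powr real l = t ^ l" using t by (rule powr_realpow)
    finally show ?thesis by (simp add: mult_ac)
  qed
  have "((\<lambda>t. (real k * s powr x) * (t ^ l * exp (- (s * t ^ k)))) has_integral Gamma x) {0<..}"
    using I1 by (rule has_integral_eq[rotated]) (rule I2)
  from has_integral_mult_right[OF this, of "1 / (real k * s powr x)"]
  have *: "((\<lambda>t. t ^ l * exp (- (s * t ^ k))) has_integral Gamma x / (real k * s powr x)) {0<..}"
    using assms by simp
  have "((\<lambda>t. t ^ l * exp (- (s * t ^ k))) has_integral Gamma x / (real k * s powr x)) {0..}"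
    using * open_closed by blast
  moreover have "Gamma x / (real k * s powr x) = laplace_const k l * s powr (- (real l + 1) / real k)"
  proof -
    have ex: "- (real l + 1) / real k = - x" unfolding x_def by (rule minus_divide_left[symmetric])
    show ?thesis
      unfolding ex laplace_const_def x_def[symmetric] powr_minus by (simp add: divide_inverse)
  qed
  ultimately show ?thesis by simp
qed

text \<open>For t > R one has t^l \<le> (1/R)^(N-l) t^N, so the missing tail is charged to the
  complete integral of order N, which has the size of the error term.\<close>

lemma truncated_power_exp_bound:
  assumes "0 < k" "0 < s" "0 < R" "l \<le> N"
  shows "\<bar>laplace_const k l * s powr (- (real l + 1) / real k) - integral {0..R} (\<lambda>t. t ^ l * exp (- (s * t ^ k)))\<bar>
     \<le> (1 / R) ^ (N - l) * (laplace_const k N * s powr (- (real N + 1) / real k))"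
proof -
  define h where "h = (\<lambda>l t. t ^ l * exp (- (s * t ^ k)))"
  define G where "G l = laplace_const k l * s powr (- (real l + 1) / real k)" for l
  have hG: "(h l has_integral G l) {0..}" for l
    using has_integral_power_exp[OF assms(1,2)] by (simp add: h_def G_def)
  define J where "J = integral {0..R} (h l)"
  have "h l integrable_on {0..R}"
    unfolding h_def by (intro integrable_continuous_interval continuous_intros)
  then have "(h l has_integral J) {0..R}" by (simp add: J_def integrable_integral)
  then have "((\<lambda>t. if t \<in> {0..R} then h l t else 0) has_integral J) {0..}"
    using assms by (subst has_integral_restrict) auto
  from has_integral_diff[OF hG this]
  have d: "((\<lambda>t. h l t - (if t \<in> {0..R} then h l t else 0)) has_integral (G l - J)) {0..}" .
  have "0 \<le> G l - J" by (rule has_integral_nonneg[OF d]) (auto simp: h_def)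
  moreover have "G l - J \<le> (1 / R) ^ (N - l) * G N"
  proof (rule has_integral_le[OF d has_integral_mult_right[OF hG]])
    fix t :: real assume "t \<in> {0..}"
    show "h l t - (if t \<in> {0..R} then h l t else 0) \<le> (1 / R) ^ (N - l) * h N t"
    proof (cases "t \<le> R")
      case True with \<open>t \<in> {0..}\<close> show ?thesis using assms by (auto simp: h_def)
    next
      case False
      have "t ^ l \<le> (1 / R) ^ (N - l) * t ^ N"
      proof -
        have "t ^ l * 1 \<le> t ^ l * (t / R) ^ (N - l)"
          using False assms by (intro mult_left_mono one_le_power) auto
        also have "\<dots> = (1 / R) ^ (N - l) * (t ^ l * t ^ (N - l))" by (simp add: power_divide)
        also have "t ^ l * t ^ (N - l) = t ^ N" using assms by (simp flip: power_add)
        finally show ?thesis by simp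
      qed
      then show ?thesis using False mult_right_mono[of "t ^ l" _ "exp (- (s * t ^ k))"]
        by (simp add: h_def mult.assoc[symmetric])
    qed
  qed
  ultimately show ?thesis by (simp add: G_def J_def h_def)
qed

text \<open>Watson's lemma with an explicit constant. The Taylor polynomial is integrated over the
  whole half line after paying for the truncation, and the remainder is bounded by C t^N; both
  errors are multiples of the same Gamma integral. The constant sees \<Phi> only through C, R and
  the |b l|, which is what uniformity in the phase requires.\<close>

lemma laplace_expansion:
  fixes \<Phi> :: "real \<Rightarrow> complex" and b :: "nat \<Rightarrow> complex"
  assumes "0 < k" "0 < s" "0 < R" "continuous_on {0..R} \<Phi>"
    and rem: "\<And>t. 0 \<le> t \<Longrightarrow> t \<le> R \<Longrightarrow> norm (\<Phi> t - (\<Sum>l<N. b l * of_real t ^ l)) \<le> C * t ^ N"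
  shows "norm (integral {0..R} (\<lambda>t. of_real (exp (- (s * t ^ k))) * \<Phi> t)
      - (\<Sum>l<N. of_real (laplace_const k l * s powr (- (real l + 1) / real k)) * b l))
     \<le> (C + (\<Sum>l<N. norm (b l) * (1 / R) ^ (N - l))) * (laplace_const k N * s powr (- (real N + 1) / real k))"
proof -
  define h where "h = (\<lambda>l t. t ^ l * exp (- (s * t ^ k)))"
  define G where "G l = laplace_const k l * s powr (- (real l + 1) / real k)" for l
  define J where "J l = integral {0..R} (h l)" for l
  have hi: "(h l has_integral J l) {0..R}" for l
    unfolding J_def h_def by (intro integrable_integral integrable_continuous_interval continuous_intros)
  have GJ: "\<bar>G l - J l\<bar> \<le> (1 / R) ^ (N - l) * G N" if "l \<le> N" for l
    using truncated_power_exp_bound[OF assms(1-3) that] by (simp add: G_def J_def h_def)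
  have "0 \<le> C * R ^ N" using rem[of R] assms(3) order_trans[OF norm_ge_zero] by fastforce
  then have C: "0 \<le> C" using zero_less_power[OF assms(3), of N] by (simp add: zero_le_mult_iff)
  define rm where "rm = (\<lambda>t. of_real (exp (- (s * t ^ k))) * (\<Phi> t - (\<Sum>l<N. b l * of_real t ^ l)))"
  have rmc: "continuous_on {0..R} rm" unfolding rm_def by (intro continuous_intros assms)
  have "norm (integral {0..R} rm) \<le> integral {0..R} (\<lambda>t. C * h N t)"
  proof (rule integral_norm_bound_integral)
    show "rm integrable_on {0..R}" by (rule integrable_continuous_interval[OF rmc])
    show "(\<lambda>t. C * h N t) integrable_on {0..R}"
      unfolding h_def by (intro integrable_continuous_interval continuous_intros)
    fix t assume t: "t \<in> {0..R}"
    have "norm (rm t) = exp (- (s * t ^ k)) * norm (\<Phi> t - (\<Sum>l<N. b l * of_real t ^ l))"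
      by (simp add: rm_def norm_mult)
    also have "\<dots> \<le> exp (- (s * t ^ k)) * (C * t ^ N)" using t by (intro mult_left_mono rem) auto
    finally show "norm (rm t) \<le> C * h N t" by (simp add: h_def mult_ac)
  qed
  also have "\<dots> = C * J N" by (simp add: J_def)
  also have "\<dots> \<le> C * G N"
  proof (rule mult_left_mono[OF _ C])
    have "((\<lambda>t. if t \<in> {0..R} then h N t else 0) has_integral J N) {0..}"
      using hi[of N] assms by (subst has_integral_restrict) auto
    then show "J N \<le> G N"
      using has_integral_power_exp[OF assms(1,2), of N, folded h_def G_def]
      by (rule has_integral_le) (auto simp: h_def G_def)
  qed
  finally have b1: "norm (integral {0..R} rm) \<le> C * G N" .
  have sumi: "((\<lambda>t. \<Sum>l<N. of_real (h l t) * b l) has_integral (\<Sum>l<N. of_real (J l) * b l)) {0..R}"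
    by (intro has_integral_sum has_integral_mult_left has_integral_of_real hi) auto
  have "((\<lambda>t. rm t + (\<Sum>l<N. of_real (h l t) * b l)) has_integral (integral {0..R} rm + (\<Sum>l<N. of_real (J l) * b l))) {0..R}"
    by (intro has_integral_add sumi integrable_integral integrable_continuous_interval[OF rmc])
  moreover have "rm t + (\<Sum>l<N. of_real (h l t) * b l) = of_real (exp (- (s * t ^ k))) * \<Phi> t" for t
    by (simp add: rm_def h_def algebra_simps sum_distrib_left)
  ultimately have I: "integral {0..R} (\<lambda>t. of_real (exp (- (s * t ^ k))) * \<Phi> t) = integral {0..R} rm + (\<Sum>l<N. of_real (J l) * b l)"
    by (simp add: integral_unique)
  have "norm (\<Sum>l<N. (of_real (J l) - of_real (G l)) * b l) \<le> (\<Sum>l<N. norm (b l) * (1 / R) ^ (N - l) * G N)"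
  proof (rule sum_norm_le)
    fix l assume "l \<in> {..<N}"
    then have "\<bar>J l - G l\<bar> \<le> (1 / R) ^ (N - l) * G N" using GJ[of l] by (simp add: abs_minus_commute)
    then have "\<bar>J l - G l\<bar> * norm (b l) \<le> (1 / R) ^ (N - l) * G N * norm (b l)" by (rule mult_right_mono) simp
    then show "norm ((of_real (J l) - of_real (G l)) * b l) \<le> norm (b l) * (1 / R) ^ (N - l) * G N"
      by (simp add: norm_mult mult_ac flip: of_real_diff)
  qed
  then have b2: "norm ((\<Sum>l<N. of_real (J l) * b l) - (\<Sum>l<N. of_real (G l) * b l)) \<le> (\<Sum>l<N. norm (b l) * (1 / R) ^ (N - l)) * G N"
    by (simp add: sum_subtractf[symmetric] left_diff_distrib sum_distrib_right)
  show ?thesis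
    unfolding I G_def[symmetric]
    using b1 b2 norm_triangle_ineq[of "integral {0..R} rm" "(\<Sum>l<N. of_real (J l) * b l) - (\<Sum>l<N. of_real (G l) * b l)"]
    by (simp add: algebra_simps)
qed

text \<open>Take 1 + x \<le> exp x at x = s\<delta>/n and raise it to the n-th power, for a positive
  integer n \<ge> a.\<close>

lemma exp_decay_powr_bound:
  fixes \<delta> a :: real
  assumes "0 < \<delta>"
  obtains C where "0 < C" "\<And>s. 1 \<le> s \<Longrightarrow> exp (- (s * \<delta>)) \<le> C * s powr (- a)"
proof -
  obtain n where n: "a \<le> real n" "0 < n" using real_arch_simple[of "max 1 a"]
    by (metis max.bounded_iff less_numeral_extra(1) of_nat_0_less_iff order_less_le_trans)
  define C where "C = (real n / \<delta>) ^ n"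
  show ?thesis
  proof (rule that)
    show "0 < C" using assms n by (simp add: C_def)
    fix s :: real assume s: "1 \<le> s"
    have "(s * \<delta> / n) ^ n \<le> exp (s * \<delta> / n) ^ n"
    proof (rule power_mono)
      show "s * \<delta> / n \<le> exp (s * \<delta> / n)" using exp_ge_add_one_self[of "s * \<delta> / n"] by linarith
    qed (use s assms in auto)
    also have "\<dots> = exp (s * \<delta>)" using n by (simp flip: exp_of_nat_mult)
    finally have "s ^ n \<le> C * exp (s * \<delta>)" using assms n by (simp add: C_def power_divide power_mult_distrib field_simps)
    moreover have "s powr a \<le> s ^ n"
      using s n powr_mono[of a "real n" s] by (simp add: powr_realpow)
    ultimately have "s powr a \<le> C * exp (s * \<delta>)" by linarith
    then show "exp (- (s * \<delta>)) \<le> C * s powr (- a)"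
      using s by (simp add: powr_minus exp_minus field_simps)
  qed
qed

section \<open>The uniform expansion of one half of the integral\<close>

text \<open>Membership records what the constants may depend on: radius, upper bound, order, and a
  lower bound for the leading coefficient. The nonnegative real part of that coefficient keeps its
  principal root in the sector of half-angle \<pi>/(2k).\<close>

definition phase_class :: "real \<Rightarrow> real \<Rightarrow> real \<Rightarrow> nat \<Rightarrow> (complex \<Rightarrow> complex) set" where
  "phase_class \<tau> M m k = {f. f holomorphic_on ball 0 \<tau> \<and> (\<forall>x. norm x < \<tau> \<longrightarrow> norm (f x) \<le> M) \<and>
     is_order_at_0 f k \<and> m \<le> norm (taylor_coeff f k) \<and> 0 \<le> Re (taylor_coeff f k)}"

definition amplitude_class :: "real \<Rightarrow> real \<Rightarrow> (complex \<Rightarrow> complex) set" where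
  "amplitude_class \<tau> M = {\<psi>. \<psi> holomorphic_on ball 0 \<tau> \<and> (\<forall>x. norm x < \<tau> \<longrightarrow> norm (\<psi> x) \<le> M)}"

text \<open>The real part is R^k cos(k\<theta>), and cosine decreases on [0, \<pi>/2]. Hence on the
  arc from angle \<alpha> to the real axis, Re (t^k) is smallest where the arc starts.\<close>

lemma Re_cis_power_ge:
  assumes "0 < k" "\<bar>\<theta>\<bar> \<le> \<bar>\<alpha>\<bar>" "real k * \<bar>\<alpha>\<bar> \<le> pi / 2" "0 \<le> R"
  shows "Re ((of_real R * exp (\<i> * of_real \<alpha>)) ^ k) \<le> Re ((of_real R * exp (\<i> * of_real \<theta>)) ^ k)"
proof -
  have e: "Re ((of_real R * exp (\<i> * of_real t)) ^ k) = R ^ k * cos (real k * t)" for t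
  proof -
    have "(of_real R * exp (\<i> * of_real t)) ^ k = of_real (R ^ k) * cis (real k * t)"
      by (simp add: power_mult_distrib cis_conv_exp flip: exp_of_nat_mult) (simp add: mult_ac)
    then show ?thesis by (simp add: cis.simps)
  qed
  have c: "cos (real k * t) = cos (real k * \<bar>t\<bar>)" for t by (simp add: abs_if)
  have "cos (real k * \<bar>\<alpha>\<bar>) \<le> cos (real k * \<bar>\<theta>\<bar>)"
  proof (rule cos_monotone_0_pi_le)
    show "real k * \<bar>\<alpha>\<bar> \<le> pi" using assms(3) pi_gt_zero by linarith
  qed (use assms in \<open>auto intro: mult_left_mono\<close>)
  then show ?thesis unfolding e c[of \<alpha>] c[of \<theta>] using assms by (intro mult_left_mono) auto
qed

text \<open>Let P be a primitive of I t = exp(-s t^k) \<Phi> t on the disk. The integral over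
  [0, \<epsilon>] is P(y \<epsilon>) - P 0, the one over the real segment is P R - P 0 with R = |y
  \<epsilon>|, and the two endpoints are joined by a circular arc. \<open>\<epsilon>0\<close> is
  fixed before \<epsilon>, \<delta> and N, and C before f, \<psi> and s, since \<delta> will be read
  off at the ends of an interval already chosen.\<close>

lemma one_sided_laplace:
  fixes \<tau> M m :: real
  assumes "0 < \<tau>" "0 < M" "0 < m" "0 < k"
  obtains \<epsilon>0 where "0 < \<epsilon>0" "\<epsilon>0 < \<tau>"
    "\<And>\<epsilon> \<delta> N. \<lbrakk>0 < \<epsilon>; \<epsilon> \<le> \<epsilon>0; 0 < \<delta>\<rbrakk> \<Longrightarrow>
       \<exists>C. \<forall>f\<in>phase_class \<tau> M m k. \<forall>\<psi>\<in>amplitude_class \<tau> M. \<forall>s\<ge>1. \<delta> \<le> Re (f (of_real \<epsilon>)) \<longrightarrow>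
         norm (integral {0..\<epsilon>} (\<lambda>x. exp (- (of_real s * f (of_real x))) * \<psi> (of_real x))
           - (\<Sum>l<N. of_real (laplace_const k l * s powr (- (real l + 1) / real k)) * b_coeff \<psi> f k l))
         \<le> C * s powr (- (real N + 1) / real k)"
proof -
  obtain r where r: "0 < r" "r \<le> \<tau>" and Y:
    "\<And>f. \<lbrakk>f holomorphic_on ball 0 \<tau>; \<And>x. norm x < \<tau> \<Longrightarrow> norm (f x) \<le> M; is_order_at_0 f k;
            m \<le> norm (taylor_coeff f k)\<rbrakk>
      \<Longrightarrow> y_coord f k holomorphic_on ball 0 r \<and> y_coord f k 0 = 0 \<and>
          deriv (y_coord f k) 0 = taylor_coeff f k powr (1 / of_nat k) \<and>
          (\<forall>x. norm x < r \<longrightarrow> norm (y_coord f k x) \<le> 1 + M \<and> (y_coord f k x) ^ k = f x \<and>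
              norm ((f x - taylor_coeff f k * x ^ k) / (taylor_coeff f k * x ^ k)) \<le> 1/2)"
    by (fact y_coord_uniform[OF assms])
  \<comment> \<open>A lower bound for |c|^(1/k): a number a < \<mu> \<le> 1 has a^k \<le> a < m,
    whereas |c| is at least m.\<close>
  define \<mu> where "\<mu> = min 1 m"
  have \<mu>: "0 < \<mu>" "\<mu> \<le> 1" "\<mu> \<le> m" using assms by (auto simp: \<mu>_def)
  have M1: "0 < 1 + M" using assms by simp
  obtain \<rho>1 \<rho>2 where \<rho>: "0 < \<rho>1" "\<rho>1 \<le> r" "0 < \<rho>2" and inverse:
    "\<And>y. \<lbrakk>y holomorphic_on ball 0 r; \<And>x. norm x < r \<Longrightarrow> norm (y x) \<le> 1 + M; y 0 = 0; \<mu> \<le> norm (deriv y 0)\<rbrakk>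
      \<Longrightarrow> \<exists>\<eta>. \<eta> holomorphic_on ball 0 \<rho>2 \<and>
            (\<forall>t. norm t < \<rho>2 \<longrightarrow> norm (\<eta> t) < r \<and> y (\<eta> t) = t \<and> norm (deriv \<eta> t) \<le> 2 / \<mu>) \<and>
            (\<forall>x. norm x < \<rho>1 \<longrightarrow> norm (y x) < \<rho>2 \<and> \<eta> (y x) = x)"
    by (fact uniform_local_inverse[OF r(1) M1 \<mu>(1)])
  define M\<Phi> where "M\<Phi> = M * (2 / \<mu>)"
  have M\<Phi>: "0 < M\<Phi>" using assms \<mu> by (simp add: M\<Phi>_def)
  show ?thesis
  proof (rule that[of "\<rho>1 / 2"])
    show "0 < \<rho>1 / 2" "\<rho>1 / 2 < \<tau>" using \<rho> r by auto
    fix \<epsilon> \<delta> :: real and N :: nat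
    assume \<epsilon>: "0 < \<epsilon>" "\<epsilon> \<le> \<rho>1 / 2" and \<delta>: "0 < \<delta>"
    obtain C2 where C2: "0 < C2" "\<And>s. 1 \<le> s \<Longrightarrow> exp (- (s * \<delta>)) \<le> C2 * s powr (- ((real N + 1) / real k))"
      using exp_decay_powr_bound[OF \<delta>] by blast
    \<comment> \<open>From \<delta> \<le> Re \<xi> \<le> R^k it follows that R is at least min 1
      \<delta>. This bound is independent of the phase and controls the powers of 1/R in the Laplace
      estimate.\<close>
    define R0 where "R0 = min 1 \<delta>"
    have R0: "0 < R0" "R0 \<le> 1" "R0 \<le> \<delta>" using \<delta> by (auto simp: R0_def)
    \<comment> \<open>The constant of the Laplace estimate, with every Taylor coefficient replaced
      by its Cauchy bound and R by \<open>R0\<close>.\<close>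
    define C1 where "C1 = ((real N + 2) * M\<Phi> * (4 / \<rho>2) ^ N + (\<Sum>l<N. M\<Phi> * (2 / \<rho>2) ^ l * (1 / R0) ^ (N - l))) * laplace_const k N"
    have "norm (integral {0..\<epsilon>} (\<lambda>x. exp (- (of_real s * f (of_real x))) * \<psi> (of_real x))
           - (\<Sum>l<N. of_real (laplace_const k l * s powr (- (real l + 1) / real k)) * b_coeff \<psi> f k l))
         \<le> (C1 + M\<Phi> * \<rho>2 * pi * C2) * s powr (- (real N + 1) / real k)"
      if f: "f \<in> phase_class \<tau> M m k" and \<psi>: "\<psi> \<in> amplitude_class \<tau> M" and s: "1 \<le> s"
        and \<delta>f: "\<delta> \<le> Re (f (of_real \<epsilon>))" for f \<psi> and s :: real
    proof -
      define y where "y = y_coord f k"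
      define c where "c = taylor_coeff f k"
      have fc: "f holomorphic_on ball 0 \<tau>" "\<And>x. norm x < \<tau> \<Longrightarrow> norm (f x) \<le> M" "is_order_at_0 f k"
        "m \<le> norm c" "0 \<le> Re c"
        using f by (auto simp: phase_class_def c_def)
      have c0: "c \<noteq> 0" using fc assms by auto
      have Yf: "y holomorphic_on ball 0 r" "y 0 = 0" "deriv y 0 = c powr (1 / of_nat k)"
        "\<And>x. norm x < r \<Longrightarrow> norm (y x) \<le> 1 + M" "\<And>x. norm x < r \<Longrightarrow> y x ^ k = f x"
        "\<And>x. norm x < r \<Longrightarrow> norm ((f x - c * x ^ k) / (c * x ^ k)) \<le> 1/2"
        using Y[OF fc(1-3)] fc(4) by (auto simp: y_def c_def)
      have "\<mu> \<le> norm (deriv y 0)"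
      proof (rule ccontr)
        assume *: "\<not> ?thesis"
        then have "norm (deriv y 0) ^ k \<le> norm (deriv y 0) ^ 1"
          using assms \<mu> by (intro power_decreasing) auto
        moreover have "norm (deriv y 0) ^ k = norm c"
          using Yf(3) powr_inverse_nat_power[OF assms(4), of c] by (metis norm_power)
        ultimately show False using * fc(4) \<mu> by simp
      qed
      from inverse[OF Yf(1,4,2) this]
      obtain \<eta> where \<eta>: "\<eta> holomorphic_on ball 0 \<rho>2"
        "\<And>t. norm t < \<rho>2 \<Longrightarrow> norm (\<eta> t) < r" "\<And>t. norm t < \<rho>2 \<Longrightarrow> y (\<eta> t) = t"
        "\<And>t. norm t < \<rho>2 \<Longrightarrow> norm (deriv \<eta> t) \<le> 2 / \<mu>"
        "\<And>x. norm x < \<rho>1 \<Longrightarrow> norm (y x) < \<rho>2" "\<And>x. norm x < \<rho>1 \<Longrightarrow> \<eta> (y x) = x"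
        by blast
      define \<Phi> where "\<Phi> = (\<lambda>t. \<psi> (\<eta> t) * deriv \<eta> t)"
      have \<psi>c: "\<psi> holomorphic_on ball 0 \<tau>" "\<And>x. norm x < \<tau> \<Longrightarrow> norm (\<psi> x) \<le> M"
        using \<psi> by (auto simp: amplitude_class_def)
      have hol\<Phi>: "\<Phi> holomorphic_on ball 0 \<rho>2"
      proof -
        have "\<eta> ` ball 0 \<rho>2 \<subseteq> ball 0 \<tau>" using \<eta>(2) r by force
        then have "(\<lambda>t. \<psi> (\<eta> t)) holomorphic_on ball 0 \<rho>2"
          using holomorphic_on_compose_gen[OF \<eta>(1) \<psi>c(1)] by (simp add: o_def)
        then show ?thesis unfolding \<Phi>_def by (intro holomorphic_intros \<eta>(1)) auto
      qed
      have bd\<Phi>: "norm (\<Phi> t) \<le> M\<Phi>" if "norm t < \<rho>2" for t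
        unfolding \<Phi>_def M\<Phi>_def norm_mult using \<eta>(2,4)[OF that] r assms
        by (intro mult_mono \<psi>c(2)) auto
      have b: "b_coeff \<psi> f k l = taylor_coeff \<Phi> l" for l
        unfolding \<Phi>_def
      proof (rule b_coeff_eq)
        show "\<eta> analytic_on {0}"
          using \<eta>(1) \<rho> by (auto simp: analytic_at intro!: exI[of _ "ball 0 \<rho>2"])
        show "\<eta> 0 = 0" using \<eta>(6)[of 0] Yf(2) \<rho> by simp
        show "\<forall>\<^sub>F x in nhds 0. \<eta> (y_coord f k x) = x"
          unfolding eventually_nhds using \<eta>(6) \<rho> by (intro exI[of _ "ball 0 \<rho>1"]) (auto simp: y_def)
        show "\<forall>\<^sub>F t in nhds 0. y_coord f k (\<eta> t) = t"
          unfolding eventually_nhds using \<eta>(3) \<rho> by (intro exI[of _ "ball 0 \<rho>2"]) (auto simp: y_def)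
      qed auto
      define I where "I = (\<lambda>t. exp (- (of_real s * t ^ k)) * \<Phi> t)"
      have "I holomorphic_on ball 0 \<rho>2" unfolding I_def by (intro holomorphic_intros hol\<Phi>)
      then obtain P where P: "\<And>t. t \<in> ball 0 \<rho>2 \<Longrightarrow> (P has_field_derivative I t) (at t within ball 0 \<rho>2)"
        using holomorphic_convex_primitive'[of "ball 0 \<rho>2" I] by auto
      have P': "(P has_field_derivative I t) (at t)" if "norm t < \<rho>2" for t
        using P[of t] that by (simp add: at_within_open[of _ "ball 0 \<rho>2"])
      have int1: "integral {0..\<epsilon>} (\<lambda>x. exp (- (of_real s * f (of_real x))) * \<psi> (of_real x)) = P (y (of_real \<epsilon>)) - P 0"
      proof (rule integral_unique)
        have "((\<lambda>x. exp (- (of_real s * f (of_real x))) * \<psi> (of_real x)) has_integral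
           (P (y (of_real \<epsilon>)) - P (y (of_real 0)))) {0..\<epsilon>}"
        proof (rule fundamental_theorem_of_calculus)
          fix x assume x: "x \<in> {0..\<epsilon>}"
          define X :: complex where "X = of_real x"
          have X: "norm X < \<rho>1" "norm X < r" using x \<epsilon> \<rho> by (auto simp: X_def)
          have "((\<lambda>X. P (y X)) has_field_derivative I (y X) * deriv y X) (at X)"
            using X by (intro DERIV_chain2[OF P'] \<eta>(5) holomorphic_derivI[OF Yf(1)]) auto
          \<comment> \<open>Since \<eta> (y x) = x near X, the two derivatives multiply to 1, which
            cancels the factor \<open>deriv \<eta>\<close> inside \<Phi>.\<close>
          moreover have "I (y X) * deriv y X = exp (- (of_real s * f X)) * \<psi> X"
          proof -
            have "((\<lambda>x. \<eta> (y x)) has_field_derivative deriv \<eta> (y X) * deriv y X) (at X)"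
              using X \<eta>(5) by (intro DERIV_chain2[OF holomorphic_derivI[OF \<eta>(1)]] holomorphic_derivI[OF Yf(1)]) auto
            moreover have "((\<lambda>x. \<eta> (y x)) has_field_derivative 1) (at X)"
            proof (rule has_field_derivative_transform_within_open[where S = "ball 0 \<rho>1"])
              show "((\<lambda>x. x) has_field_derivative 1) (at X)" by (rule DERIV_ident)
            qed (use X \<eta>(6) in auto)
            ultimately have "deriv \<eta> (y X) * deriv y X = 1" by (rule DERIV_unique)
            then show ?thesis using Yf(5)[OF X(2)] \<eta>(6)[OF X(1)] by (simp add: I_def \<Phi>_def mult_ac)
          qed
          ultimately show "((\<lambda>x. P (y (of_real x))) has_vector_derivative
              exp (- (of_real s * f (of_real x))) * \<psi> (of_real x)) (at x within {0..\<epsilon>})"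
            unfolding X_def by (auto intro: has_vector_derivative_real_field)
        qed (use \<epsilon> in auto)
        then show "((\<lambda>x. exp (- (of_real s * f (of_real x))) * \<psi> (of_real x)) has_integral
           (P (y (of_real \<epsilon>)) - P 0)) {0..\<epsilon>}" using Yf(2) by simp
      qed
      define \<xi> where "\<xi> = f (of_real \<epsilon>)"
      have e1: "norm (of_real \<epsilon> :: complex) < \<rho>1" "norm (of_real \<epsilon> :: complex) < r" using \<epsilon> \<rho> by auto
      have \<xi>: "0 < Re \<xi>" "\<delta> \<le> Re \<xi>" using \<delta>f \<delta> by (auto simp: \<xi>_def)
      then have \<xi>0: "\<xi> \<noteq> 0" by auto
      have ye: "y (of_real \<epsilon>) = \<xi> powr (1 / of_nat k)"
        unfolding y_def \<xi>_def using assms(4) fc(5) c0 \<epsilon>(1) Yf(6)[OF e1(2)]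
        by (intro y_coord_eq_powr) (auto simp: c_def)
      define R where "R = norm (y (of_real \<epsilon>))"
      define \<alpha> where "\<alpha> = Im (Ln \<xi>) / real k"
      have Rk: "R ^ k = norm \<xi>" using Yf(5)[OF e1(2)] by (metis R_def \<xi>_def norm_power)
      have R: "0 \<le> R" "R < \<rho>2" using \<eta>(5)[OF e1(1)] by (auto simp: R_def)
      have RR0: "R0 \<le> R"
      proof (rule ccontr)
        assume *: "\<not> ?thesis"
        then have "R ^ k \<le> R ^ 1" using assms R R0 by (intro power_decreasing) auto
        moreover have "\<delta> \<le> R ^ k" using \<xi> complex_Re_le_cmod[of \<xi>] Rk by linarith
        ultimately show False using * R0 by simp
      qed
      have Rpos: "0 < R" using RR0 R0 by simp
      \<comment> \<open>Re \<xi> > 0 puts the argument of \<xi> within \<pi>/2, hence that of its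
        principal k-th root within \<pi>/(2k).\<close>
      have kal: "real k * \<bar>\<alpha>\<bar> \<le> pi/2"
        using Re_Ln_pos_lt[OF \<xi>0] \<xi> assms by (auto simp: \<alpha>_def abs_mult)
      have yR: "y (of_real \<epsilon>) = of_real R * exp (\<i> * of_real \<alpha>)"
      proof -
        have "y (of_real \<epsilon>) = exp (Ln \<xi> / of_nat k)" using \<xi>0 by (simp add: ye powr_def)
        also have "Ln \<xi> / of_nat k = of_real (Re (Ln \<xi>) / real k) + \<i> * of_real \<alpha>"
          by (simp add: complex_eq_iff \<alpha>_def Re_divide_of_nat Im_divide_of_nat)
        finally have *: "y (of_real \<epsilon>) = of_real (exp (Re (Ln \<xi>) / real k)) * exp (\<i> * of_real \<alpha>)"
          by (simp only: exp_add exp_of_real)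
        then have "R = exp (Re (Ln \<xi>) / real k)" by (simp add: R_def norm_mult)
        then show ?thesis using * by simp
      qed
      \<comment> \<open>The mean value inequality in the angle: |I| is at most M\<Phi>
        exp(-s\<delta>) on the arc, the radius is below \<rho>2, and the opening angle is at most
        \<pi>.\<close>
      have arc: "norm (P (y (of_real \<epsilon>)) - P (of_real R)) \<le> M\<Phi> * \<rho>2 * exp (- (s * \<delta>)) * pi"
      proof -
        define E where "E = (\<lambda>z. of_real R * exp (\<i> * z))"
        have "norm (P (E (of_real \<alpha>)) - P (E 0)) \<le> (M\<Phi> * \<rho>2 * exp (- (s * \<delta>))) * norm (of_real \<alpha> - 0 :: complex)"
        proof (rule field_differentiable_bound[where S = "closed_segment 0 (of_real \<alpha>)" and f' = "\<lambda>z. I (E z) * (\<i> * E z)"])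
          fix z :: complex assume z: "z \<in> closed_segment 0 (of_real \<alpha>)"
          then obtain u where u: "z = of_real (u * \<alpha>)" "0 \<le> u" "u \<le> 1"
            by (auto simp: closed_segment_def scaleR_conv_of_real)
          define \<theta> where "\<theta> = u * \<alpha>"
          have th: "z = of_real \<theta>" "\<bar>\<theta>\<bar> \<le> \<bar>\<alpha>\<bar>"
            using u by (auto simp: \<theta>_def abs_mult mult_left_le_one_le)
          have nE: "norm (E z) = R" using R by (simp add: E_def th norm_mult)
          have "(E has_field_derivative \<i> * E z) (at z)" unfolding E_def by (auto intro!: derivative_eq_intros)
          then have "((\<lambda>z. P (E z)) has_field_derivative I (E z) * (\<i> * E z)) (at z)"
            by (rule DERIV_chain2[OF P', rotated]) (use nE R in auto)
          then show "((\<lambda>z. P (E z)) has_field_derivative I (E z) * (\<i> * E z)) (at z within closed_segment 0 (of_real \<alpha>))"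
            by (rule has_field_derivative_at_within)
          have "\<xi> = (of_real R * exp (\<i> * of_real \<alpha>)) ^ k" using Yf(5)[OF e1(2)] yR by (simp add: \<xi>_def)
          then have "\<delta> \<le> Re (E z ^ k)"
            using Re_cis_power_ge[OF assms(4) th(2) kal R(1)] \<xi> th(1) by (simp add: E_def)
          then have "norm (exp (- (of_real s * E z ^ k))) \<le> exp (- (s * \<delta>))"
            using s by (simp add: norm_exp_eq_Re)
          then have "norm (I (E z)) \<le> exp (- (s * \<delta>)) * M\<Phi>"
            unfolding I_def norm_mult using bd\<Phi>[of "E z"] nE R by (intro mult_mono) auto
          then have "norm (I (E z)) * R \<le> (exp (- (s * \<delta>)) * M\<Phi>) * \<rho>2" using R M\<Phi> by (intro mult_mono) auto
          then show "norm (I (E z) * (\<i> * E z)) \<le> M\<Phi> * \<rho>2 * exp (- (s * \<delta>))"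
            by (simp add: norm_mult nE mult_ac)
        qed auto
        also have "\<dots> \<le> (M\<Phi> * \<rho>2 * exp (- (s * \<delta>))) * pi"
        proof (rule mult_left_mono)
          have "\<bar>\<alpha>\<bar> \<le> real k * \<bar>\<alpha>\<bar>" using assms by (simp add: mult_le_cancel_right1)
          then show "norm (of_real \<alpha> - 0 :: complex) \<le> pi" using kal pi_gt_zero by simp
        qed (use M\<Phi> \<rho> in auto)
        finally show ?thesis by (simp add: E_def yR)
      qed
      have int2: "integral {0..R} (\<lambda>t. of_real (exp (- (s * t ^ k))) * \<Phi> (of_real t)) = P (of_real R) - P 0"
      proof (rule integral_unique)
        have "((\<lambda>t. of_real (exp (- (s * t ^ k))) * \<Phi> (of_real t)) has_integral (P (of_real R) - P (of_real 0))) {0..R}"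
        proof (rule fundamental_theorem_of_calculus[OF R(1)])
          fix t assume "t \<in> {0..R}"
          then have "norm (of_real t :: complex) < \<rho>2" using R by simp
          from P'[OF this] have "((\<lambda>t. P (of_real t)) has_vector_derivative I (of_real t)) (at t within {0..R})"
            by (rule has_vector_derivative_real_field)
          then show "((\<lambda>t. P (of_real t)) has_vector_derivative of_real (exp (- (s * t ^ k))) * \<Phi> (of_real t)) (at t within {0..R})"
            by (simp add: I_def flip: exp_of_real)
        qed
        then show "((\<lambda>t. of_real (exp (- (s * t ^ k))) * \<Phi> (of_real t)) has_integral (P (of_real R) - P 0)) {0..R}" by simp
      qed
      have main: "norm (P (of_real R) - P 0 - (\<Sum>l<N. of_real (laplace_const k l * s powr (- (real l + 1) / real k)) * taylor_coeff \<Phi> l))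
         \<le> ((real N + 2) * M\<Phi> * (4 / \<rho>2) ^ N + (\<Sum>l<N. norm (taylor_coeff \<Phi> l) * (1 / R) ^ (N - l)))
            * (laplace_const k N * s powr (- (real N + 1) / real k))"
        unfolding int2[symmetric]
      proof (rule laplace_expansion)
        show "continuous_on {0..R} (\<lambda>t. \<Phi> (of_real t))"
          using R by (intro continuous_on_compose2[OF holomorphic_on_imp_continuous_on[OF hol\<Phi>]] continuous_intros) auto
        fix t :: real assume "0 \<le> t" "t \<le> R"
        then show "norm (\<Phi> (of_real t) - (\<Sum>l<N. taylor_coeff \<Phi> l * of_real t ^ l)) \<le> (real N + 2) * M\<Phi> * (4 / \<rho>2) ^ N * t ^ N"
          using taylor_remainder_bound_ball[OF hol\<Phi> bd\<Phi> \<rho>(3), of "of_real t" N] R by simp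
      qed (use assms s Rpos in auto)
      also have "\<dots> \<le> ((real N + 2) * M\<Phi> * (4 / \<rho>2) ^ N + (\<Sum>l<N. M\<Phi> * (2 / \<rho>2) ^ l * (1 / R0) ^ (N - l)))
            * (laplace_const k N * s powr (- (real N + 1) / real k))"
      proof (intro mult_right_mono add_left_mono sum_mono mult_mono power_mono)
        show "norm (taylor_coeff \<Phi> l) \<le> M\<Phi> * (2 / \<rho>2) ^ l" for l
          by (rule taylor_coeff_bound[OF hol\<Phi> bd\<Phi> \<rho>(3)])
      qed (use RR0 R0 Rpos M\<Phi> \<rho> less_imp_le[OF laplace_const_pos[OF assms(4), of N]] in \<open>auto intro!: divide_left_mono\<close>)
      also have "\<dots> = C1 * s powr (- (real N + 1) / real k)" by (simp add: C1_def)
      finally have m1: "norm (P (of_real R) - P 0 - (\<Sum>l<N. of_real (laplace_const k l * s powr (- (real l + 1) / real k)) * b_coeff \<psi> f k l))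
         \<le> C1 * s powr (- (real N + 1) / real k)" by (simp add: b)
      have "M\<Phi> * \<rho>2 * exp (- (s * \<delta>)) * pi \<le> M\<Phi> * \<rho>2 * (C2 * s powr (- ((real N + 1) / real k))) * pi"
        using C2(2)[OF s] M\<Phi> \<rho> by (intro mult_right_mono mult_left_mono) auto
      also have "\<dots> = M\<Phi> * \<rho>2 * pi * C2 * s powr (- (real N + 1) / real k)" by (simp only: minus_divide_left mult_ac)
      finally have m2: "norm (P (y (of_real \<epsilon>)) - P (of_real R)) \<le> M\<Phi> * \<rho>2 * pi * C2 * s powr (- (real N + 1) / real k)"
        using arc by linarith
      have split: "P (y (of_real \<epsilon>)) - P 0 - B = (P (of_real R) - P 0 - B) + (P (y (of_real \<epsilon>)) - P (of_real R))" for B by simp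
      show ?thesis unfolding int1 split distrib_right using m1 m2 by (rule norm_triangle_mono)
    qed
    then show "\<exists>C. \<forall>f\<in>phase_class \<tau> M m k. \<forall>\<psi>\<in>amplitude_class \<tau> M. \<forall>s\<ge>1. \<delta> \<le> Re (f (of_real \<epsilon>)) \<longrightarrow>
         norm (integral {0..\<epsilon>} (\<lambda>x. exp (- (of_real s * f (of_real x))) * \<psi> (of_real x))
           - (\<Sum>l<N. of_real (laplace_const k l * s powr (- (real l + 1) / real k)) * b_coeff \<psi> f k l))
         \<le> C * s powr (- (real N + 1) / real k)" by blast
  qed
qed

section \<open>Vanishing and reflection of the coefficients, and the two-sided integral\<close>

lemma taylor_coeff_scale:
  assumes "\<phi> analytic_on {0}"
  shows "taylor_coeff (\<lambda>t. c * \<phi> (a * t)) l = c * a ^ l * taylor_coeff \<phi> l"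
proof -
  obtain T where T: "open T" "0 \<in> T" "\<phi> holomorphic_on T" using assms by (auto simp: analytic_at)
  define S where "S = (\<lambda>t. a * t) -` T"
  have S: "open S" "0 \<in> S" using T by (auto simp: S_def intro!: open_vimage continuous_intros)
  have hol: "(\<lambda>t. \<phi> (a * t)) holomorphic_on S"
    using holomorphic_on_compose_gen[of "\<lambda>t. a * t" S \<phi> T] T by (auto simp: o_def S_def intro!: holomorphic_intros)
  have "(deriv ^^ l) (\<lambda>t. \<phi> (a * t)) 0 = a ^ l * (deriv ^^ l) \<phi> (a * 0)"
    using T S by (intro higher_deriv_compose_linear[where S = S and T = T]) (auto simp: S_def)
  moreover have "(deriv ^^ l) (\<lambda>t. c * \<phi> (a * t)) 0 = c * (deriv ^^ l) (\<lambda>t. \<phi> (a * t)) 0"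
    by (rule higher_deriv_cmult[OF hol S(2,1)])
  ultimately show ?thesis by (simp add: taylor_coeff_def)
qed

text \<open>Identities between coefficients concern one phase at a time, so the quantitative inverse
  is taken with \<mu> = |y'(0)| and only its germ is kept.\<close>

lemma phase_class_local_inverse:
  assumes "f \<in> phase_class \<tau> M m k" "0 < \<tau>" "0 < M" "0 < m" "0 < k"
  obtains \<eta> where "\<eta> analytic_on {0}" "\<eta> 0 = 0" "\<forall>\<^sub>F x in nhds 0. \<eta> (y_coord f k x) = x"
    "\<forall>\<^sub>F t in nhds 0. y_coord f k (\<eta> t) = t"
proof -
  obtain r where r: "0 < r" "r \<le> \<tau>" and Y:
    "\<And>f. \<lbrakk>f holomorphic_on ball 0 \<tau>; \<And>x. norm x < \<tau> \<Longrightarrow> norm (f x) \<le> M; is_order_at_0 f k;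
            m \<le> norm (taylor_coeff f k)\<rbrakk>
      \<Longrightarrow> y_coord f k holomorphic_on ball 0 r \<and> y_coord f k 0 = 0 \<and>
          deriv (y_coord f k) 0 = taylor_coeff f k powr (1 / of_nat k) \<and>
          (\<forall>x. norm x < r \<longrightarrow> norm (y_coord f k x) \<le> 1 + M \<and> (y_coord f k x) ^ k = f x \<and>
              norm ((f x - taylor_coeff f k * x ^ k) / (taylor_coeff f k * x ^ k)) \<le> 1/2)"
    by (fact y_coord_uniform[OF assms(2-5)])
  have fc: "f holomorphic_on ball 0 \<tau>" "\<And>x. norm x < \<tau> \<Longrightarrow> norm (f x) \<le> M" "is_order_at_0 f k"
    "m \<le> norm (taylor_coeff f k)" using assms(1) by (auto simp: phase_class_def)
  define y where "y = y_coord f k"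
  have Yf: "y holomorphic_on ball 0 r" "y 0 = 0" "deriv y 0 = taylor_coeff f k powr (1 / of_nat k)"
    "\<And>x. norm x < r \<Longrightarrow> norm (y x) \<le> 1 + M"
    using Y[OF fc] by (auto simp: y_def)
  have M1: "0 < 1 + M" using assms by simp
  have "deriv y 0 \<noteq> 0" using fc(4) assms by (auto simp: Yf(3))
  then have \<mu>: "0 < norm (deriv y 0)" by simp
  obtain \<rho>1 \<rho>2 where \<rho>: "0 < \<rho>1" "\<rho>1 \<le> r" "0 < \<rho>2" and inverse:
    "\<And>h. \<lbrakk>h holomorphic_on ball 0 r; \<And>x. norm x < r \<Longrightarrow> norm (h x) \<le> 1 + M; h 0 = 0; norm (deriv y 0) \<le> norm (deriv h 0)\<rbrakk>
      \<Longrightarrow> \<exists>\<eta>. \<eta> holomorphic_on ball 0 \<rho>2 \<and>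
            (\<forall>t. norm t < \<rho>2 \<longrightarrow> norm (\<eta> t) < r \<and> h (\<eta> t) = t \<and> norm (deriv \<eta> t) \<le> 2 / norm (deriv y 0)) \<and>
            (\<forall>x. norm x < \<rho>1 \<longrightarrow> norm (h x) < \<rho>2 \<and> \<eta> (h x) = x)"
    by (fact uniform_local_inverse[OF r(1) M1 \<mu>])
  from inverse[OF Yf(1,4,2) order_refl]
  obtain \<eta> where \<eta>: "\<eta> holomorphic_on ball 0 \<rho>2" "\<And>t. norm t < \<rho>2 \<Longrightarrow> y (\<eta> t) = t"
    "\<And>x. norm x < \<rho>1 \<Longrightarrow> \<eta> (y x) = x" by blast
  show ?thesis
  proof (rule that)
    show "\<eta> analytic_on {0}"
      using \<eta>(1) \<rho> by (auto simp: analytic_at intro!: exI[of _ "ball 0 \<rho>2"])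
    show "\<eta> 0 = 0" using \<eta>(3)[of 0] Yf(2) \<rho> by simp
    show "\<forall>\<^sub>F x in nhds 0. \<eta> (y_coord f k x) = x"
      unfolding eventually_nhds using \<eta>(3) \<rho> by (intro exI[of _ "ball 0 \<rho>1"]) (auto simp: y_def)
    show "\<forall>\<^sub>F t in nhds 0. y_coord f k (\<eta> t) = t"
      unfolding eventually_nhds using \<eta>(2) \<rho> by (intro exI[of _ "ball 0 \<rho>2"]) (auto simp: y_def)
  qed
qed

lemma analytic_at_0_compose:
  assumes "\<psi> analytic_on {0}" "\<eta> analytic_on {0}" "\<eta> 0 = 0"
  shows "(\<lambda>t. \<psi> (\<eta> t)) analytic_on {0}"
  using analytic_on_compose_gen[OF assms(2), of \<psi> "{0}"] assms by (simp add: o_def)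

text \<open>If j \<le> l were the index of the first nonzero coefficient of \<Phi>, then \<Phi> t /
  t^j would tend to that coefficient. But \<eta> t = O(t) makes \<Phi> t = O(t^l0) with l0 > j, so
  the same quotient tends to 0.\<close>

lemma b_coeff_eq_0:
  assumes f: "f \<in> phase_class \<tau> M m k" "0 < \<tau>" "0 < M" "0 < m" "0 < k"
    and \<psi>: "\<psi> analytic_on {0}" "\<psi> \<in> O[at 0](\<lambda>x. x ^ l0)" and "l < l0"
  shows "b_coeff \<psi> f k l = 0"
proof -
  obtain \<eta> where \<eta>: "\<eta> analytic_on {0}" "\<eta> 0 = 0" "\<forall>\<^sub>F x in nhds 0. \<eta> (y_coord f k x) = x"
    "\<forall>\<^sub>F t in nhds 0. y_coord f k (\<eta> t) = t"
    by (fact phase_class_local_inverse[OF f])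
  define \<Phi> where "\<Phi> = (\<lambda>t. \<psi> (\<eta> t) * deriv \<eta> t)"
  have b: "b_coeff \<psi> f k j = taylor_coeff \<Phi> j" for j
    unfolding \<Phi>_def by (rule b_coeff_eq[OF \<eta>]) auto
  have an: "\<Phi> analytic_on {0}"
    unfolding \<Phi>_def by (intro analytic_on_mult analytic_at_0_compose[OF \<psi>(1) \<eta>(1,2)] analytic_deriv \<eta>(1))
  obtain r where r: "\<Phi> holomorphic_on ball 0 r" "0 < r" using an unfolding analytic_on_def by auto
  show ?thesis unfolding b
  proof (rule ccontr)
    assume nz: "taylor_coeff \<Phi> l \<noteq> 0"
    have "isCont \<eta> 0" using \<eta>(1) by (rule analytic_at_imp_isCont)
    have nh: "filterlim \<eta> (nhds 0) (at 0)" using \<open>isCont \<eta> 0\<close> \<eta>(2) by (simp add: isCont_def)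
    obtain C where C: "\<forall>\<^sub>F x in at 0. norm (\<psi> x) \<le> C * norm (x ^ l0)" using \<psi>(2) by (auto elim: landau_o.bigE)
    \<comment> \<open>\<open>\<eta> t\<close> tends to 0 but is not known to avoid it, so the bound
      is extended to the point 0 by continuity before composing.\<close>
    have C': "\<forall>\<^sub>F x in nhds 0. norm (\<psi> x) \<le> C * norm (x ^ l0)"
    proof -
      have "isCont \<psi> 0" using \<psi>(1) by (rule analytic_at_imp_isCont)
      then have "((\<lambda>x. norm (\<psi> x)) \<longlongrightarrow> norm (\<psi> 0)) (at 0)" by (intro tendsto_norm) (simp add: isCont_def)
      moreover have "((\<lambda>x::complex. C * norm (x ^ l0)) \<longlongrightarrow> C * norm ((0::complex) ^ l0)) (at 0)"
        by (intro tendsto_intros)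
      ultimately have "norm (\<psi> 0) \<le> C * norm ((0::complex) ^ l0)" using C by (intro tendsto_le) auto
      with C show ?thesis by (auto simp: eventually_nhds_conv_at)
    qed
    have e1: "\<forall>\<^sub>F t in at 0. norm (\<psi> (\<eta> t)) \<le> C * norm (\<eta> t ^ l0)"
      using eventually_compose_filterlim[OF C' nh] .
    have "\<exists>j. taylor_coeff \<Phi> j \<noteq> 0" using nz by blast
    define j where "j = (LEAST j. taylor_coeff \<Phi> j \<noteq> 0)"
    have j: "taylor_coeff \<Phi> j \<noteq> 0" "j \<le> l" using LeastI[of "\<lambda>j. taylor_coeff \<Phi> j \<noteq> 0", OF nz] Least_le[of "\<lambda>j. taylor_coeff \<Phi> j \<noteq> 0", OF nz]
      unfolding j_def by blast+
    have jl: "taylor_coeff \<Phi> i = 0" if "i < j" for i using that not_less_Least unfolding j_def by blast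
    obtain M' where M': "\<And>x. norm x < r/2 \<Longrightarrow> norm (\<Phi> x) \<le> M'"
    proof -
      have "continuous_on (cball 0 (r/2)) \<Phi>"
        using r by (intro continuous_on_subset[OF holomorphic_on_imp_continuous_on[OF r(1)]]) auto
      then have "bounded (\<Phi> ` cball 0 (r/2))" by (intro compact_imp_bounded compact_continuous_image) auto
      then obtain B where "\<forall>x\<in>cball 0 (r/2). norm (\<Phi> x) \<le> B" by (auto simp: bounded_iff)
      then show ?thesis by (intro that[of B]) auto
    qed
    have r2: "\<Phi> holomorphic_on ball 0 (r/2)" using r by (auto intro: holomorphic_on_subset)
    have "((\<lambda>t. \<Phi> t / t ^ j) \<longlongrightarrow> taylor_coeff \<Phi> j) (at 0)"
    proof (rule LIM_zero_cancel, rule Lim_null_comparison)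
      define D where "D = (real (Suc j) + 2) * M' * (4 / (r/2)) ^ Suc j"
      show "((\<lambda>t::complex. D * norm t) \<longlongrightarrow> 0) (at 0)" by (auto intro!: tendsto_eq_intros)
      show "\<forall>\<^sub>F t in at 0. norm (\<Phi> t / t ^ j - taylor_coeff \<Phi> j) \<le> D * norm t"
        unfolding eventually_at
      proof (intro exI[of _ "r/2"] conjI ballI impI)
        fix t :: complex assume t: "t \<noteq> 0 \<and> dist t 0 < r/2"
        have "(\<Sum>l<Suc j. taylor_coeff \<Phi> l * t ^ l) = taylor_coeff \<Phi> j * t ^ j" using jl by simp
        then have "norm (\<Phi> t - taylor_coeff \<Phi> j * t ^ j) \<le> D * norm t ^ Suc j"
          using taylor_remainder_bound_ball[OF r2 M', of t "Suc j"] t r by (simp add: D_def)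
        then have "norm (\<Phi> t - taylor_coeff \<Phi> j * t ^ j) / norm t ^ j \<le> D * norm t ^ Suc j / norm t ^ j"
          by (rule divide_right_mono) auto
        moreover have "\<Phi> t / t ^ j - taylor_coeff \<Phi> j = (\<Phi> t - taylor_coeff \<Phi> j * t ^ j) / t ^ j"
          using t by (simp add: field_simps)
        ultimately show "norm (\<Phi> t / t ^ j - taylor_coeff \<Phi> j) \<le> D * norm t"
          using t by (simp add: norm_divide norm_power)
      qed (use r in auto)
    qed
    moreover have "((\<lambda>t. \<Phi> t / t ^ j) \<longlongrightarrow> 0) (at 0)"
    proof (rule Lim_null_comparison)
      have d: "(\<eta> has_field_derivative deriv \<eta> 0) (at 0)"
        using \<eta>(1) by (simp add: analytic_on_imp_differentiable_at field_differentiable_derivI)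
      then have l1: "((\<lambda>t. \<eta> t / t) \<longlongrightarrow> deriv \<eta> 0) (at 0)" using \<eta>(2) by (simp add: has_field_derivative_iff)
      have "isCont (deriv \<eta>) 0" using analytic_deriv[OF \<eta>(1)] by (rule analytic_at_imp_isCont)
      then have l2: "(deriv \<eta> \<longlongrightarrow> deriv \<eta> 0) (at 0)" by (simp add: isCont_def)
      show "((\<lambda>t. C * norm (\<eta> t / t) ^ l0 * norm t ^ (l0 - j) * norm (deriv \<eta> t)) \<longlongrightarrow> 0) (at 0)"
      proof -
        have "l0 - j > 0" using j assms by simp
        moreover have "((\<lambda>t. C * norm (\<eta> t / t) ^ l0 * norm t ^ (l0 - j) * norm (deriv \<eta> t)) \<longlongrightarrow>
            C * norm (deriv \<eta> 0) ^ l0 * norm (0::complex) ^ (l0 - j) * norm (deriv \<eta> 0)) (at 0)"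
          by (intro tendsto_mult tendsto_const tendsto_power tendsto_norm l1 l2 tendsto_ident_at)
        ultimately show ?thesis by (simp add: power_0_left)
      qed
      have "\<forall>\<^sub>F t in at (0::complex). t \<noteq> 0" by (simp add: eventually_at_filter)
      then show "\<forall>\<^sub>F t in at 0. norm (\<Phi> t / t ^ j) \<le> C * norm (\<eta> t / t) ^ l0 * norm t ^ (l0 - j) * norm (deriv \<eta> t)"
        using e1
      proof eventually_elim
        case (elim t)
        have "norm (\<Phi> t / t ^ j) = norm (\<psi> (\<eta> t)) * norm (deriv \<eta> t) / norm t ^ j"
          by (simp add: \<Phi>_def norm_divide norm_mult norm_power)
        also have "\<dots> \<le> C * norm (\<eta> t ^ l0) * norm (deriv \<eta> t) / norm t ^ j"
          using elim by (intro divide_right_mono mult_right_mono) auto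
        also have "\<dots> = C * norm (\<eta> t / t) ^ l0 * (norm t ^ l0 / norm t ^ j) * norm (deriv \<eta> t)"
          using elim by (simp add: norm_divide norm_power power_divide)
        also have "norm t ^ l0 / norm t ^ j = norm t ^ (l0 - j)"
          using elim j assms by (simp add: power_diff)
        finally show ?case .
      qed
    qed
    ultimately have "taylor_coeff \<Phi> j = 0" by (intro tendsto_unique[of "at 0"]) auto
    then show False using j by simp
  qed
qed

lemma taylor_coeff_reflect:
  assumes "\<phi> analytic_on {0}"
  shows "taylor_coeff (\<lambda>x. \<phi> (- x)) l = (- 1) ^ l * taylor_coeff \<phi> l"
  using taylor_coeff_scale[OF assms, of 1 "-1" l] by simp

text \<open>The coordinate of the reflected phase is x \<mapsto> -(1/\<kappa>) y(-x), where \<kappa>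
  compares the principal roots of c and (-1)^k c. Solving for x gives the inverse t \<mapsto>
  -\<eta>(-\<kappa> t), so the transformed amplitude is \<kappa> \<Phi>(-\<kappa> t), and its l-th
  coefficient carries the factor \<kappa> (-\<kappa>)^l.\<close>

lemma b_coeff_reflect:
  assumes f: "f \<in> phase_class \<tau> M m k" "0 < \<tau>" "0 < M" "0 < m" "0 < k"
    and \<psi>: "\<psi> analytic_on {0}"
    and \<kappa>: "\<kappa> = taylor_coeff f k powr (1 / of_nat k) / ((- 1) ^ k * taylor_coeff f k) powr (1 / of_nat k)"
  shows "b_coeff (\<lambda>x. \<psi> (- x)) (\<lambda>x. f (- x)) k l = (- 1) ^ l * \<kappa> ^ Suc l * b_coeff \<psi> f k l"
proof -
  define c where "c = taylor_coeff f k"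
  have anf: "f analytic_on {0}" using f by (auto simp: phase_class_def analytic_at intro!: exI[of _ "ball 0 \<tau>"])
  have c0: "c \<noteq> 0" using f by (auto simp: c_def phase_class_def)
  have \<kappa>0: "\<kappa> \<noteq> 0" using c0 by (simp add: \<kappa> c_def)
  obtain \<eta> where \<eta>: "\<eta> analytic_on {0}" "\<eta> 0 = 0" "\<forall>\<^sub>F x in nhds 0. \<eta> (y_coord f k x) = x"
    "\<forall>\<^sub>F t in nhds 0. y_coord f k (\<eta> t) = t"
    by (fact phase_class_local_inverse[OF f])
  have y: "y_coord (\<lambda>x. f (- x)) k x = - (1 / \<kappa>) * y_coord f k (- x)" for x
  proof -
    have tc: "taylor_coeff (\<lambda>x. f (- x)) k = (- 1) ^ k * c" using taylor_coeff_reflect[OF anf] by (simp add: c_def)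
    have pw: "(- 1) ^ k * c * x ^ k = c * (- x) ^ k" by (simp add: power_minus[of x])
    have cp: "((- 1) ^ k * c) powr (1 / of_nat k) = (1 / \<kappa>) * c powr (1 / of_nat k)"
      using c0 by (simp add: \<kappa> c_def)
    show ?thesis unfolding y_coord_def Let_def tc c_def[symmetric] pw cp by (simp add: mult_ac)
  qed
  define \<eta>' where "\<eta>' = (\<lambda>t. - \<eta> (- \<kappa> * t))"
  have sc: "filterlim (\<lambda>t. a * t) (nhds 0) (nhds (0::complex))" for a
    using tendsto_mult[OF tendsto_const[of a] filterlim_ident[of "nhds (0::complex)"]] by simp
  have lin: "(\<lambda>t. - \<kappa> * t) analytic_on {0}" by (intro analytic_intros)
  have cmp: "(\<lambda>t. \<eta> (- \<kappa> * t)) analytic_on {0}" by (intro analytic_at_0_compose[OF \<eta>(1) lin]) simp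
  have b': "b_coeff (\<lambda>x. \<psi> (- x)) (\<lambda>x. f (- x)) k l = taylor_coeff (\<lambda>t. \<psi> (- \<eta>' t) * deriv \<eta>' t) l"
  proof (rule b_coeff_eq)
    show "\<eta>' analytic_on {0}" unfolding \<eta>'_def by (intro analytic_intros cmp)
    show "\<eta>' 0 = 0" by (simp add: \<eta>'_def \<eta>)
    have "\<forall>\<^sub>F x in nhds 0. \<eta> (y_coord f k (- 1 * x)) = - 1 * x"
      by (rule eventually_compose_filterlim[OF \<eta>(3) sc])
    then show "\<forall>\<^sub>F x in nhds 0. \<eta>' (y_coord (\<lambda>x. f (- x)) k x) = x"
      by eventually_elim (simp add: y \<eta>'_def \<kappa>0)
    have "\<forall>\<^sub>F t in nhds 0. y_coord f k (\<eta> (- \<kappa> * t)) = - \<kappa> * t"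
      by (rule eventually_compose_filterlim[OF \<eta>(4) sc])
    then show "\<forall>\<^sub>F t in nhds 0. y_coord (\<lambda>x. f (- x)) k (\<eta>' t) = t"
      by eventually_elim (simp add: y \<eta>'_def \<kappa>0)
  qed auto
  define \<Phi> where "\<Phi> = (\<lambda>t. \<psi> (\<eta> t) * deriv \<eta> t)"
  have b: "b_coeff \<psi> f k l = taylor_coeff \<Phi> l"
    unfolding \<Phi>_def by (rule b_coeff_eq[OF \<eta>]) auto
  have an: "\<Phi> analytic_on {0}"
    unfolding \<Phi>_def by (intro analytic_on_mult analytic_at_0_compose[OF \<psi> \<eta>(1,2)] analytic_deriv \<eta>(1))
  have "\<forall>\<^sub>F t in nhds 0. \<psi> (- \<eta>' t) * deriv \<eta>' t = \<kappa> * \<Phi> (- \<kappa> * t)"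
  proof -
    have "\<forall>\<^sub>F t in nhds 0. \<eta> analytic_on {t}" using \<eta>(1) by (auto simp: eventually_nhds analytic_at)
    then have "\<forall>\<^sub>F t in nhds 0. \<eta> analytic_on {- \<kappa> * t}" by (rule eventually_compose_filterlim[OF _ sc])
    then show ?thesis
    proof eventually_elim
      case (elim t)
      have "(\<eta> has_field_derivative deriv \<eta> (- \<kappa> * t)) (at (- \<kappa> * t))"
        using elim by (simp add: analytic_on_imp_differentiable_at field_differentiable_derivI)
      then have "((\<lambda>t. \<eta> (- \<kappa> * t)) has_field_derivative deriv \<eta> (- \<kappa> * t) * (- \<kappa>)) (at t)"
        by (rule DERIV_chain2) (auto intro!: derivative_eq_intros)
      then have "(\<eta>' has_field_derivative deriv \<eta> (- \<kappa> * t) * \<kappa>) (at t)"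
        unfolding \<eta>'_def by (auto intro!: derivative_eq_intros)
      from DERIV_imp_deriv[OF this] show ?case by (simp add: \<Phi>_def \<eta>'_def)
    qed
  qed
  then have "taylor_coeff (\<lambda>t. \<psi> (- \<eta>' t) * deriv \<eta>' t) l = taylor_coeff (\<lambda>t. \<kappa> * \<Phi> (- \<kappa> * t)) l"
    by (rule taylor_coeff_cong)
  also have "\<dots> = \<kappa> * (- \<kappa>) ^ l * taylor_coeff \<Phi> l" by (rule taylor_coeff_scale[OF an])
  finally show ?thesis unfolding b' b by (simp add: power_minus[of \<kappa>] mult_ac)
qed

text \<open>For even k the two roots agree, \<kappa> = 1, and 1 + (-1)^l is 2 or 0. For odd k one
  has c = it with t real; c and -c have arguments \<pi>/2 and -\<pi>/2, in the order given by the
  sign of t, so \<kappa> = exp(sgn(t) i\<pi>/k). Changing the sign of t conjugates the result, which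
  is the case distinction in \<open>calA\<close>.\<close>

lemma calA_eq:
  assumes "0 < k" "c \<noteq> 0" "odd k \<Longrightarrow> Re c = 0"
  shows "of_real (laplace_const k l) * (1 + (- 1) ^ l * (c powr (1 / of_nat k) / ((- 1) ^ k * c) powr (1 / of_nat k)) ^ Suc l)
     = calA c k l"
proof (cases "even k")
  case True
  then show ?thesis using assms
    by (cases "even l") (auto simp: calA_def A_const_def laplace_const_def)
next
  case False
  have odd: "odd k" using False by simp
  define t where "t = Im c"
  have c: "c = of_real t * \<i>" using assms(3)[OF odd] by (simp add: complex_eq_iff t_def)
  have t0: "t \<noteq> 0" using assms(2) c by auto
  define a where "a = pi * (real l + 1) / real k"
  define \<sigma> :: complex where "\<sigma> = of_real (sgn t)"
  have Ln1: "Ln (of_real u * \<i>) = of_real (ln \<bar>u\<bar>) + of_real (sgn u) * \<i> * of_real pi / 2" if "u \<noteq> 0" for u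
  proof (cases "u > 0")
    case True
    then show ?thesis using Ln_times_of_real[of u \<i>] Ln_of_real[of u] by simp
  next
    case False
    then have "0 < - u" using that by simp
    have "of_real u * \<i> = of_real (- u) * (- \<i>)" by simp
    also have "Ln \<dots> = of_real (ln (- u)) + Ln (- \<i>)"
      using Ln_times_of_real[OF \<open>0 < - u\<close>, of "- \<i>"] Ln_of_real[OF \<open>0 < - u\<close>] by simp
    finally show ?thesis using \<open>0 < - u\<close> by simp
  qed
  have "c powr (1 / of_nat k) / ((- 1) ^ k * c) powr (1 / of_nat k) = exp ((Ln c - Ln (- c)) / of_nat k)"
    using assms(2) odd by (simp add: powr_def exp_diff diff_divide_distrib)
  also have "Ln c - Ln (- c) = \<sigma> * \<i> * of_real pi"
    using Ln1[OF t0] Ln1[of "- t"] t0 by (simp add: c \<sigma>_def sgn_minus)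
  finally have "(c powr (1 / of_nat k) / ((- 1) ^ k * c) powr (1 / of_nat k)) ^ Suc l = exp (\<sigma> * \<i> * of_real pi / of_nat k) ^ Suc l"
    by simp
  also have "\<dots> = exp (\<sigma> * (\<i> * of_real (pi * (real l + 1) / real k)))"
    by (subst exp_of_nat_mult[symmetric]) (simp add: mult_ac add_ac)
  finally have pw: "(c powr (1 / of_nat k) / ((- 1) ^ k * c) powr (1 / of_nat k)) ^ Suc l
      = exp (\<sigma> * (\<i> * of_real a))" unfolding a_def .
  \<comment> \<open>The fixed sign in the exponent of \<open>A_const\<close> reproduces (-1)^l
    \<kappa>^(l+1) for t > 0, because exp(-i\<pi>l) = (-1)^l.\<close>
  have "exp (- (\<i> * of_real (pi * (real l - (real l + 1) / real k)))) =
     exp (- (\<i> * of_real (pi * real l))) * exp (\<i> * of_real (pi * (real l + 1) / real k))"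
    by (simp add: algebra_simps flip: exp_add)
  also have "exp (- (\<i> * of_real (pi * real l))) = inverse (exp (\<i> * of_real pi) ^ l)"
  proof -
    have "exp (\<i> * of_real (pi * real l)) = exp (\<i> * of_real pi) ^ l"
      by (subst exp_of_nat_mult[symmetric]) (simp add: mult_ac)
    then show ?thesis by (simp only: exp_minus)
  qed
  also have "\<dots> = (- 1) ^ l" by (cases "even l") (simp_all add: exp_pi_i')
  finally have "exp (- (\<i> * of_real (pi * (real l - (real l + 1) / real k)))) = (- 1) ^ l * exp (\<i> * of_real a)"
    unfolding a_def .
  then have A: "A_const k l = of_real (laplace_const k l) * (1 + (- 1) ^ l * exp (\<i> * of_real a))"
    unfolding A_const_def laplace_const_def using odd by simp
  show ?thesis
  proof (cases "t > 0")
    case True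
    then show ?thesis unfolding pw calA_def A using t0 by (simp add: \<sigma>_def t_def)
  next
    case False
    then have "t < 0" using t0 by simp
    moreover have "cnj (exp (\<i> * of_real a)) = exp (- (\<i> * of_real a))"
      by (simp add: exp_cnj)
    ultimately show ?thesis unfolding pw calA_def A by (simp add: \<sigma>_def t_def)
  qed
qed

lemma holomorphic_on_reflect:
  assumes "f holomorphic_on ball 0 \<tau>"
  shows "(\<lambda>x. f (- x)) holomorphic_on ball (0::complex) \<tau>"
proof -
  have "(\<lambda>x::complex. - x) holomorphic_on ball 0 \<tau>" by (intro holomorphic_intros)
  moreover have "(\<lambda>x::complex. - x) ` ball 0 \<tau> \<subseteq> ball 0 \<tau>" by auto
  ultimately show ?thesis using holomorphic_on_compose_gen[OF _ assms] by (force simp: o_def)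
qed

lemma phase_class_reflect:
  assumes "f \<in> phase_class \<tau> M m k" "0 < \<tau>" "0 \<le> Re ((- 1) ^ k * taylor_coeff f k)"
  shows "(\<lambda>x. f (- x)) \<in> phase_class \<tau> M m k"
proof -
  have hol: "f holomorphic_on ball 0 \<tau>" using assms by (auto simp: phase_class_def)
  have anf: "f analytic_on {0}" using assms(2) hol by (auto simp: analytic_at intro!: exI[of _ "ball 0 \<tau>"])
  have "(\<lambda>x. f (- x)) holomorphic_on ball 0 \<tau>" by (rule holomorphic_on_reflect[OF hol])
  then show ?thesis
    using assms by (auto simp: phase_class_def is_order_at_0_def taylor_coeff_reflect[OF anf] norm_mult norm_power)
qed

lemma amplitude_class_reflect:
  assumes "\<psi> \<in> amplitude_class \<tau> M"
  shows "(\<lambda>x. \<psi> (- x)) \<in> amplitude_class \<tau> M"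
  using assms by (auto simp: amplitude_class_def intro!: holomorphic_on_reflect)

text \<open>Split at 0 and reflect the left half. Both halves are one-sided integrals over the same
  classes with the same constant, hence the error C + C. The left coefficients differ from the right
  ones by (-1)^l \<kappa>^(l+1), and together the two halves produce \<open>calA\<close>.\<close>

lemma two_sided_laplace:
  fixes \<tau> M m :: real
  assumes "0 < \<tau>" "0 < M" "0 < m" "0 < k"
  obtains \<epsilon>0 where "0 < \<epsilon>0" "\<epsilon>0 < \<tau>"
    "\<And>\<epsilon> \<delta> N. \<lbrakk>0 < \<epsilon>; \<epsilon> \<le> \<epsilon>0; 0 < \<delta>\<rbrakk> \<Longrightarrow>
       \<exists>C. \<forall>f\<in>phase_class \<tau> M m k. \<forall>\<psi>\<in>amplitude_class \<tau> M. \<forall>s\<ge>1.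
         0 \<le> Re ((- 1) ^ k * taylor_coeff f k) \<longrightarrow> \<delta> \<le> Re (f (of_real \<epsilon>)) \<longrightarrow> \<delta> \<le> Re (f (of_real (- \<epsilon>))) \<longrightarrow>
         norm (integral {- \<epsilon>..\<epsilon>} (\<lambda>x. exp (- (of_real s * f (of_real x))) * \<psi> (of_real x))
           - (\<Sum>l<N. of_real (s powr (- (real l + 1) / real k)) * (calA (taylor_coeff f k) k l * b_coeff \<psi> f k l)))
         \<le> C * s powr (- (real N + 1) / real k)"
proof -
  obtain \<epsilon>0 where \<epsilon>0: "0 < \<epsilon>0" "\<epsilon>0 < \<tau>" and one:
    "\<And>\<epsilon> \<delta> N. \<lbrakk>0 < \<epsilon>; \<epsilon> \<le> \<epsilon>0; 0 < \<delta>\<rbrakk> \<Longrightarrow>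
       \<exists>C. \<forall>f\<in>phase_class \<tau> M m k. \<forall>\<psi>\<in>amplitude_class \<tau> M. \<forall>s\<ge>1. \<delta> \<le> Re (f (of_real \<epsilon>)) \<longrightarrow>
         norm (integral {0..\<epsilon>} (\<lambda>x. exp (- (of_real s * f (of_real x))) * \<psi> (of_real x))
           - (\<Sum>l<N. of_real (laplace_const k l * s powr (- (real l + 1) / real k)) * b_coeff \<psi> f k l))
         \<le> C * s powr (- (real N + 1) / real k)"
    by (fact one_sided_laplace[OF assms])
  show ?thesis
  proof (rule that[OF \<epsilon>0])
    fix \<epsilon> \<delta> :: real and N :: nat
    assume \<epsilon>: "0 < \<epsilon>" "\<epsilon> \<le> \<epsilon>0" "0 < \<delta>"
    from one[OF \<epsilon>, of N] obtain C where C0: "\<forall>f\<in>phase_class \<tau> M m k. \<forall>\<psi>\<in>amplitude_class \<tau> M. \<forall>s\<ge>1.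
         \<delta> \<le> Re (f (of_real \<epsilon>)) \<longrightarrow>
         norm (integral {0..\<epsilon>} (\<lambda>x. exp (- (of_real s * f (of_real x))) * \<psi> (of_real x))
           - (\<Sum>l<N. of_real (laplace_const k l * s powr (- (real l + 1) / real k)) * b_coeff \<psi> f k l))
         \<le> C * s powr (- (real N + 1) / real k)" ..
    note C = C0[rule_format]
    have key: "norm (integral {- \<epsilon>..\<epsilon>} (\<lambda>x. exp (- (of_real s * f (of_real x))) * \<psi> (of_real x))
           - (\<Sum>l<N. of_real (s powr (- (real l + 1) / real k)) * (calA (taylor_coeff f k) k l * b_coeff \<psi> f k l)))
         \<le> (C + C) * s powr (- (real N + 1) / real k)"
      if f: "f \<in> phase_class \<tau> M m k" and \<psi>: "\<psi> \<in> amplitude_class \<tau> M" and s: "1 \<le> s"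
       and re: "0 \<le> Re ((- 1) ^ k * taylor_coeff f k)"
       and d: "\<delta> \<le> Re (f (of_real \<epsilon>))" "\<delta> \<le> Re (f (of_real (- \<epsilon>)))" for f \<psi> and s :: real
    proof -
      define G where "G = (\<lambda>x. exp (- (of_real s * f (of_real x))) * \<psi> (of_real x))"
      have hol: "f holomorphic_on ball 0 \<tau>" "\<psi> holomorphic_on ball 0 \<tau>"
        using f \<psi> by (auto simp: phase_class_def amplitude_class_def)
      have an: "\<psi> analytic_on {0}" using assms(1) hol by (auto simp: analytic_at intro!: exI[of _ "ball 0 \<tau>"])
      have "continuous_on {- \<epsilon>..\<epsilon>} G"
        unfolding G_def using \<epsilon> \<epsilon>0
        by (intro continuous_intros continuous_on_compose2[OF holomorphic_on_imp_continuous_on[OF hol(1)]]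
             continuous_on_compose2[OF holomorphic_on_imp_continuous_on[OF hol(2)]]) auto
      then have "G integrable_on {- \<epsilon>..\<epsilon>}" by (rule integrable_continuous_interval)
      then have "integral {- \<epsilon>..\<epsilon>} G = integral {- \<epsilon>..0} G + integral {0..\<epsilon>} G"
        using \<epsilon> by (simp add: Henstock_Kurzweil_Integration.integral_combine)
      also have "integral {- \<epsilon>..0} G = integral {0..\<epsilon>} (\<lambda>x. G (- x))"
        using Henstock_Kurzweil_Integration.integral_reflect_real[of 0 "- \<epsilon>" G] by simp
      finally have I: "integral {- \<epsilon>..\<epsilon>} G = integral {0..\<epsilon>} (\<lambda>x. G (- x)) + integral {0..\<epsilon>} G" .
      define c where "c = taylor_coeff f k"
      define \<kappa> where "\<kappa> = c powr (1 / of_nat k) / ((- 1) ^ k * c) powr (1 / of_nat k)"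
      define p where "p = (\<lambda>l. s powr (- (real l + 1) / real k))"
      have c: "c \<noteq> 0" "0 \<le> Re c" using f assms by (auto simp: c_def phase_class_def)
      \<comment> \<open>For odd k the two sign conditions read Re c \<ge> 0 and Re (-c) \<ge>
        0.\<close>
      have odd: "Re c = 0" if "odd k" using c re that by (simp add: c_def)
      have b1: "norm (integral {0..\<epsilon>} G - (\<Sum>l<N. of_real (laplace_const k l * p l) * b_coeff \<psi> f k l)) \<le> C * p N"
        using C[OF f \<psi> s d(1)] by (simp add: G_def p_def)
      have b2: "norm (integral {0..\<epsilon>} (\<lambda>x. G (- x)) - (\<Sum>l<N. of_real (laplace_const k l * p l) * ((- 1) ^ l * \<kappa> ^ Suc l * b_coeff \<psi> f k l))) \<le> C * p N"
        using C[OF phase_class_reflect[OF f assms(1) re] amplitude_class_reflect[OF \<psi>] s] d(2)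
        unfolding b_coeff_reflect[OF f assms an \<kappa>_def[unfolded c_def]] by (simp add: G_def p_def)
      have cA: "calA c k l = of_real (laplace_const k l) * (1 + (- 1) ^ l * \<kappa> ^ Suc l)" for l
        using calA_eq[OF assms(4) c(1) odd, of l] unfolding \<kappa>_def by simp
      have summand: "of_real (p l) * (calA c k l * b_coeff \<psi> f k l) =
          of_real (laplace_const k l * p l) * ((- 1) ^ l * \<kappa> ^ Suc l * b_coeff \<psi> f k l) +
          of_real (laplace_const k l * p l) * b_coeff \<psi> f k l" for l
        by (simp only: cA) (simp add: algebra_simps)
      have "integral {- \<epsilon>..\<epsilon>} G - (\<Sum>l<N. of_real (p l) * (calA c k l * b_coeff \<psi> f k l)) =
         (integral {0..\<epsilon>} (\<lambda>x. G (- x)) - (\<Sum>l<N. of_real (laplace_const k l * p l) * ((- 1) ^ l * \<kappa> ^ Suc l * b_coeff \<psi> f k l)))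
         + (integral {0..\<epsilon>} G - (\<Sum>l<N. of_real (laplace_const k l * p l) * b_coeff \<psi> f k l))"
        unfolding I summand sum.distrib by simp
      also have "norm \<dots> \<le> C * p N + C * p N" using b2 b1 by (rule norm_triangle_mono)
      finally have "norm (integral {- \<epsilon>..\<epsilon>} G - (\<Sum>l<N. of_real (p l) * (calA c k l * b_coeff \<psi> f k l))) \<le> (C + C) * p N"
        by (simp only: distrib_right)
      then show ?thesis unfolding G_def p_def c_def .
    qed
    show "\<exists>C. \<forall>f\<in>phase_class \<tau> M m k. \<forall>\<psi>\<in>amplitude_class \<tau> M. \<forall>s\<ge>1.
         0 \<le> Re ((- 1) ^ k * taylor_coeff f k) \<longrightarrow> \<delta> \<le> Re (f (of_real \<epsilon>)) \<longrightarrow> \<delta> \<le> Re (f (of_real (- \<epsilon>))) \<longrightarrow>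
         norm (integral {- \<epsilon>..\<epsilon>} (\<lambda>x. exp (- (of_real s * f (of_real x))) * \<psi> (of_real x))
           - (\<Sum>l<N. of_real (s powr (- (real l + 1) / real k)) * (calA (taylor_coeff f k) k l * b_coeff \<psi> f k l)))
         \<le> C * s powr (- (real N + 1) / real k)"
      by (intro exI[of _ "C + C"] ballI allI impI) (rule key)
  qed
qed

section \<open>Analytic functions of two variables\<close>

text \<open>Joint continuity is included so that Cauchy integrals in one variable can be treated as
  parameter integrals in the other; regularity of the partial derivatives is recovered from
  them.\<close>

definition sep_hol :: "(complex \<times> complex \<Rightarrow> complex) \<Rightarrow> (complex \<times> complex) set \<Rightarrow> bool" where
  "sep_hol f U \<longleftrightarrow> open U \<and> continuous_on U f \<and>
     (\<forall>p\<in>U. (\<lambda>u. f (u, snd p)) field_differentiable at (fst p) \<and>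
            (\<lambda>v. f (fst p, v)) field_differentiable at (snd p))"

text \<open>Absolute convergence at the single point (r, r) dominates the series on the closed
  bidisk of radius r, so the Weierstrass M-test makes f a uniform limit of polynomials
  there.\<close>

lemma has_power_series_imp_sep_hol:
  assumes "has_power_series a f p"
  obtains r where "0 < r" "sep_hol f (ball (fst p) r \<times> ball (snd p) r)"
proof -
  obtain \<rho> where \<rho>: "0 < \<rho>" and S: "\<And>x y. norm x < \<rho> \<Longrightarrow> norm y < \<rho> \<Longrightarrow>
      ((\<lambda>(m, n). a m n * x ^ m * y ^ n) has_sum f (fst p + x, snd p + y)) UNIV"
    using assms unfolding has_power_series_def by blast
  define r where "r = \<rho> / 2"
  have r: "0 < r" "r < \<rho>" using \<rho> by (auto simp: r_def)
  define X where "X = cball (fst p) r \<times> cball (snd p) r"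
  define T where "T = (\<lambda>(m, n) q. a m n * (fst q - fst p) ^ m * (snd q - snd p) ^ n)"
  have "(\<lambda>(m, n). a m n * of_real r ^ m * of_real r ^ n) summable_on UNIV"
    using S[of "of_real r" "of_real r"] r by (auto simp: summable_on_def)
  \<comment> \<open>Unconditional summability of a complex family is absolute.\<close>
  then have sm: "(\<lambda>i. norm (case i of (m, n) \<Rightarrow> a m n * of_real r ^ m * of_real r ^ n)) summable_on UNIV"
    by (simp add: summable_on_iff_abs_summable_on_complex)
  have ul: "uniform_limit X (\<lambda>F q. \<Sum>i\<in>F. T i q) (\<lambda>q. \<Sum>\<^sub>\<infinity>i\<in>UNIV. T i q) (finite_subsets_at_top UNIV)"
  proof (rule Weierstrass_m_test_general[OF _ sm])
    fix i q assume q: "q \<in> X"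
    show "norm (T i q) \<le> norm (case i of (m, n) \<Rightarrow> a m n * of_real r ^ m * of_real r ^ n)"
      using q r unfolding X_def T_def
      by (auto simp: norm_mult norm_power dist_norm norm_minus_commute split: prod.splits
          intro!: mult_mono power_mono mult_nonneg_nonneg)
  qed
  have feq: "(\<Sum>\<^sub>\<infinity>i\<in>UNIV. T i q) = f q" if "q \<in> X" for q
    using S[of "fst q - fst p" "snd q - snd p"] that r
    by (auto simp: X_def T_def dist_norm norm_minus_commute case_prod_unfold intro!: infsumI)
  have ul: "uniform_limit X (\<lambda>F q. \<Sum>i\<in>F. T i q) f (finite_subsets_at_top UNIV)"
    using ul feq by (subst (asm) uniform_limit_cong'[where g = "\<lambda>F q. \<Sum>i\<in>F. T i q" and i = f]) auto
  have "continuous_on X f"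
    by (rule uniform_limit_theorem[OF _ ul])
       (auto simp: T_def case_prod_unfold intro!: always_eventually continuous_intros)
  moreover have "ball (fst p) r \<times> ball (snd p) r \<subseteq> X" by (auto simp: X_def)
  ultimately have c: "continuous_on (ball (fst p) r \<times> ball (snd p) r) f" by (rule continuous_on_subset)
  have h1: "(\<lambda>u. f (u, v)) holomorphic_on ball (fst p) r" if "v \<in> ball (snd p) r" for v
  proof -
    have "(\<lambda>u. (u, v)) \<in> cball (fst p) r \<rightarrow> X" using that by (auto simp: X_def)
    from uniform_limit_compose'[OF ul this]
    have l: "uniform_limit (cball (fst p) r) (\<lambda>F u. \<Sum>i\<in>F. T i (u, v)) (\<lambda>u. f (u, v)) (finite_subsets_at_top UNIV)" .
    show ?thesis
      by (rule holomorphic_uniform_limit[OF _ l])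
         (auto simp: T_def case_prod_unfold intro!: always_eventually continuous_intros holomorphic_intros)
  qed
  have h2: "(\<lambda>v. f (u, v)) holomorphic_on ball (snd p) r" if "u \<in> ball (fst p) r" for u
  proof -
    have "(\<lambda>v. (u, v)) \<in> cball (snd p) r \<rightarrow> X" using that by (auto simp: X_def)
    from uniform_limit_compose'[OF ul this]
    have l: "uniform_limit (cball (snd p) r) (\<lambda>F v. \<Sum>i\<in>F. T i (u, v)) (\<lambda>v. f (u, v)) (finite_subsets_at_top UNIV)" .
    show ?thesis
      by (rule holomorphic_uniform_limit[OF _ l])
         (auto simp: T_def case_prod_unfold intro!: always_eventually continuous_intros holomorphic_intros)
  qed
  have "sep_hol f (ball (fst p) r \<times> ball (snd p) r)"
    unfolding sep_hol_def
  proof (intro conjI ballI)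
    fix q assume q: "q \<in> ball (fst p) r \<times> ball (snd p) r"
    show "(\<lambda>u. f (u, snd q)) field_differentiable at (fst q)"
      by (rule holomorphic_on_imp_differentiable_at[OF h1 open_ball]) (use q in auto)
    show "(\<lambda>v. f (fst q, v)) field_differentiable at (snd q)"
      by (rule holomorphic_on_imp_differentiable_at[OF h2 open_ball]) (use q in auto)
  qed (use c in \<open>auto simp: open_Times\<close>)
  with r show ?thesis using that by blast
qed

lemma analytic2_on_imp_sep_hol:
  assumes "analytic2_on f S"
  obtains U where "S \<subseteq> U" "sep_hol f U"
proof -
  have "\<exists>r>0. sep_hol f (ball (fst p) r \<times> ball (snd p) r)" if p: "p \<in> S" for p
  proof -
    obtain a where "has_power_series a f p" using assms p by (auto simp: analytic2_on_def)
    then show ?thesis using has_power_series_imp_sep_hol by blast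
  qed
  then obtain r where r: "\<And>p. p \<in> S \<Longrightarrow> 0 < r p" "\<And>p. p \<in> S \<Longrightarrow> sep_hol f (ball (fst p) (r p) \<times> ball (snd p) (r p))"
    by metis
  show ?thesis
  proof (rule that)
    show "S \<subseteq> (\<Union>p\<in>S. ball (fst p) (r p) \<times> ball (snd p) (r p))" using r(1) by force
    show "sep_hol f (\<Union>p\<in>S. ball (fst p) (r p) \<times> ball (snd p) (r p))"
      unfolding sep_hol_def
    proof (intro conjI)
      show "continuous_on (\<Union>p\<in>S. ball (fst p) (r p) \<times> ball (snd p) (r p)) f"
        using r(2) by (intro continuous_on_open_UN) (auto simp: sep_hol_def)
    qed (use r(2) in \<open>auto simp: sep_hol_def open_Times\<close>)
  qed
qed

lemma sep_holD:
  assumes "sep_hol f U" "(u, v) \<in> U"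
  shows "(\<lambda>u. f (u, v)) field_differentiable at u" "(\<lambda>v. f (u, v)) field_differentiable at v"
  using assms unfolding sep_hol_def by (auto dest!: bspec[of U _ "(u, v)"])

lemma sep_hol_subset: "sep_hol f U \<Longrightarrow> open V \<Longrightarrow> V \<subseteq> U \<Longrightarrow> sep_hol f V"
  unfolding sep_hol_def by (meson continuous_on_subset subsetD)

lemma sep_hol_snd:
  assumes "sep_hol f U" "{u} \<times> A \<subseteq> U"
  shows "(\<lambda>v. f (u, v)) holomorphic_on A"
  unfolding holomorphic_on_def
  using assms(2) by (auto intro!: field_differentiable_at_within sep_holD[OF assms(1)])

lemma sep_hol_divide:
  assumes "sep_hol f U" "sep_hol h U" "\<And>q. q \<in> U \<Longrightarrow> h q \<noteq> 0"
  shows "sep_hol (\<lambda>q. f q / h q) U"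
  using assms unfolding sep_hol_def
  by (auto intro!: continuous_intros field_differentiable_divide)

section \<open>Circle integrals depending on a parameter\<close>

text \<open>Over a fixed real interval the theorems on parameter integrals apply.\<close>

lemma circle_integral_eq:
  "contour_integral (circlepath c R) h = integral (cbox 0 1)
     (\<lambda>t. h (c + of_real R * exp (2 * of_real pi * \<i> * of_real t)) *
        (2 * of_real pi * \<i> * of_real R * exp (2 * of_real pi * \<i> * of_real t)))"
  unfolding contour_integral_integral vector_derivative_circlepath by (simp add: circlepath)

lemma circle_integral_continuous:
  fixes W :: "'a::topological_space set"
  assumes "continuous_on (W \<times> sphere c R) (\<lambda>(w, \<zeta>). h w \<zeta>)" "0 \<le> R"
  shows "continuous_on W (\<lambda>w. contour_integral (circlepath c R) (h w))"
  unfolding circle_integral_eq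
proof (rule integral_continuous_on_param)
  have "continuous_on (W \<times> cbox 0 1) ((\<lambda>(w, \<zeta>). h w \<zeta>) \<circ>
     (\<lambda>(w, t). (w, c + of_real R * exp (2 * of_real pi * \<i> * of_real t))))"
    using assms(2)
    by (intro continuous_on_compose continuous_on_subset[OF assms(1)])
       (auto simp: case_prod_unfold dist_norm norm_mult intro!: continuous_intros)
  then have "continuous_on (W \<times> cbox 0 1) (\<lambda>q. h (fst q) (c + of_real R * exp (2 * of_real pi * \<i> * of_real (snd q))))"
    by (simp add: o_def case_prod_unfold)
  then show "continuous_on (W \<times> cbox 0 1) (\<lambda>(w, t). h w (c + of_real R * exp (2 * of_real pi * \<i> * of_real t)) *
        (2 * of_real pi * \<i> * of_real R * exp (2 * of_real pi * \<i> * of_real t)))"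
    unfolding case_prod_unfold by (intro continuous_intros)
qed

lemma circle_integral_holomorphic:
  assumes "\<And>w \<zeta>. w \<in> W \<Longrightarrow> \<zeta> \<in> sphere c R \<Longrightarrow> ((\<lambda>w. h w \<zeta>) has_field_derivative h' w \<zeta>) (at w)"
    and "\<And>w. w \<in> W \<Longrightarrow> continuous_on (sphere c R) (h w)"
    and "continuous_on (W \<times> sphere c R) (\<lambda>(w, \<zeta>). h' w \<zeta>)" "0 \<le> R" "convex W"
  shows "(\<lambda>w. contour_integral (circlepath c R) (h w)) holomorphic_on W"
  unfolding circle_integral_eq
proof (rule leibniz_rule_holomorphic)
  define e where "e = (\<lambda>t::real. c + of_real R * exp (2 * of_real pi * \<i> * of_real t))"
  define e' where "e' = (\<lambda>t::real. 2 * of_real pi * \<i> * of_real R * exp (2 * of_real pi * \<i> * of_real t))"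
  have es: "e t \<in> sphere c R" for t using assms(4) by (simp add: e_def dist_norm norm_mult)
  have ce: "continuous_on A e" "continuous_on A e'" for A unfolding e_def e'_def by (auto intro!: continuous_intros)
  show "((\<lambda>w. h w (c + of_real R * exp (2 * of_real pi * \<i> * of_real t)) *
        (2 * of_real pi * \<i> * of_real R * exp (2 * of_real pi * \<i> * of_real t)))
     has_field_derivative h' w (e t) * e' t) (at w within W)"
    if "w \<in> W" "t \<in> cbox 0 1" for w t
  proof -
    have "((\<lambda>w. h w (e t) * e' t) has_field_derivative h' w (e t) * e' t) (at w within W)"
      by (rule DERIV_cmult_right[OF has_field_derivative_at_within[OF assms(1)[OF that(1) es]]])
    then show ?thesis by (simp only: e_def e'_def)
  qed
  show "(\<lambda>t. h w (c + of_real R * exp (2 * of_real pi * \<i> * of_real t)) *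
        (2 * of_real pi * \<i> * of_real R * exp (2 * of_real pi * \<i> * of_real t))) integrable_on cbox 0 1"
    if "w \<in> W" for w
  proof -
    have "(\<lambda>t. h w (e t) * e' t) integrable_on cbox 0 1"
      using es by (intro integrable_continuous continuous_on_mult ce continuous_on_compose2[OF assms(2)[OF that] ce(1)]) auto
    then show ?thesis by (simp only: e_def e'_def)
  qed
  have "continuous_on (W \<times> cbox 0 1) ((\<lambda>(w, \<zeta>). h' w \<zeta>) \<circ> (\<lambda>q. (fst q, e (snd q))))"
    using es by (intro continuous_on_compose continuous_on_subset[OF assms(3)])
       (auto intro!: continuous_intros continuous_on_compose2[OF ce(1)[of UNIV]])
  then have "continuous_on (W \<times> cbox 0 1) (\<lambda>q. h' (fst q) (e (snd q)))"
    by (simp add: o_def)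
  then show "continuous_on (W \<times> cbox 0 1) (\<lambda>(w, t). h' w (e t) * e' t)"
    unfolding case_prod_unfold
    by (intro continuous_intros continuous_on_compose2[OF ce(2)[of UNIV]]) auto
qed (rule assms)

text \<open>By Cauchy's formula the partial derivative is, up to a constant, the integral of f(u,
  \<zeta>)/(\<zeta> - v)^2 over a circle that can be kept fixed near the given point. This depends
  continuously on (u, v) jointly.\<close>

lemma sep_hol_continuous_partial2:
  assumes "sep_hol f U"
  shows "continuous_on U (partial2 f)"
proof -
  have oU: "open U" using assms by (simp add: sep_hol_def)
  have "isCont (partial2 f) p" if p: "p \<in> U" for p
  proof -
    obtain A B where AB: "open A" "open B" "p \<in> A \<times> B" "A \<times> B \<subseteq> U" using open_prod_elim[OF oU p] by blast
    obtain R1 R2 where R: "0 < R1" "cball (fst p) R1 \<subseteq> A" "0 < R2" "cball (snd p) R2 \<subseteq> B"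
      using AB open_contains_cball by (metis mem_Times_iff)
    have bU: "cball (fst p) R1 \<times> cball (snd p) R2 \<subseteq> U" using R AB by blast
    define W where "W = ball (fst p) R1 \<times> ball (snd p) R2"
    define J where "J = (\<lambda>q. contour_integral (circlepath (snd p) R2) (\<lambda>\<zeta>. f (fst q, \<zeta>) / (\<zeta> - snd q)\<^sup>2))"
    have eq: "J q = of_real (2 * pi) * \<i> * partial2 f q" if q: "q \<in> W" for q
    proof -
      have "(\<lambda>v. f (fst q, v)) holomorphic_on cball (snd p) R2"
        by (rule sep_hol_snd[OF assms]) (use q bU in \<open>auto simp: W_def\<close>)
      then show ?thesis unfolding J_def partial2_def using q holomorphic_on_subset[OF _ ball_subset_cball]
        by (intro Cauchy_contour_integral_circlepath_2 holomorphic_on_imp_continuous_on) (auto simp: W_def)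
    qed
    have "continuous_on W J"
      unfolding J_def
    proof (rule circle_integral_continuous)
      have "continuous_on (W \<times> sphere (snd p) R2) (\<lambda>x. f (fst (fst x), snd x))"
      proof (rule continuous_on_compose2[of U f])
        show "continuous_on U f" using assms by (simp add: sep_hol_def)
        show "(\<lambda>x. (fst (fst x), snd x)) ` (W \<times> sphere (snd p) R2) \<subseteq> U"
          using bU by (auto simp: W_def)
      qed (intro continuous_intros)
      then show "continuous_on (W \<times> sphere (snd p) R2) (\<lambda>(w, \<zeta>). f (fst w, \<zeta>) / (\<zeta> - snd w)\<^sup>2)"
        unfolding case_prod_unfold by (intro continuous_intros) (auto simp: W_def)
    qed (use R in auto)
    then have "continuous_on W (\<lambda>q. J q / (of_real (2 * pi) * \<i>))" by (intro continuous_intros) auto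
    then have "continuous_on W (partial2 f)" by (rule continuous_on_eq) (simp add: eq)
    moreover have "open W" "p \<in> W" using R by (auto simp: W_def open_Times mem_Times_iff)
    ultimately show ?thesis by (simp add: continuous_on_eq_continuous_at)
  qed
  then show ?thesis by (simp add: continuous_at_imp_continuous_on)
qed

lemma sep_hol_swap:
  assumes "sep_hol f U"
  shows "sep_hol (\<lambda>q. f (prod.swap q)) (prod.swap -` U)"
proof -
  have c: "continuous_on A (prod.swap :: complex \<times> complex \<Rightarrow> _)" for A
    unfolding prod.swap_def by (intro continuous_intros)
  show ?thesis
    using assms unfolding sep_hol_def
    by (auto intro!: open_vimage c continuous_on_compose2[of U f _ prod.swap])
qed

lemma sep_hol_continuous_partial1:
  assumes "sep_hol f U"
  shows "continuous_on U (partial1 f)"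
proof -
  have "continuous_on U (\<lambda>q. partial2 (\<lambda>q. f (prod.swap q)) (prod.swap q))"
    by (rule continuous_on_compose2[OF sep_hol_continuous_partial2[OF sep_hol_swap[OF assms]]])
       (auto simp: prod.swap_def intro!: continuous_intros)
  then show ?thesis by (simp add: partial1_def partial2_def cong: continuous_on_cong)
qed

lemma sep_hol_partials:
  assumes "sep_hol f U" "(u, v) \<in> U"
  shows "((\<lambda>u. f (u, v)) has_field_derivative partial1 f (u, v)) (at u)"
    and "((\<lambda>v. f (u, v)) has_field_derivative partial2 f (u, v)) (at v)"
  using sep_holD[OF assms] by (simp_all add: partial1_def partial2_def field_differentiable_derivI)

text \<open>Continuity of one partial derivative upgrades partial to total differentiability, which
  the chain rule along the curve u \<mapsto> (u, g u) requires.\<close>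

lemma sep_hol_has_derivative:
  assumes "sep_hol f U" "p \<in> U"
  shows "(f has_derivative (\<lambda>(h1, h2). partial1 f p * h1 + partial2 f p * h2)) (at p)"
proof -
  have oU: "open U" using assms by (simp add: sep_hol_def)
  obtain x y where xy: "p = (x, y)" by force
  obtain A B where AB: "open A" "open B" "p \<in> A \<times> B" "A \<times> B \<subseteq> U" using open_prod_elim[OF oU assms(2)] by blast
  obtain R where R: "0 < R" "ball y R \<subseteq> B" using AB xy open_contains_ball[of B] by auto
  have "((\<lambda>(x, y). f (x, y)) has_derivative (\<lambda>(tx, ty). partial1 f p * tx + blinfun_mult_right (partial2 f (x, y)) ty)) (at (x, y) within A \<times> ball y R)"
  proof (rule has_derivative_partialsI)
    show "((\<lambda>x. f (x, y)) has_derivative (*) (partial1 f p)) (at x within A)"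
      using has_field_derivative_at_within[OF sep_hol_partials(1)[OF assms[unfolded xy]]]
      by (simp add: has_field_derivative_def xy)
    show "((\<lambda>v. f (u, v)) has_derivative blinfun_apply (blinfun_mult_right (partial2 f (u, v)))) (at v within ball y R)"
      if "u \<in> A" "v \<in> ball y R" for u v
    proof -
      have "(u, v) \<in> U" using that R AB by auto
      from has_field_derivative_at_within[OF sep_hol_partials(2)[OF assms(1) this]]
      show ?thesis by (simp add: has_field_derivative_def blinfun_mult_right.rep_eq)
    qed
    have "isCont (partial2 f) p"
      using sep_hol_continuous_partial2[OF assms(1)] oU assms(2) by (simp add: continuous_on_eq_continuous_at)
    then have "isCont (\<lambda>q. blinfun_mult_right (partial2 f q)) p"
      by (intro bounded_linear.isCont[OF bounded_linear_blinfun_mult_right])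
    then show "continuous (at (x, y) within A \<times> ball y R) (\<lambda>(x, y). blinfun_mult_right (partial2 f (x, y)))"
      by (simp add: xy case_prod_unfold continuous_at_imp_continuous_at_within)
  qed (use R in auto)
  moreover have "at (x, y) within A \<times> ball y R = at (x, y)"
    using AB R xy by (intro at_within_open) (auto simp: open_Times)
  ultimately show ?thesis by (simp add: xy blinfun_mult_right.rep_eq case_prod_unfold)
qed

lemma implicit_derivative:
  assumes "sep_hol H U" "(z, g z) \<in> U" "(g has_field_derivative g') (at z)" "\<forall>\<^sub>F u in nhds z. H (u, g u) = 0"
  shows "partial1 H (z, g z) + partial2 H (z, g z) * g' = 0"
proof -
  have "((\<lambda>u. (u, g u)) has_derivative (\<lambda>h. (h, g' * h))) (at z)"
    using assms(3) by (auto simp: has_field_derivative_def intro!: derivative_eq_intros)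
  from has_derivative_compose[OF this sep_hol_has_derivative[OF assms(1,2)]]
  have "((\<lambda>u. H (u, g u)) has_derivative (\<lambda>h. (partial1 H (z, g z) + partial2 H (z, g z) * g') * h)) (at z)"
    by (simp add: algebra_simps)
  then have "((\<lambda>u. H (u, g u)) has_field_derivative (partial1 H (z, g z) + partial2 H (z, g z) * g')) (at z)"
    by (simp add: has_field_derivative_def)
  moreover have "((\<lambda>u. H (u, g u)) has_field_derivative 0) (at z)"
    using assms(4) DERIV_cong_ev[OF refl assms(4) refl] by simp
  ultimately show ?thesis by (rule DERIV_unique)
qed

section \<open>Extraction of the coefficients of a double power series\<close>

lemma taylor_coeff_unique:
  assumes "0 < \<rho>" "\<And>y. norm y < \<rho> \<Longrightarrow> (\<lambda>n. c n * y ^ n) sums f y"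
  shows "taylor_coeff f n = c n"
proof -
  have "f has_fps_expansion Abs_fps c"
    using assms by (intro has_fps_expansionI) 
      (auto simp: eventually_nhds intro!: exI[of _ "ball 0 \<rho>"])
  then show ?thesis using fps_expansion_eqI[of f "Abs_fps c"]
    by (auto simp: fps_expansion_def taylor_coeff_def fps_eq_iff)
qed

text \<open>The double series converges unconditionally, so for each n it may first be summed over
  the powers of x; the inner sums are the coefficients of y^n.\<close>

lemma power_series_taylor_coeff:
  assumes "has_power_series a F (0, 0)"
  shows "taylor_coeff (\<lambda>u. taylor_coeff (\<lambda>v. F (u, v)) s) r = a r s"
proof -
  obtain \<rho> where \<rho>: "0 < \<rho>" and S: "\<And>x y. norm x < \<rho> \<Longrightarrow> norm y < \<rho> \<Longrightarrow>
      ((\<lambda>(m, n). a m n * x ^ m * y ^ n) has_sum F (x, y)) UNIV"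
    using assms unfolding has_power_series_def by auto
  have S': "((\<lambda>(n, m). a m n * x ^ m * y ^ n) has_sum F (x, y)) (UNIV \<times> UNIV)" if "norm x < \<rho>" "norm y < \<rho>" for x y
    using S[OF that] has_sum_swap[where f = "\<lambda>(m, n). a m n * x ^ m * y ^ n" and A = UNIV and B = UNIV]
    by (simp add: case_prod_unfold)
  have inner: "(\<lambda>m. a m n * x ^ m) summable_on UNIV" if x: "norm x < \<rho>" for x n
  proof -
    \<comment> \<open>A fixed nonzero second coordinate, so that y^n can be divided out of the
      summable slice.\<close>
    define y :: complex where "y = of_real (\<rho> / 2)"
    have y: "norm y < \<rho>" "y \<noteq> 0" using \<rho> by (auto simp: y_def)
    have "(\<lambda>(n, m). a m n * x ^ m * y ^ n) summable_on (UNIV \<times> UNIV)" using S'[OF x y(1)] by (auto simp: summable_on_def)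
    from summable_on_SigmaD1[OF this, of n] have "(\<lambda>m. a m n * x ^ m * y ^ n) summable_on UNIV" by simp
    then have "(\<lambda>m. (a m n * x ^ m * y ^ n) * inverse (y ^ n)) summable_on UNIV" by (rule summable_on_cmult_left)
    then show ?thesis using y by (simp add: mult.assoc)
  qed
  define c where "c x n = infsum (\<lambda>m. a m n * x ^ m) UNIV" for x n
  have hc: "((\<lambda>m. a m n * x ^ m) has_sum c x n) UNIV" if "norm x < \<rho>" for x n
    unfolding c_def using inner[OF that] by (rule has_sum_infsum)
  have "(\<lambda>n. c x n * y ^ n) sums F (x, y)" if "norm x < \<rho>" "norm y < \<rho>" for x y
    by (rule has_sum_imp_sums, rule has_sum_SigmaD[OF S'[OF that]])
       (use has_sum_cmult_left[OF hc[OF that(1)]] in auto)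
  then have tc: "taylor_coeff (\<lambda>v. F (x, v)) n = c x n" if "norm x < \<rho>" for x n
    using that by (intro taylor_coeff_unique[OF \<rho>]) auto
  show ?thesis
    by (rule taylor_coeff_unique[OF \<rho>]) (use has_sum_imp_sums[OF hc] in \<open>auto simp: tc\<close>)
qed

lemma Cauchy_taylor_coeff:
  assumes "f holomorphic_on cball 0 r" "0 < r"
  shows "contour_integral (circlepath 0 r) (\<lambda>\<zeta>. f \<zeta> / \<zeta> ^ Suc s) = of_real (2 * pi) * \<i> * taylor_coeff f s"
proof -
  have "contour_integral (circlepath 0 r) (\<lambda>\<zeta>. f \<zeta> / (\<zeta> - 0) ^ Suc s) = of_real (2 * pi) * \<i> * (deriv ^^ s) f 0 / fact s"
    using assms holomorphic_on_subset[OF assms(1) ball_subset_cball]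
    by (intro Cauchy_contour_integral_circlepath holomorphic_on_imp_continuous_on) auto
  then show ?thesis by (simp add: taylor_coeff_def)
qed

text \<open>Cauchy's formula over one small circle, the same for all u, turns the coefficient into a
  parameter integral.\<close>

lemma taylor_coeff_snd_holomorphic:
  assumes F: "sep_hol F U" and sub: "W \<times> cball 0 \<kappa> \<subseteq> U" and "0 < \<kappa>" "convex W" "open W"
  shows "(\<lambda>u. taylor_coeff (\<lambda>v. F (u, v)) s) holomorphic_on W"
proof -
  define J where "J = (\<lambda>u. contour_integral (circlepath 0 \<kappa>) (\<lambda>\<zeta>. F (u, \<zeta>) / \<zeta> ^ Suc s))"
  have J: "J u = of_real (2 * pi) * \<i> * taylor_coeff (\<lambda>v. F (u, v)) s" if "u \<in> W" for u
  proof -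
    have "(\<lambda>v. F (u, v)) holomorphic_on cball 0 \<kappa>"
      by (rule sep_hol_snd[OF F]) (use sub that in auto)
    then show ?thesis unfolding J_def using assms(3) by (rule Cauchy_taylor_coeff)
  qed
  have "J holomorphic_on W"
    unfolding J_def
  proof (rule circle_integral_holomorphic[where h' = "\<lambda>u \<zeta>. partial1 F (u, \<zeta>) / \<zeta> ^ Suc s"])
    show "((\<lambda>w. F (w, \<zeta>) / \<zeta> ^ Suc s) has_field_derivative partial1 F (w, \<zeta>) / \<zeta> ^ Suc s) (at w)"
      if "w \<in> W" "\<zeta> \<in> sphere 0 \<kappa>" for w \<zeta>
    proof -
      have "(w, \<zeta>) \<in> U" using that sub by auto
      then have "((\<lambda>w. F (w, \<zeta>)) has_field_derivative partial1 F (w, \<zeta>)) (at w)"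
        by (rule sep_hol_partials(1)[OF F])
      then show ?thesis by (rule DERIV_cdivide)
    qed
    show "continuous_on (sphere 0 \<kappa>) (\<lambda>\<zeta>. F (w, \<zeta>) / \<zeta> ^ Suc s)" if w: "w \<in> W" for w
    proof -
      have "(\<lambda>\<zeta>. F (w, \<zeta>)) holomorphic_on sphere 0 \<kappa>"
        by (rule sep_hol_snd[OF F]) (use sub w in auto)
      from holomorphic_on_imp_continuous_on[OF this] show ?thesis
        using assms(3) by (intro continuous_on_divide continuous_on_power continuous_on_id) auto
    qed
    have "continuous_on (W \<times> sphere 0 \<kappa>) (partial1 F)"
      by (rule continuous_on_subset[OF sep_hol_continuous_partial1[OF F]]) (use sub in auto)
    then show "continuous_on (W \<times> sphere 0 \<kappa>) (\<lambda>(w, \<zeta>). partial1 F (w, \<zeta>) / \<zeta> ^ Suc s)"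
      using assms(3) unfolding case_prod_unfold prod.collapse by (intro continuous_intros) auto
  qed (use assms in auto)
  then have "(\<lambda>u. J u / (of_real (2 * pi) * \<i>)) holomorphic_on W" by (intro holomorphic_intros) auto
  then show ?thesis by (rule holomorphic_transform) (simp add: J)
qed

lemma taylor_coeff_torus_integral:
  assumes A: "A holomorphic_on ball 0 \<rho>" and z: "norm z < \<rho>" "z \<noteq> 0"
  shows "taylor_coeff A r * z ^ r = of_real (1 / (2 * pi)) *
     integral {-pi..pi} (\<lambda>\<theta>. A (z * exp (\<i> * of_real \<theta>)) * exp (- (\<i> * of_nat r * of_real \<theta>)))"
proof -
  \<comment> \<open>The factor -z instead of z shifts the angle by \<pi>. The circle path covers
    [0, 2\<pi>] from its base point, and after the shift the point z, where the integral
    concentrates, sits in the middle of [-\<pi>, \<pi>].\<close>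
  define B where "B = (\<lambda>u. A (- z * u))"
  define T where "T = ball (0::complex) (\<rho> / norm z)"
  have T: "cball 0 1 \<subseteq> T"
  proof
    fix x :: complex assume "x \<in> cball 0 1"
    then have "norm x * norm z \<le> norm z" by (simp add: mult_left_le_one_le)
    then have "norm x * norm z < \<rho>" using z by linarith
    then show "x \<in> T" using z by (simp add: T_def pos_less_divide_eq)
  qed
  have \<rho>: "0 < \<rho>" using z norm_ge_zero[of z] by linarith
  have im: "(\<lambda>u. - z * u) ` T \<subseteq> ball 0 \<rho>" using z by (auto simp: T_def norm_mult field_simps)
  have holB: "B holomorphic_on T"
    unfolding B_def using holomorphic_on_compose_gen[OF _ A im] by (simp add: o_def holomorphic_on_mult holomorphic_on_const holomorphic_on_ident holomorphic_on_minus)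
  have tB: "taylor_coeff B r = (- z) ^ r * taylor_coeff A r"
  proof -
    have "A analytic_on {0}" unfolding analytic_at using A \<rho> by (intro exI[of _ "ball 0 \<rho>"]) auto
    from taylor_coeff_scale[OF this, of 1 "- z" r] show ?thesis by (simp add: B_def)
  qed
  define f where "f = (\<lambda>\<theta>. A (z * exp (\<i> * of_real \<theta>)) * exp (- (\<i> * of_nat r * of_real \<theta>)))"
  have e: "exp (2 * of_real pi * \<i> * of_real t) = - exp (\<i> * of_real (2 * pi * t + - pi))" for t
  proof -
    have "\<i> * of_real (2 * pi * t + - pi) = 2 * of_real pi * \<i> * of_real t - \<i> * of_real pi"
      by (simp add: algebra_simps)
    then have "exp (\<i> * of_real (2 * pi * t + - pi)) = exp (2 * of_real pi * \<i> * of_real t) / exp (\<i> * of_real pi)"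
      by (simp only: exp_diff)
    then show ?thesis by simp
  qed
  have "contour_integral (circlepath 0 1) (\<lambda>u. B u / u ^ Suc r) = of_real (2 * pi) * \<i> * taylor_coeff B r"
    by (rule Cauchy_taylor_coeff[OF holomorphic_on_subset[OF holB T]]) simp
  moreover have "contour_integral (circlepath 0 1) (\<lambda>u. B u / u ^ Suc r) =
      integral (cbox 0 1) (\<lambda>t. (of_real (2 * pi) * \<i> * (- 1) ^ r) * f (2 * pi * t + - pi))"
    unfolding circle_integral_eq
  proof (rule integral_cong)
    fix t :: real
    define E where "E = exp (\<i> * of_real (2 * pi * t + - pi))"
    have E0: "E \<noteq> 0" by (simp add: E_def)
    have fE: "f (2 * pi * t + - pi) = A (z * E) / E ^ r"
      unfolding f_def E_def exp_minus divide_inverse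
      by (subst exp_of_nat_mult[symmetric]) (simp add: mult_ac)
    show "B (0 + of_real 1 * exp (2 * of_real pi * \<i> * of_real t)) / (0 + of_real 1 * exp (2 * of_real pi * \<i> * of_real t)) ^ Suc r *
        (2 * of_real pi * \<i> * of_real 1 * exp (2 * of_real pi * \<i> * of_real t)) =
       (of_real (2 * pi) * \<i> * (- 1) ^ r) * f (2 * pi * t + - pi)"
      unfolding e fE E_def[symmetric] B_def using E0 by (cases "even r") (simp_all add: field_simps)
  qed
  moreover have "((\<lambda>t. f (2 * pi * t + - pi)) has_integral integral {-pi..pi} f / of_real (2 * pi)) (cbox 0 1)"
  proof -
    have "continuous_on {-pi..pi} f" unfolding f_def using z
      by (intro continuous_intros continuous_on_compose2[OF holomorphic_on_imp_continuous_on[OF A]]) (auto simp: norm_mult)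
    then have "(f has_integral integral {-pi..pi} f) (cbox (-pi) pi)"
      by (simp add: integrable_continuous_interval integrable_integral)
    from has_integral_affinity[OF this, of "2 * pi" "- pi"]
    have "((\<lambda>t. f (2 * pi * t + - pi)) has_integral (1 / (2 * pi)) *\<^sub>R integral {-pi..pi} f)
      ((\<lambda>x. (1 / (2 * pi)) * x + 1 / 2) ` cbox (-pi) pi)" by simp
    moreover have "(\<lambda>x. (1 / (2 * pi)) * x + 1 / 2) ` cbox (-pi) pi = cbox 0 1"
      using image_affinity_cbox[of "1 / (2 * pi)" "1/2" "- pi" pi] pi_gt_zero by simp
    ultimately show ?thesis by (simp add: scaleR_conv_of_real)
  qed
  ultimately have "of_real (2 * pi) * \<i> * ((- z) ^ r * taylor_coeff A r) =
     (of_real (2 * pi) * \<i> * (- 1) ^ r) * (integral {-pi..pi} f / of_real (2 * pi))"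
    unfolding tB by (simp add: integral_unique)
  then have "2 * (of_real pi * (z ^ r * taylor_coeff A r)) = integral {-pi..pi} f"
    by (simp add: power_minus[of z])
  then show ?thesis unfolding f_def[symmetric] by (simp add: field_simps)
qed

section \<open>The pole near a smooth point\<close>

lemma near_cball:
  fixes u :: complex
  assumes "norm u \<le> a + \<delta>" "0 \<le> a" "0 \<le> \<delta>"
  obtains u' where "norm u' \<le> a" "dist u' u \<le> \<delta>"
proof (cases "norm u \<le> a")
  case True
  then show ?thesis using that[of u] assms by simp
next
  case False
  then have u: "0 < norm u" "a < norm u" using assms by auto
  define u' where "u' = of_real (a / norm u) * u"
  have nu': "norm u' = a" using u assms by (simp add: u'_def norm_mult norm_divide)
  have "u' - u = of_real (a / norm u - 1) * u" by (simp add: u'_def algebra_simps)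
  then have "dist u' u = \<bar>a / norm u - 1\<bar> * norm u" by (simp only: dist_norm norm_mult norm_of_real)
  also have "\<dots> = norm u - a" using u by (simp add: abs_if field_simps)
  finally show ?thesis using that[of u'] assms nu' by simp
qed

text \<open>The data at one pole. \<open>U\<close> is a common domain of G and H containing the
  closed polydisk. Since F is a total function with default value 0 where H vanishes, its holomorphy
  is stated on the set \<open>V\<close> defined below.\<close>

locale smooth_point =
  fixes F G H :: "complex \<times> complex \<Rightarrow> complex" and U :: "(complex \<times> complex) set"
    and z0 w0 :: complex and g :: "complex \<Rightarrow> complex"
  assumes F: "F = (\<lambda>q. G q / H q)"
    and G: "sep_hol G U" and H: "sep_hol H U"
    and U: "polydisk (z0, w0) \<subseteq> U"
    and minimal: "strictly_minimal H (z0, w0)"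
    and simple: "partial2 H (z0, w0) \<noteq> 0"
    and z0: "z0 \<noteq> 0" and w0: "w0 \<noteq> 0"
    and g: "parametrizes g H (z0, w0)"
begin

definition V where "V = {q \<in> U. H q \<noteq> 0}"

lemma open_U: "open U" using H by (simp add: sep_hol_def)

lemma open_V: "open V"
proof -
  have "open (U \<inter> H -` (- {0}))"
    using H by (intro continuous_open_preimage) (auto simp: sep_hol_def)
  moreover have "U \<inter> H -` (- {0}) = V" by (auto simp: V_def)
  ultimately show ?thesis by simp
qed

lemma F_sep_hol: "sep_hol F V"
  unfolding F
proof (rule sep_hol_divide)
  have "V \<subseteq> U" by (auto simp: V_def)
  then show "sep_hol G V" "sep_hol H V" using sep_hol_subset open_V G H by blast+
qed (simp add: V_def)

lemma F_continuous: "continuous_on V F"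
  using F_sep_hol by (simp add: sep_hol_def)

text \<open>The closed polydisk meets the zeros of H only at (z0, w0). So \<open>V\<close> together
  with a small box around that point is an open neighbourhood of a compact set; it contains an
  \<epsilon>-neighbourhood, and with it a slightly larger polydisk. This margin is where the
  geometric gain of the error terms comes from.\<close>

lemma zeros_near_point:
  assumes "0 < b"
  obtains \<delta> where "0 < \<delta>"
    "\<And>u v. norm u \<le> norm z0 + \<delta> \<Longrightarrow> norm v \<le> norm w0 + \<delta> \<Longrightarrow>
       (u, v) \<in> U \<and> (H (u, v) = 0 \<longrightarrow> norm (u - z0) < b \<and> norm (v - w0) < b)"
proof -
  define O' where "O' = V \<union> (U \<inter> ball z0 b \<times> ball w0 b)"
  have pd: "polydisk (z0, w0) = cball 0 (norm z0) \<times> cball 0 (norm w0)" by (auto simp: polydisk_def)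
  have cp: "compact (polydisk (z0, w0))" unfolding pd by (intro compact_Times compact_cball)
  have opO: "open O'" unfolding O'_def by (intro open_Un open_Int open_Times open_ball open_U open_V)
  have sub: "polydisk (z0, w0) \<subseteq> O'"
  proof
    fix q assume q: "q \<in> polydisk (z0, w0)"
    show "q \<in> O'"
    proof (cases "H q = 0")
      case True
      then have "q = (z0, w0)" using q minimal by (auto simp: strictly_minimal_def zero_set_def)
      then show ?thesis using q U assms by (auto simp: O'_def)
    next
      case False
      then show ?thesis using q U by (auto simp: O'_def V_def)
    qed
  qed
  obtain \<epsilon> where \<epsilon>: "0 < \<epsilon>" "(\<Union>x\<in>polydisk (z0, w0). ball x \<epsilon>) \<subseteq> O'"
    using compact_subset_open_imp_ball_epsilon_subset[OF cp opO sub] by blast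
  show ?thesis
  \<comment> \<open>Radial projection to the polydisk moves each coordinate by at most \<epsilon>/4,
    and hence the pair by less than \<epsilon>.\<close>
  proof (rule that[of "\<epsilon> / 4"])
    fix u v :: complex assume uv: "norm u \<le> norm z0 + \<epsilon> / 4" "norm v \<le> norm w0 + \<epsilon> / 4"
    obtain u' where u': "norm u' \<le> norm z0" "dist u' u \<le> \<epsilon> / 4" using near_cball[OF uv(1)] \<epsilon> by auto
    obtain v' where v': "norm v' \<le> norm w0" "dist v' v \<le> \<epsilon> / 4" using near_cball[OF uv(2)] \<epsilon> by auto
    have "dist (u', v') (u, v) \<le> \<bar>dist u' u\<bar> + \<bar>dist v' v\<bar>"
      unfolding dist_Pair_Pair by (rule sqrt_sum_squares_le_sum_abs)
    then have "dist (u', v') (u, v) < \<epsilon>" using u' v' \<epsilon> by simp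
    then have "(u, v) \<in> ball (u', v') \<epsilon>" by simp
    moreover have "(u', v') \<in> polydisk (z0, w0)" using u' v' by (simp add: polydisk_def)
    ultimately have "(u, v) \<in> O'" using \<epsilon>(2) by blast
    then show "(u, v) \<in> U \<and> (H (u, v) = 0 \<longrightarrow> norm (u - z0) < b \<and> norm (v - w0) < b)"
      by (auto simp: O'_def V_def dist_norm norm_minus_commute)
  qed (use \<epsilon> in auto)
qed

lemma g_z0: "g z0 = w0" using g by (simp add: parametrizes_def)

lemma local_box:
  obtains \<beta> where "0 < \<beta>" "\<beta> \<le> norm w0 / 4" "g holomorphic_on cball z0 \<beta>" "cball z0 \<beta> \<times> cball w0 \<beta> \<subseteq> U"
    "\<And>u v. u \<in> cball z0 \<beta> \<Longrightarrow> v \<in> cball w0 \<beta> \<Longrightarrow> (H (u, v) = 0 \<longleftrightarrow> v = g u) \<and> partial2 H (u, v) \<noteq> 0"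
proof -
  have p0U: "(z0, w0) \<in> U" using U by (auto simp: polydisk_def)
  have "\<forall>\<^sub>F q in nhds (z0, w0). q \<in> U" using open_U p0U by (rule eventually_nhds_in_open)
  moreover have "\<forall>\<^sub>F q in nhds (z0, w0). H q = 0 \<longleftrightarrow> snd q = g (fst q)"
    using g by (simp add: parametrizes_def zero_set_def)
  moreover have "\<forall>\<^sub>F q in nhds (z0, w0). partial2 H q \<noteq> 0"
  proof -
    have "isCont (partial2 H) (z0, w0)"
      using sep_hol_continuous_partial2[OF H] open_U p0U by (simp add: continuous_on_eq_continuous_at)
    then have "(partial2 H \<longlongrightarrow> partial2 H (z0, w0)) (nhds (z0, w0))"
      by (simp add: isCont_def tendsto_at_iff_tendsto_nhds)
    then show ?thesis using simple by (rule tendsto_imp_eventually_ne)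
  qed
  ultimately have "\<forall>\<^sub>F q in nhds (z0, w0). q \<in> U \<and> (H q = 0 \<longleftrightarrow> snd q = g (fst q)) \<and> partial2 H q \<noteq> 0"
    by eventually_elim simp
  then obtain e where e: "0 < e" "\<And>q. dist q (z0, w0) < e \<Longrightarrow> q \<in> U \<and> (H q = 0 \<longleftrightarrow> snd q = g (fst q)) \<and> partial2 H q \<noteq> 0"
    by (auto simp: eventually_nhds_metric)
  obtain S where S: "open S" "z0 \<in> S" "g holomorphic_on S" using g by (auto simp: parametrizes_def analytic_at)
  then obtain d where d: "0 < d" "cball z0 d \<subseteq> S" using open_contains_cball by blast
  \<comment> \<open>e/4 keeps the box inside the e-ball of the product metric; |w0|/4 keeps the
    second coordinates of the box away from 0.\<close>
  define \<beta> where "\<beta> = min (min (e / 4) d) (norm w0 / 4)"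
  have \<beta>: "0 < \<beta>" "\<beta> \<le> e / 4" "\<beta> \<le> d" "\<beta> \<le> norm w0 / 4" using e d w0 by (auto simp: \<beta>_def)
  have box: "dist (u, v) (z0, w0) < e" if "u \<in> cball z0 \<beta>" "v \<in> cball w0 \<beta>" for u v
  proof -
    have "dist (u, v) (z0, w0) \<le> \<bar>dist u z0\<bar> + \<bar>dist v w0\<bar>"
      unfolding dist_Pair_Pair by (rule sqrt_sum_squares_le_sum_abs)
    also have "\<dots> \<le> \<beta> + \<beta>" using that by (simp add: dist_commute add_mono)
    also have "\<dots> < e" using \<beta> e by simp
    finally show ?thesis .
  qed
  show ?thesis
  proof (rule that[OF \<beta>(1,4)])
    have "cball z0 \<beta> \<subseteq> S" using d \<beta>(3) by force
    then show "g holomorphic_on cball z0 \<beta>" using S(3) holomorphic_on_subset by blast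
    show "cball z0 \<beta> \<times> cball w0 \<beta> \<subseteq> U" using e(2) box by blast
    show "(H (u, v) = 0 \<longleftrightarrow> v = g u) \<and> partial2 H (u, v) \<noteq> 0" if "u \<in> cball z0 \<beta>" "v \<in> cball w0 \<beta>" for u v
      using e(2)[OF box[OF that]] by simp
  qed
qed

text \<open>The residue of v \<mapsto> F(u, v) at the simple pole v = g u.\<close>

definition R where "R u = G (u, g u) / partial2 H (u, g u)"

lemma pole_limit:
  assumes "(u, g u) \<in> U" "H (u, g u) = 0" "partial2 H (u, g u) \<noteq> 0"
  shows "((\<lambda>v. (v - g u) * F (u, v)) \<longlongrightarrow> R u) (at (g u))"
proof -
  have "((\<lambda>v. H (u, v)) has_field_derivative partial2 H (u, g u)) (at (g u))"
    by (rule sep_hol_partials(2)[OF H assms(1)])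
  then have "((\<lambda>v. H (u, v) / (v - g u)) \<longlongrightarrow> partial2 H (u, g u)) (at (g u))"
    using assms(2) by (simp add: has_field_derivative_iff)
  moreover have "((\<lambda>v. G (u, v)) \<longlongrightarrow> G (u, g u)) (at (g u))"
    using DERIV_isCont[OF sep_hol_partials(2)[OF G assms(1)]] by (simp add: isCont_def)
  ultimately have "((\<lambda>v. G (u, v) / (H (u, v) / (v - g u))) \<longlongrightarrow> R u) (at (g u))"
    unfolding R_def using assms(3) by (intro tendsto_divide)
  then show ?thesis by (simp add: F mult.commute)
qed

lemma psi_eq:
  assumes "(u, g u) \<in> U" "H (u, g u) = 0" "partial2 H (u, g u) \<noteq> 0" "g u \<noteq> 0"
  shows "psi F g u = - R u / g u"
proof -
  have "((\<lambda>v. (v - g u) * F (u, v) / v) \<longlongrightarrow> R u / g u) (at (g u))"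
    using pole_limit[OF assms(1-3)] assms(4) by (intro tendsto_divide tendsto_ident_at)
  then have "Lim (at (g u)) (\<lambda>v. (v - g u) * F (u, v) / v) = R u / g u" by (intro tendsto_Lim) auto
  then show ?thesis by (simp add: psi_def)
qed


text \<open>For u near z0 the point g u is the only zero of H(u, \<cdot>) in the disk of radius |w0|
  + \<delta>. Removing the principal part R u/(v - g u), whose s-th coefficient is -R u/(g u)^(s+1),
  leaves a function holomorphic beyond |w0|. Cauchy's estimate for it gives the decay \<rho>^(-s)
  with \<rho> > |w0|.\<close>

lemma inner_structure:
  obtains \<beta>1 \<rho> M where "0 < \<beta>1" "norm w0 < \<rho>" "g holomorphic_on cball z0 \<beta>1" "R holomorphic_on ball z0 \<beta>1"
    "continuous_on (cball z0 \<beta>1) R"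
    "\<And>u. u \<in> cball z0 \<beta>1 \<Longrightarrow> (u, g u) \<in> U \<and> H (u, g u) = 0 \<and> partial2 H (u, g u) \<noteq> 0 \<and> norm (g u - w0) < norm w0 / 4"
    "\<And>u s. u \<in> cball z0 \<beta>1 \<Longrightarrow> norm (taylor_coeff (\<lambda>v. F (u, v)) s + R u / g u ^ Suc s) \<le> M / \<rho> ^ s"
proof -
  obtain \<beta> where \<beta>: "0 < \<beta>" "\<beta> \<le> norm w0 / 4" "g holomorphic_on cball z0 \<beta>" "cball z0 \<beta> \<times> cball w0 \<beta> \<subseteq> U"
    "\<And>u v. u \<in> cball z0 \<beta> \<Longrightarrow> v \<in> cball w0 \<beta> \<Longrightarrow> (H (u, v) = 0 \<longleftrightarrow> v = g u) \<and> partial2 H (u, v) \<noteq> 0"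
    by (fact local_box)
  obtain \<delta> where \<delta>: "0 < \<delta>"
    "\<And>u v. norm u \<le> norm z0 + \<delta> \<Longrightarrow> norm v \<le> norm w0 + \<delta> \<Longrightarrow>
       (u, v) \<in> U \<and> (H (u, v) = 0 \<longrightarrow> norm (u - z0) < \<beta> \<and> norm (v - w0) < \<beta>)"
    by (fact zeros_near_point[OF \<beta>(1)])
  have contg: "continuous_on (cball z0 \<beta>) g" using \<beta>(3) by (rule holomorphic_on_imp_continuous_on)
  have "0 < min (\<delta> / 2) \<beta>" using \<delta> \<beta> by simp
  then obtain d where d: "0 < d" "\<And>u. u \<in> cball z0 \<beta> \<Longrightarrow> dist u z0 < d \<Longrightarrow> dist (g u) (g z0) < min (\<delta> / 2) \<beta>"
    using contg[unfolded continuous_on_iff] \<beta>(1) by (metis centre_in_cball less_eq_real_def)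
  define \<beta>1 where "\<beta>1 = min (min (d / 2) \<beta>) \<delta>"
  have \<beta>1: "0 < \<beta>1" "\<beta>1 \<le> d / 2" "\<beta>1 \<le> \<beta>" "\<beta>1 \<le> \<delta>" using d \<beta> \<delta> by (auto simp: \<beta>1_def)
  have sub: "cball z0 \<beta>1 \<subseteq> cball z0 \<beta>" using \<beta>1 by auto
  have gb: "norm (g u - w0) < \<delta> / 2" "norm (g u - w0) < \<beta>" if "u \<in> cball z0 \<beta>1" for u
    using d(2)[of u] that \<beta>1 sub d(1) by (auto simp: g_z0 dist_norm norm_minus_commute)
  have nu: "norm u \<le> norm z0 + \<delta>" if "u \<in> cball z0 \<beta>1" for u
    using that \<beta>1 norm_triangle_ineq2[of u z0] by (auto simp: dist_norm norm_minus_commute)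
  have curve: "(u, g u) \<in> U \<and> H (u, g u) = 0 \<and> partial2 H (u, g u) \<noteq> 0 \<and> norm (g u - w0) < norm w0 / 4"
    if u: "u \<in> cball z0 \<beta>1" for u
  proof -
    have "u \<in> cball z0 \<beta>" using u sub by blast
    moreover have "g u \<in> cball w0 \<beta>" using gb[OF u] by (simp add: dist_norm norm_minus_commute)
    ultimately show ?thesis using \<beta>(4,5) gb[OF u] \<beta>(2) by auto
  qed
  have gu0: "g u \<noteq> 0" if "u \<in> cball z0 \<beta>1" for u using curve[OF that] w0 by auto
  \<comment> \<open>The radii are nested: |g u| < |w0| + \<delta>/2 < \<rho> < r. On the circle of
    radius \<rho> the distance to the pole is at least \<delta>/4.\<close>
  define r where "r = norm w0 + \<delta>"
  define \<rho> where "\<rho> = norm w0 + 3 / 4 * \<delta>"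
  have r\<rho>: "norm w0 < \<rho>" "\<rho> < r" "0 < \<rho>" using \<delta>(1) by (auto simp: r_def \<rho>_def intro: add_nonneg_pos)
  have gr: "norm (g u) < norm w0 + \<delta> / 2" if "u \<in> cball z0 \<beta>1" for u
    using gb[OF that] norm_triangle_ineq2[of "g u" w0] by linarith
  have inU: "(u, v) \<in> U" if "u \<in> cball z0 \<beta>1" "norm v \<le> r" for u v
    using \<delta>(2)[OF nu[OF that(1)]] that(2) by (simp add: r_def)
  have zero: "v = g u" if "u \<in> cball z0 \<beta>1" "norm v \<le> r" "H (u, v) = 0" for u v
  proof -
    have "norm (v - w0) < \<beta>" using \<delta>(2)[OF nu[OF that(1)]] that(2,3) by (simp add: r_def)
    then have "v \<in> cball w0 \<beta>" by (simp add: dist_norm norm_minus_commute)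
    then show ?thesis using \<beta>(5)[of u v] that sub by auto
  qed
  have ring: "(u, v) \<in> V" if "u \<in> cball z0 \<beta>1" "norm v \<le> r" "v \<noteq> g u" for u v
    using inU[OF that(1,2)] zero[OF that(1,2)] that(3) by (auto simp: V_def)
  have sph: "cball z0 \<beta>1 \<times> sphere 0 \<rho> \<subseteq> V"
  proof -
    have "(u, v) \<in> V" if "u \<in> cball z0 \<beta>1" "norm v = \<rho>" for u v
      using ring[OF that(1)] gr[OF that(1)] that(2) r\<rho> \<delta>(1) by (force simp: \<rho>_def)
    then show ?thesis by auto
  qed
  have contR: "continuous_on (cball z0 \<beta>1) R"
  proof -
    have cg: "continuous_on (cball z0 \<beta>1) (\<lambda>u. (u, g u))"
      by (intro continuous_on_Pair continuous_on_id continuous_on_subset[OF contg sub])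
    have im: "(\<lambda>u. (u, g u)) ` cball z0 \<beta>1 \<subseteq> U" using curve by blast
    have "continuous_on (cball z0 \<beta>1) (\<lambda>u. G (u, g u))"
      using G by (intro continuous_on_compose2[OF _ cg im]) (simp add: sep_hol_def)
    moreover have "continuous_on (cball z0 \<beta>1) (\<lambda>u. partial2 H (u, g u))"
      by (rule continuous_on_compose2[OF sep_hol_continuous_partial2[OF H] cg im])
    ultimately show ?thesis unfolding R_def using curve by (intro continuous_on_divide) auto
  qed
  \<comment> \<open>F(u, \<cdot>) with its pole multiplied away; the value at g u is the limit
    there, so the singularity is removable.\<close>
  define Q where "Q = (\<lambda>u v. if v = g u then R u else (v - g u) * F (u, v))"
  have Fhol: "(\<lambda>v. F (u, v)) holomorphic_on ball 0 r - {g u}" if "u \<in> cball z0 \<beta>1" for u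
    by (rule sep_hol_snd[OF F_sep_hol]) (auto intro!: ring[OF that])
  have Qhol: "Q u holomorphic_on ball 0 r" if u: "u \<in> cball z0 \<beta>1" for u
  proof (rule no_isolated_singularity'[where K = "{g u}"])
    have "(\<lambda>v. (v - g u) * F (u, v)) holomorphic_on ball 0 r - {g u}"
      by (intro holomorphic_intros Fhol[OF u])
    then show "Q u holomorphic_on ball 0 r - {g u}"
      by (rule holomorphic_transform) (simp add: Q_def)
    have "(Q u \<longlongrightarrow> R u) (at (g u))"
    proof (rule Lim_transform_eventually[OF pole_limit])
      show "\<forall>\<^sub>F v in at (g u). (v - g u) * F (u, v) = Q u v"
        by (simp add: eventually_at_filter Q_def)
    qed (use curve[OF u] in auto)
    then show "(Q u \<longlongrightarrow> Q u v) (at v within ball 0 r)" if "v \<in> {g u}" for v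
      using that by (auto simp: Q_def intro: tendsto_within_subset)
  qed auto
  have gur: "g u \<in> ball 0 r" "g u \<in> ball 0 \<rho>" if "u \<in> cball z0 \<beta>1" for u
    using gr[OF that] \<delta>(1) by (auto simp: r_def \<rho>_def)
  \<comment> \<open>Over a fixed circle the residue becomes a parameter integral of F, and its
    holomorphy in u follows.\<close>
  have Rint: "contour_integral (circlepath 0 \<rho>) (\<lambda>\<zeta>. F (u, \<zeta>)) = 2 * of_real pi * \<i> * R u" if u: "u \<in> cball z0 \<beta>1" for u
  proof -
    have Q\<rho>: "Q u holomorphic_on cball 0 \<rho>" using r\<rho> by (intro holomorphic_on_subset[OF Qhol[OF u]]) auto
    have "((\<lambda>v. Q u v / (v - g u)) has_contour_integral 2 * of_real pi * \<i> * Q u (g u)) (circlepath 0 \<rho>)"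
    proof (rule Cauchy_integral_circlepath)
      show "continuous_on (cball 0 \<rho>) (Q u)" using Q\<rho> by (rule holomorphic_on_imp_continuous_on)
      show "Q u holomorphic_on ball 0 \<rho>" using Q\<rho> ball_subset_cball by (rule holomorphic_on_subset)
    qed (use gur[OF u] in auto)
    then have "((\<lambda>\<zeta>. F (u, \<zeta>)) has_contour_integral 2 * of_real pi * \<i> * Q u (g u)) (circlepath 0 \<rho>)"
    proof (rule has_contour_integral_eq)
      fix v assume "v \<in> path_image (circlepath 0 \<rho>)"
      then have "norm v = \<rho>" using r\<rho> by simp
      then have "v \<noteq> g u" using gur(2)[OF u] by auto
      then show "Q u v / (v - g u) = F (u, v)" by (simp add: Q_def)
    qed
    then show ?thesis by (simp add: contour_integral_unique Q_def)
  qed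
  have holR: "R holomorphic_on ball z0 \<beta>1"
  proof -
    have s2: "ball z0 \<beta>1 \<times> sphere 0 \<rho> \<subseteq> V" using sph by auto
    have "(\<lambda>u. contour_integral (circlepath 0 \<rho>) (\<lambda>\<zeta>. F (u, \<zeta>))) holomorphic_on ball z0 \<beta>1"
    proof (rule circle_integral_holomorphic[where h' = "\<lambda>u \<zeta>. partial1 F (u, \<zeta>)"])
      show "((\<lambda>w. F (w, \<zeta>)) has_field_derivative partial1 F (w, \<zeta>)) (at w)"
        if "w \<in> ball z0 \<beta>1" "\<zeta> \<in> sphere 0 \<rho>" for w \<zeta>
        using s2 that by (intro sep_hol_partials(1)[OF F_sep_hol]) auto
      show "continuous_on (sphere 0 \<rho>) (\<lambda>\<zeta>. F (w, \<zeta>))" if w: "w \<in> ball z0 \<beta>1" for w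
        by (rule holomorphic_on_imp_continuous_on, rule sep_hol_snd[OF F_sep_hol]) (use s2 w in auto)
      show "continuous_on (ball z0 \<beta>1 \<times> sphere 0 \<rho>) (\<lambda>(w, \<zeta>). partial1 F (w, \<zeta>))"
        using continuous_on_subset[OF sep_hol_continuous_partial1[OF F_sep_hol] s2] by (simp add: case_prod_unfold)
    qed (use r\<rho> in auto)
    then have "(\<lambda>u. contour_integral (circlepath 0 \<rho>) (\<lambda>\<zeta>. F (u, \<zeta>)) / (2 * of_real pi * \<i>)) holomorphic_on ball z0 \<beta>1"
      by (intro holomorphic_on_divide holomorphic_on_const) auto
    then show ?thesis by (rule holomorphic_transform) (use Rint in auto)
  qed
  have cV: "compact (F ` (cball z0 \<beta>1 \<times> sphere 0 \<rho>))"
    by (intro compact_continuous_image compact_Times compact_cball compact_sphere continuous_on_subset[OF F_continuous sph])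
  obtain MF where MF: "\<And>u v. u \<in> cball z0 \<beta>1 \<Longrightarrow> norm v = \<rho> \<Longrightarrow> norm (F (u, v)) \<le> MF"
  proof -
    obtain B where "\<forall>x\<in>F ` (cball z0 \<beta>1 \<times> sphere 0 \<rho>). norm x \<le> B" using compact_imp_bounded[OF cV] by (auto simp: bounded_iff)
    then show ?thesis by (intro that[of B]) auto
  qed
  obtain MR where MR: "\<And>u. u \<in> cball z0 \<beta>1 \<Longrightarrow> norm (R u) \<le> MR"
  proof -
    have "bounded (R ` cball z0 \<beta>1)" by (intro compact_imp_bounded compact_continuous_image contR compact_cball)
    then obtain B where "\<forall>x\<in>R ` cball z0 \<beta>1. norm x \<le> B" by (auto simp: bounded_iff)
    then show ?thesis by (intro that[of B]) auto
  qed
  have MR0: "0 \<le> MR" using MR[of z0] \<beta>1(1) order_trans[OF norm_ge_zero] by fastforce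
  have coeff: "norm (taylor_coeff (\<lambda>v. F (u, v)) s + R u / g u ^ Suc s) \<le> (MF + MR / (\<delta> / 4)) / \<rho> ^ s"
    if u: "u \<in> cball z0 \<beta>1" for u s
  proof -
    \<comment> \<open>F minus its principal part. The value at the pole is the derivative of Q, the
      one that makes the difference quotient (Q v - R u)/(v - g u) holomorphic.\<close>
    define E where "E = (\<lambda>v. if v = g u then deriv (Q u) (g u) else F (u, v) - R u / (v - g u))"
    have "(\<lambda>v. if v = g u then deriv (Q u) (g u) else F (u, v) - Q u (g u) / (v - g u)) holomorphic_on ball 0 r"
      by (rule pole_theorem[OF Qhol[OF u]]) (use gur[OF u] in \<open>auto simp: Q_def\<close>)
    moreover have "Q u (g u) = R u" by (simp add: Q_def)
    ultimately have Ehol: "E holomorphic_on ball 0 r" by (simp only: E_def)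
    have "norm ((deriv ^^ s) E 0) \<le> fact s * (MF + MR / (\<delta> / 4)) / \<rho> ^ s"
    proof (rule Cauchy_inequality)
      have s3: "cball 0 \<rho> \<subseteq> ball (0::complex) r" "ball 0 \<rho> \<subseteq> ball (0::complex) r" using r\<rho> by auto
      show "E holomorphic_on ball 0 \<rho>" using Ehol s3(2) by (rule holomorphic_on_subset)
      show "continuous_on (cball 0 \<rho>) E" using Ehol s3(1) by (intro holomorphic_on_imp_continuous_on) (rule holomorphic_on_subset)
      fix v :: complex assume "norm (0 - v) = \<rho>"
      then have v: "norm v = \<rho>" by simp
      have far: "\<delta> / 4 \<le> norm (v - g u)"
        using gr[OF u] v norm_triangle_ineq2[of v "g u"] by (simp add: \<rho>_def)
      have vg: "v \<noteq> g u" using far \<delta>(1) by auto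
      have "norm (E v) \<le> norm (F (u, v)) + norm (R u / (v - g u))"
        using vg by (simp add: E_def norm_triangle_ineq4)
      also have "\<dots> \<le> MF + MR / (\<delta> / 4)"
        unfolding norm_divide using far \<delta>(1) MR0
        by (intro add_mono MF[OF u v] frac_le MR[OF u]) auto
      finally show "norm (E v) \<le> MF + MR / (\<delta> / 4)" .
    qed (use r\<rho> in auto)
    then have Eb: "norm (taylor_coeff E s) \<le> (MF + MR / (\<delta> / 4)) / \<rho> ^ s"
      by (simp add: taylor_coeff_def norm_divide field_simps)
    \<comment> \<open>Both sides are compared as power series on |y| < |g u|, where the principal
      part is a geometric series in y/(g u).\<close>
    have "taylor_coeff (\<lambda>v. F (u, v)) s = taylor_coeff E s - R u / g u ^ Suc s"
    proof (rule taylor_coeff_unique)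
      show "0 < min r (norm (g u))" using r\<rho> gu0[OF u] by auto
      fix y :: complex assume y: "norm y < min r (norm (g u))"
      have "(\<lambda>n. (y / g u) ^ n) sums (1 / (1 - y / g u))"
        using y gu0[OF u] by (intro geometric_sums) (simp add: norm_divide)
      then have "(\<lambda>n. R u / g u * (y / g u) ^ n) sums (R u / g u * (1 / (1 - y / g u)))" by (rule sums_mult)
      moreover have "(\<lambda>n. taylor_coeff E n * y ^ n) sums E y" using y by (intro taylor_coeff_sums[OF Ehol]) simp
      ultimately have "(\<lambda>n. taylor_coeff E n * y ^ n - R u / g u * (y / g u) ^ n) sums (E y - R u / g u * (1 / (1 - y / g u)))"
        by (intro sums_diff)
      moreover have "E y - R u / g u * (1 / (1 - y / g u)) = F (u, y)"
      proof -
        have "y \<noteq> g u" using y by auto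
        then have "R u / g u * (1 / (1 - y / g u)) = - (R u / (y - g u))"
          using gu0[OF u] by (simp add: divide_simps) (simp add: algebra_simps)
        then show ?thesis using \<open>y \<noteq> g u\<close> by (simp add: E_def)
      qed
      moreover have "taylor_coeff E n * y ^ n - R u / g u * (y / g u) ^ n = (taylor_coeff E n - R u / g u ^ Suc n) * y ^ n" for n
        by (simp add: power_divide left_diff_distrib)
      ultimately show "(\<lambda>n. (taylor_coeff E n - R u / g u ^ Suc n) * y ^ n) sums F (u, y)" by simp
    qed
    then show ?thesis using Eb by simp
  qed
  show ?thesis
    by (rule that[OF \<beta>1(1) r\<rho>(1) holomorphic_on_subset[OF \<beta>(3) sub] holR contR curve coeff])
qed

text \<open>For u at distance at least b from z0, H(u, \<cdot>) has no zero in a closed disk of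
  radius \<rho> > |w0|. The set of such u is compact, so F is bounded on the product and Cauchy's
  estimate is uniform in u.\<close>

lemma outer_bound:
  assumes "0 < b"
  obtains \<rho> \<delta> M where "norm w0 < \<rho>" "0 < \<delta>"
    "\<And>u s. norm u \<le> norm z0 + \<delta> \<Longrightarrow> b \<le> norm (u - z0) \<Longrightarrow> norm (taylor_coeff (\<lambda>v. F (u, v)) s) \<le> M / \<rho> ^ s"
proof -
  obtain \<delta> where \<delta>: "0 < \<delta>"
    "\<And>u v. norm u \<le> norm z0 + \<delta> \<Longrightarrow> norm v \<le> norm w0 + \<delta> \<Longrightarrow>
       (u, v) \<in> U \<and> (H (u, v) = 0 \<longrightarrow> norm (u - z0) < b \<and> norm (v - w0) < b)"
    by (fact zeros_near_point[OF assms])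
  define \<rho> where "\<rho> = norm w0 + \<delta>"
  define C where "C = cball 0 (norm z0 + \<delta>) \<inter> {u. b \<le> norm (u - z0)}"
  have \<rho>: "norm w0 < \<rho>" "0 < \<rho>" using \<delta> by (auto simp: \<rho>_def add_nonneg_pos)
  have CV: "C \<times> cball 0 \<rho> \<subseteq> V" using \<delta>(2) by (fastforce simp: C_def \<rho>_def V_def)
  have "compact C" unfolding C_def by (intro compact_Int_closed compact_cball closed_Collect_le continuous_intros)
  then have cF: "compact (F ` (C \<times> cball 0 \<rho>))"
    by (intro compact_continuous_image compact_Times compact_cball continuous_on_subset[OF F_continuous CV])
  then obtain B where B: "\<forall>x\<in>F ` (C \<times> cball 0 \<rho>). norm x \<le> B"
    using compact_imp_bounded[OF cF] by (auto simp: bounded_iff)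
  show ?thesis
  proof (rule that[OF \<rho>(1) \<delta>(1)])
    fix u s assume "norm u \<le> norm z0 + \<delta>" "b \<le> norm (u - z0)"
    then have u: "u \<in> C" by (simp add: C_def)
    have hol: "(\<lambda>v. F (u, v)) holomorphic_on cball 0 \<rho>"
      by (rule sep_hol_snd[OF F_sep_hol]) (use CV u in auto)
    have "norm ((deriv ^^ s) (\<lambda>v. F (u, v)) 0) \<le> fact s * B / \<rho> ^ s"
    proof (rule Cauchy_inequality)
      show "(\<lambda>v. F (u, v)) holomorphic_on ball 0 \<rho>" using hol ball_subset_cball by (rule holomorphic_on_subset)
      show "continuous_on (cball 0 \<rho>) (\<lambda>v. F (u, v))" using hol by (rule holomorphic_on_imp_continuous_on)
      show "norm (F (u, v)) \<le> B" if "norm (0 - v) = \<rho>" for v using B u that by auto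
    qed (use \<rho> in auto)
    then show "norm (taylor_coeff (\<lambda>v. F (u, v)) s) \<le> B / \<rho> ^ s"
      by (simp add: taylor_coeff_def norm_divide field_simps)
  qed
qed

text \<open>The closed disk |v| \<le> |w0|/2 avoids all zeros of H for |u| < |z0| + \<delta>, also
  for u near z0, because every zero in the enlarged polydisk satisfies |v - w0| < |w0|/2.\<close>

lemma coefficient_holomorphic:
  obtains \<rho> where "norm z0 < \<rho>" "\<And>s. (\<lambda>u. taylor_coeff (\<lambda>v. F (u, v)) s) holomorphic_on ball 0 \<rho>"
proof -
  have "0 < norm w0 / 2" using w0 by simp
  from zeros_near_point[OF this] obtain \<delta> where \<delta>: "0 < \<delta>"
    "\<And>u v. norm u \<le> norm z0 + \<delta> \<Longrightarrow> norm v \<le> norm w0 + \<delta> \<Longrightarrow>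
       (u, v) \<in> U \<and> (H (u, v) = 0 \<longrightarrow> norm (u - z0) < norm w0 / 2 \<and> norm (v - w0) < norm w0 / 2)"
    by metis
  have sub: "ball 0 (norm z0 + \<delta>) \<times> cball 0 (norm w0 / 2) \<subseteq> V"
  proof -
    have "(u, v) \<in> V" if "norm u < norm z0 + \<delta>" "norm v \<le> norm w0 / 2" for u v
    proof -
      have "norm w0 - norm v \<le> norm (v - w0)" using norm_triangle_ineq2[of w0 v] by (simp add: norm_minus_commute)
      then have "\<not> norm (v - w0) < norm w0 / 2" using that by linarith
      moreover have "norm v \<le> norm w0 + \<delta>" using that \<delta>(1) norm_ge_zero[of w0] by linarith
      ultimately show ?thesis using \<delta>(2)[of u v] that by (auto simp: V_def)
    qed
    then show ?thesis by auto
  qed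
  show ?thesis
  proof (rule that)
    show "norm z0 < norm z0 + \<delta>" using \<delta> by simp
    show "(\<lambda>u. taylor_coeff (\<lambda>v. F (u, v)) s) holomorphic_on ball 0 (norm z0 + \<delta>)" for s
      by (rule taylor_coeff_snd_holomorphic[OF F_sep_hol sub]) (use w0 in auto)
  qed
qed

end

section \<open>The leading coefficient, comparison of germs, and the direction of a pole\<close>

lemma taylor_coeff_diff:
  assumes "f holomorphic_on ball 0 r" "h holomorphic_on ball 0 r" "0 < r"
  shows "taylor_coeff (\<lambda>x. f x - h x) l = taylor_coeff f l - taylor_coeff h l"
  using higher_deriv_diff[OF assms(1,2) open_ball, of 0 l] assms(3)
  by (simp add: taylor_coeff_def diff_divide_distrib)

text \<open>If Re c were negative, the leading term c x^k would outweigh the remainder D x^(k+1) for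
  small x > 0 and make Re f negative.\<close>

lemma Re_leading_coeff_nonneg:
  assumes hol: "f holomorphic_on ball 0 \<tau>" and bd: "\<And>x. norm x < \<tau> \<Longrightarrow> norm (f x) \<le> M" and "0 < \<tau>"
    and ord: "is_order_at_0 f k" and pos: "\<And>x. 0 < x \<Longrightarrow> x < \<tau> \<Longrightarrow> 0 \<le> Re (f (of_real x))"
  shows "0 \<le> Re (taylor_coeff f k)"
proof (rule ccontr)
  assume neg: "\<not> ?thesis"
  define c where "c = taylor_coeff f k"
  define D where "D = (real (Suc k) + 2) * M * (4 / \<tau>) ^ Suc k"
  \<comment> \<open>Small enough that D x \<le> -Re c/2; the summand 1 keeps the denominator
    positive.\<close>
  define x where "x = min (\<tau> / 2) (- Re c / (2 * (\<bar>D\<bar> + 1)))"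
  have c: "Re c < 0" using neg by (simp add: c_def)
  have x: "0 < x" "x < \<tau>" "x \<le> - Re c / (2 * (\<bar>D\<bar> + 1))" using c assms(3) by (auto simp: x_def divide_neg_pos)
  have "(\<Sum>l<Suc k. taylor_coeff f l * of_real x ^ l) = c * of_real x ^ k"
    using ord by (simp add: is_order_at_0_def c_def)
  then have "norm (f (of_real x) - c * of_real x ^ k) \<le> D * x ^ Suc k"
    using taylor_remainder_bound_ball[OF hol bd assms(3), of "of_real x" "Suc k"] x by (simp add: D_def)
  moreover have "Re (f (of_real x) - c * of_real x ^ k) \<le> norm (f (of_real x) - c * of_real x ^ k)"
    by (rule complex_Re_le_cmod)
  moreover have "Re (c * of_real x ^ k) = Re c * x ^ k" by (simp flip: of_real_power)
  ultimately have "0 \<le> (Re c + D * x) * x ^ k"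
    using pos[OF x(1,2)] by (simp add: algebra_simps)
  moreover have "0 < x ^ k" using x by simp
  ultimately have "0 \<le> Re c + D * x" by (simp add: zero_le_mult_iff)
  moreover have "D * x \<le> (\<bar>D\<bar> + 1) * x" using x by (intro mult_right_mono) auto
  moreover have "(\<bar>D\<bar> + 1) * x \<le> (\<bar>D\<bar> + 1) * (- Re c / (2 * (\<bar>D\<bar> + 1)))" using x by (intro mult_left_mono) auto
  moreover have "(\<bar>D\<bar> + 1) * (- Re c / (2 * (\<bar>D\<bar> + 1))) = - Re c / 2" by (simp add: field_simps)
  ultimately show False using c by linarith
qed

lemma b_coeff_cong:
  assumes f: "f \<in> phase_class \<tau> M m k" "0 < \<tau>" "0 < M" "0 < m" "0 < k"
    and eq: "\<forall>\<^sub>F x in nhds 0. f x = f' x" "\<forall>\<^sub>F x in nhds 0. \<psi> x = \<psi>' x"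
  shows "b_coeff \<psi>' f' k l = b_coeff \<psi> f k l"
proof -
  obtain \<eta> where \<eta>: "\<eta> analytic_on {0}" "\<eta> 0 = 0" "\<forall>\<^sub>F x in nhds 0. \<eta> (y_coord f k x) = x"
    "\<forall>\<^sub>F t in nhds 0. y_coord f k (\<eta> t) = t"
    by (fact phase_class_local_inverse[OF f])
  show ?thesis
    using b_coeff_eq[OF \<eta> eq] b_coeff_eq[OF \<eta>, of f \<psi> \<psi>] by simp
qed

lemma is_order_at_0_cong:
  assumes "\<forall>\<^sub>F x in nhds 0. f x = f' x"
  shows "is_order_at_0 f k \<longleftrightarrow> is_order_at_0 f' k"
  using taylor_coeff_cong[OF assms] by (simp add: is_order_at_0_def)

text \<open>H vanishes along (u, g1 u), and near the point its zeros are exactly the graph of g2. So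
  the parametrization given at a pole close to a fixed one can be replaced by that of the fixed
  pole.\<close>

lemma parametrizes_unique:
  assumes "g1 analytic_on {z}" "parametrizes g2 H (z, g1 z)" "\<forall>\<^sub>F u in nhds z. H (u, g1 u) = 0"
  shows "\<forall>\<^sub>F u in nhds z. g2 u = g1 u"
proof -
  have "isCont g1 z" using assms(1) by (rule analytic_at_imp_isCont)
  then have "filterlim (\<lambda>u. (u, g1 u)) (nhds (z, g1 z)) (nhds z)"
    by (intro tendsto_Pair filterlim_ident) (simp add: isCont_def tendsto_at_iff_tendsto_nhds)
  moreover have "\<forall>\<^sub>F q in nhds (z, g1 z). H q = 0 \<longleftrightarrow> snd q = g2 (fst q)"
    using assms(2) by (simp add: parametrizes_def zero_set_def)
  ultimately have "\<forall>\<^sub>F u in nhds z. H (u, g1 u) = 0 \<longleftrightarrow> snd (u, g1 u) = g2 (fst (u, g1 u))"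
    by (rule eventually_compose_filterlim[rotated])
  with assms(3) show ?thesis by eventually_elim simp
qed

lemma filterlim_rotation:
  "filterlim (\<lambda>\<theta>. z * exp (\<i> * \<theta>)) (nhds z) (nhds 0)"
proof -
  have "isCont (\<lambda>\<theta>. z * exp (\<i> * \<theta>)) 0" by (intro continuous_intros)
  then show ?thesis using tendsto_at_iff_tendsto_nhds[of "\<lambda>\<theta>. z * exp (\<i> * \<theta>)" 0] by (simp add: isCont_def)
qed

lemma tilde_cong:
  assumes "\<forall>\<^sub>F u in nhds z. g2 u = g1 u"
  shows "\<forall>\<^sub>F \<theta> in nhds 0. f_tilde g1 z slope \<theta> = f_tilde g2 z slope \<theta>"
    and "\<forall>\<^sub>F \<theta> in nhds 0. psi_tilde F g1 z \<theta> = psi_tilde F g2 z \<theta>"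
proof -
  have e: "\<forall>\<^sub>F \<theta> in nhds 0. g2 (z * exp (\<i> * \<theta>)) = g1 (z * exp (\<i> * \<theta>))"
    by (rule eventually_compose_filterlim[OF assms filterlim_rotation])
  have "g2 z = g1 z" using assms by (rule eventually_nhds_x_imp_x)
  with e show "\<forall>\<^sub>F \<theta> in nhds 0. f_tilde g1 z slope \<theta> = f_tilde g2 z slope \<theta>"
    by (auto simp: f_tilde_def elim!: eventually_mono)
  show "\<forall>\<^sub>F \<theta> in nhds 0. psi_tilde F g1 z \<theta> = psi_tilde F g2 z \<theta>"
    using e by (auto simp: psi_tilde_def psi_def elim!: eventually_mono)
qed

text \<open>The ratio r/s dictated by the direction: implicit differentiation gives z H_z/(w H_w) =
  -z g'(z)/g(z). This number is real at a minimal point; the real part makes the definition a real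
  function also at neighbouring z where it is not.\<close>

definition slope_of :: "(complex \<Rightarrow> complex) \<Rightarrow> complex \<Rightarrow> real" where
  "slope_of g z = - Re (z * deriv g z / g z)"

context smooth_point
begin

text \<open>Otherwise (u, g u) would be a second zero of H in the closed polydisk of (z, g
  z).\<close>

lemma minimal_on_circle:
  assumes "strictly_minimal H (z, g z)" "H (u, g u) = 0" "norm u = norm z" "u \<noteq> z"
  shows "norm (g z) < norm (g u)"
proof (rule ccontr)
  assume "\<not> ?thesis"
  then have "(u, g u) \<in> zero_set H \<inter> polydisk (z, g z)" using assms by (auto simp: zero_set_def polydisk_def)
  then show False using assms(1,4) by (auto simp: strictly_minimal_def)
qed

text \<open>On the circle through \<open>z\<close> the function \<open>\<bar>g\<bar>\<close> has a minimum at \<open>z\<close>, so the angular derivative of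
  \<open>log g\<close> has no real part.\<close>

lemma log_derivative_real:
  assumes "strictly_minimal H (z, g z)" "\<forall>\<^sub>F u in nhds z. H (u, g u) = 0" "g analytic_on {z}" "g z \<noteq> 0"
  shows "z * deriv g z / g z = - of_real (slope_of g z)"
proof -
  define L where "L = (\<lambda>\<theta>::real. Re (Ln (g (z * exp (\<i> * of_real \<theta>)) / g z)))"
  have d: "(g has_field_derivative deriv g z) (at z)"
    using assms(3) by (simp add: analytic_on_imp_differentiable_at field_differentiable_derivI)
  have "((\<lambda>\<theta>. g (z * exp (\<i> * \<theta>)) / g z) has_field_derivative deriv g z * (z * \<i>) / g z) (at 0)"
  proof (rule DERIV_cdivide)
    have "((\<lambda>\<theta>. z * exp (\<i> * \<theta>)) has_field_derivative z * \<i>) (at 0)" by (auto intro!: derivative_eq_intros)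
    then show "((\<lambda>\<theta>. g (z * exp (\<i> * \<theta>))) has_field_derivative deriv g z * (z * \<i>)) (at 0)"
      using d by (intro DERIV_chain2[of g]) auto
  qed
  then have "((\<lambda>\<theta>. Ln (g (z * exp (\<i> * \<theta>)) / g z)) has_field_derivative inverse 1 * (deriv g z * (z * \<i>) / g z)) (at 0)"
    by (intro DERIV_chain2[of Ln]) (use assms(4) has_field_derivative_Ln[of 1] in auto)
  then have "((\<lambda>\<theta>. Ln (g (z * exp (\<i> * \<theta>)) / g z)) has_field_derivative \<i> * (z * deriv g z / g z)) (at (of_real 0))"
    by (simp add: mult_ac)
  then have "((\<lambda>\<theta>::real. Ln (g (z * exp (\<i> * of_real \<theta>)) / g z)) has_vector_derivative \<i> * (z * deriv g z / g z)) (at 0)"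
    by (rule has_vector_derivative_real_field)
  then have dL: "(L has_real_derivative Re (\<i> * (z * deriv g z / g z))) (at 0)"
    unfolding L_def has_real_derivative_iff_has_vector_derivative
    by (rule bounded_linear.has_vector_derivative[OF bounded_linear_Re])
  have "\<forall>\<^sub>F \<theta> in nhds 0. H (z * exp (\<i> * \<theta>), g (z * exp (\<i> * \<theta>))) = 0"
    by (rule eventually_compose_filterlim[OF assms(2) filterlim_rotation])
  then obtain d where d: "0 < d" "\<And>\<theta>. dist \<theta> 0 < d \<Longrightarrow> H (z * exp (\<i> * \<theta>), g (z * exp (\<i> * \<theta>))) = 0"
    by (auto simp: eventually_nhds_metric)
  have "Re (\<i> * (z * deriv g z / g z)) = 0"
  proof (rule DERIV_local_min[OF dL d(1)], intro allI impI)
    fix \<theta> :: real assume "\<bar>0 - \<theta>\<bar> < d"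
    then have Hz: "H (z * exp (\<i> * of_real \<theta>), g (z * exp (\<i> * of_real \<theta>))) = 0" by (intro d(2)) simp
    have *: "norm (g z) \<le> norm (g (z * exp (\<i> * of_real \<theta>)))"
    proof (cases "z * exp (\<i> * of_real \<theta>) = z")
      case True
      show ?thesis unfolding True by simp
    next
      case False
      then show ?thesis using minimal_on_circle[OF assms(1) Hz] by (simp add: norm_mult)
    qed
    define X where "X = g (z * exp (\<i> * of_real \<theta>)) / g z"
    have "1 \<le> norm X" using * assms(4) by (simp add: X_def norm_divide)
    then have "0 \<le> Re (Ln X)" by (subst Re_Ln) auto
    then show "L 0 \<le> L \<theta>" using assms(4) by (simp add: L_def X_def)
  qed
  then have "Im (z * deriv g z / g z) = 0" by (simp only: Re_i_times neg_equal_0_iff_equal)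
  then show ?thesis by (simp add: slope_of_def complex_eq_iff)
qed

text \<open>Both parts follow from partial1 H = -g' partial2 H. The first supplies a real pair in
  the direction of every pole, so that the hypothesis on the order of the phase can be invoked even
  where no integer pair lies in that direction.\<close>

lemma dir_iff:
  assumes "strictly_minimal H (z, g z)" "\<forall>\<^sub>F u in nhds z. H (u, g u) = 0" "g analytic_on {z}" "g z \<noteq> 0"
    "(z, g z) \<in> U" "partial2 H (z, g z) \<noteq> 0"
  shows "(slope_of g z, 1) \<in> dir H (z, g z)"
    and "(r, s) \<in> dir H (z, g z) \<Longrightarrow> s \<noteq> 0 \<Longrightarrow> r / s = slope_of g z"
proof -
  have d: "(g has_field_derivative deriv g z) (at z)"
    using assms(3) by (simp add: analytic_on_imp_differentiable_at field_differentiable_derivI)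
  have "partial1 H (z, g z) + partial2 H (z, g z) * deriv g z = 0"
    by (rule implicit_derivative[OF H assms(5) d assms(2)])
  then have p1: "partial1 H (z, g z) = - partial2 H (z, g z) * deriv g z" by (simp add: add_eq_0_iff)
  have sl: "of_real (slope_of g z) = - (z * deriv g z / g z)"
    using log_derivative_real[OF assms(1-4)] by simp
  show "(slope_of g z, 1) \<in> dir H (z, g z)"
    unfolding dir_def using assms(4,6)
    by (auto simp: p1 sl field_simps intro!: exI[of _ "1 / (g z * partial2 H (z, g z))"])
  assume rs: "(r, s) \<in> dir H (z, g z)" "s \<noteq> 0"
  then obtain c where c: "complex_of_real r = c * (z * partial1 H (z, g z))" "complex_of_real s = c * (g z * partial2 H (z, g z))"
    by (auto simp: dir_def)
  have c0: "c \<noteq> 0" using c(2) rs(2) by auto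
  have "complex_of_real (r / s) = of_real (slope_of g z)"
    using c0 assms(4,6) unfolding of_real_divide c p1 sl by (simp add: field_simps)
  then show "r / s = slope_of g z" by (simp only: of_real_eq_iff)
qed

text \<open>The curve \<theta> \<mapsto> (z0 e^(i\<theta>), g(z0 e^(i\<theta>))), with complex
  \<theta>, lies in the zero set near the point, and both of its coordinate differences are
  O(\<theta>). So the order of G on the variety passes to the angle, and the amplitude is G along
  the curve times a bounded factor.\<close>

lemma psi_tilde_bigo:
  assumes "vanishes_to_order_on G (zero_set H) (z0, w0) l"
  shows "psi_tilde F g z0 \<in> O[at 0](\<lambda>\<theta>. \<theta> ^ l)"
proof -
  obtain \<beta>1 \<rho> M where inner: "0 < \<beta>1" "norm w0 < \<rho>" "g holomorphic_on cball z0 \<beta>1" "R holomorphic_on ball z0 \<beta>1"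
    "continuous_on (cball z0 \<beta>1) R"
    "\<And>u. u \<in> cball z0 \<beta>1 \<Longrightarrow> (u, g u) \<in> U \<and> H (u, g u) = 0 \<and> partial2 H (u, g u) \<noteq> 0 \<and> norm (g u - w0) < norm w0 / 4"
    "\<And>u s. u \<in> cball z0 \<beta>1 \<Longrightarrow> norm (taylor_coeff (\<lambda>v. F (u, v)) s + R u / g u ^ Suc s) \<le> M / \<rho> ^ s"
    by (fact inner_structure)
  define e where "e = (\<lambda>\<theta>. z0 * exp (\<i> * \<theta>))"
  define q where "q = (\<lambda>\<theta>. (e \<theta>, g (e \<theta>)))"
  have dg: "(g has_field_derivative deriv g z0) (at z0)"
    using inner(1,3) by (intro holomorphic_derivI[OF holomorphic_on_subset[OF inner(3) ball_subset_cball] open_ball]) auto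
  have de: "(e has_field_derivative z0 * \<i>) (at 0)" unfolding e_def by (auto intro!: derivative_eq_intros)
  have e0: "e 0 = z0" by (simp add: e_def)
  have dge: "((\<lambda>\<theta>. g (e \<theta>)) has_field_derivative deriv g z0 * (z0 * \<i>)) (at 0)"
    using DERIV_chain2[OF _ de] dg by (simp add: e0)
  have l1: "((\<lambda>\<theta>. (e \<theta> - z0) / \<theta>) \<longlongrightarrow> z0 * \<i>) (at 0)" using de by (simp add: has_field_derivative_iff e0)
  have l2: "((\<lambda>\<theta>. (g (e \<theta>) - w0) / \<theta>) \<longlongrightarrow> deriv g z0 * (z0 * \<i>)) (at 0)" using dge by (simp add: has_field_derivative_iff e0 g_z0)
  have ebig: "(\<lambda>\<theta>. e \<theta> - z0) \<in> O[at 0](\<lambda>\<theta>. \<theta>)"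
    by (rule bigoI_tendsto[OF l1]) (simp add: eventually_at_filter)
  have gbig: "(\<lambda>\<theta>. g (e \<theta>) - w0) \<in> O[at 0](\<lambda>\<theta>. \<theta>)"
    by (rule bigoI_tendsto[OF l2]) (simp add: eventually_at_filter)
  have ce: "filterlim e (nhds z0) (nhds 0)" unfolding e_def by (rule filterlim_rotation)
  have evD: "\<forall>\<^sub>F \<theta> in nhds 0. e \<theta> \<in> cball z0 \<beta>1"
  proof (rule eventually_compose_filterlim[OF _ ce])
    have "\<forall>\<^sub>F u in nhds z0. u \<in> ball z0 \<beta>1" by (rule eventually_nhds_in_open) (use inner(1) in auto)
    then show "\<forall>\<^sub>F u in nhds z0. u \<in> cball z0 \<beta>1" by (rule eventually_mono) auto
  qed
  have nD: "\<forall>\<^sub>F \<theta> in at 0. e \<theta> \<in> cball z0 \<beta>1" using evD by (simp add: eventually_nhds_conv_at)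
  \<comment> \<open>The order of vanishing is a limit that excludes the point itself; the curve
    avoids it because its derivative z0 i is nonzero.\<close>
  have ne: "\<forall>\<^sub>F \<theta> in at 0. e \<theta> \<noteq> z0"
    by (rule tendsto_imp_eventually_ne[OF l1, of 0, THEN eventually_mono]) (use z0 in auto)
  have fq: "filterlim q (at (z0, w0) within zero_set H) (at 0)"
    unfolding filterlim_at
  proof
    have "isCont e 0" "isCont (\<lambda>\<theta>. g (e \<theta>)) 0" using de dge by (blast intro: DERIV_isCont)+
    then show "filterlim q (nhds (z0, w0)) (at 0)"
      unfolding q_def by (intro tendsto_Pair) (auto simp: isCont_def e0 g_z0)
    show "\<forall>\<^sub>F \<theta> in at 0. q \<theta> \<in> zero_set H \<and> q \<theta> \<noteq> (z0, w0)"
      using ne nD by eventually_elim (use inner(6) in \<open>auto simp: q_def zero_set_def\<close>)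
  qed
  have "(\<lambda>\<theta>. norm (G (q \<theta>))) \<in> O[at 0](\<lambda>\<theta>. norm (z0 - e \<theta>) ^ l + norm (w0 - g (e \<theta>)) ^ l)"
    using landau_o.big.compose[OF assms[unfolded vanishes_to_order_on_def] fq] by (simp add: q_def)
  also have "(\<lambda>\<theta>. norm (z0 - e \<theta>) ^ l + norm (w0 - g (e \<theta>)) ^ l) \<in> O[at 0](\<lambda>\<theta>. norm \<theta> ^ l)"
  proof (intro sum_in_bigo landau_o.big_power)
    show "(\<lambda>\<theta>. norm (z0 - e \<theta>)) \<in> O[at 0](norm)"
      using landau_o.big.uminus_in_iff[of "\<lambda>\<theta>. e \<theta> - z0" "at 0" "\<lambda>\<theta>. \<theta>"] ebig by simp
    show "(\<lambda>\<theta>. norm (w0 - g (e \<theta>))) \<in> O[at 0](norm)"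
      using landau_o.big.uminus_in_iff[of "\<lambda>\<theta>. g (e \<theta>) - w0" "at 0" "\<lambda>\<theta>. \<theta>"] gbig by simp
  qed
  finally have Gbig: "(\<lambda>\<theta>. G (q \<theta>)) \<in> O[at 0](\<lambda>\<theta>. \<theta> ^ l)"
    by (simp add: norm_power[symmetric] del: norm_power)
  define B where "B = (\<lambda>\<theta>. - (1 / (partial2 H (q \<theta>) * g (e \<theta>))))"
  have "(B \<longlongrightarrow> - (1 / (partial2 H (z0, w0) * w0))) (at 0)"
  proof -
    have p0U: "(z0, w0) \<in> U" using U by (auto simp: polydisk_def)
    have "isCont (partial2 H) (z0, w0)"
      using sep_hol_continuous_partial2[OF H] open_U p0U by (simp add: continuous_on_eq_continuous_at)
    then have "((\<lambda>\<theta>. partial2 H (q \<theta>)) \<longlongrightarrow> partial2 H (z0, w0)) (at 0)"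
      using fq filterlim_at by (intro isCont_tendsto_compose[of _ "partial2 H"]) auto
    moreover have "((\<lambda>\<theta>. g (e \<theta>)) \<longlongrightarrow> w0) (at 0)"
      using DERIV_isCont[OF dge] by (simp add: isCont_def e0 g_z0)
    ultimately show ?thesis unfolding B_def using simple w0
      by (intro tendsto_minus tendsto_divide tendsto_const tendsto_mult) auto
  qed
  then have "B \<in> O[at 0](\<lambda>_. 1)" by (intro bigoI_tendsto[of _ _ "- (1 / (partial2 H (z0, w0) * w0))"]) auto
  from landau_o.big.mult[OF Gbig this] have big: "(\<lambda>\<theta>. G (q \<theta>) * B \<theta>) \<in> O[at 0](\<lambda>\<theta>. \<theta> ^ l)" by simp
  have ev: "\<forall>\<^sub>F \<theta> in at 0. G (q \<theta>) * B \<theta> = psi_tilde F g z0 \<theta>"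
    using nD
  proof eventually_elim
    case (elim \<theta>)
    have "g (e \<theta>) \<noteq> 0" using inner(6)[OF elim] w0 by auto
    then have "psi F g (e \<theta>) = - R (e \<theta>) / g (e \<theta>)" using inner(6)[OF elim] by (intro psi_eq) auto
    then show ?case by (simp add: psi_tilde_def B_def R_def q_def e_def)
  qed
  show ?thesis using iffD1[OF landau_o.big.in_cong[OF ev] big] .
qed

end

section \<open>The local expansion\<close>

context smooth_point
begin

text \<open>The phase is jointly continuous on the compact set \<open>S\<close> of pairs (z,
  \<theta>), where z ranges over a full disk and not just over coordinates of poles. Boundedness of
  the phase and, by uniform continuity, its uniform closeness to the phase at z0 follow.\<close>

lemma phase_data:
  assumes \<beta>1: "0 < \<beta>1" and holg: "g holomorphic_on cball z0 \<beta>1" and holR: "R holomorphic_on ball z0 \<beta>1"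
    and contR: "continuous_on (cball z0 \<beta>1) R"
    and inner': "\<forall>u\<in>cball z0 \<beta>1.
        (u, g u) \<in> U \<and> H (u, g u) = 0 \<and> partial2 H (u, g u) \<noteq> 0 \<and> norm (g u - w0) < norm w0 / 4"
  obtains \<beta> \<tau> M where "0 < \<beta>" "\<beta> < \<beta>1" "0 < \<tau>" "0 < M"
    "\<And>z \<theta>. z \<in> cball z0 \<beta> \<Longrightarrow> norm \<theta> \<le> \<tau> \<Longrightarrow> z * exp (\<i> * \<theta>) \<in> ball z0 \<beta>1"
    "\<And>z. z \<in> cball z0 \<beta> \<Longrightarrow> f_tilde g z (slope_of g z) holomorphic_on ball 0 \<tau>"
    "\<And>z \<theta>. z \<in> cball z0 \<beta> \<Longrightarrow> norm \<theta> \<le> \<tau> \<Longrightarrow> norm (f_tilde g z (slope_of g z) \<theta>) \<le> M"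
    "\<And>z. z \<in> cball z0 \<beta> \<Longrightarrow> psi_tilde F g z \<in> amplitude_class \<tau> M"
    "\<And>e. 0 < e \<Longrightarrow> \<exists>d>0. \<forall>z\<in>cball z0 \<beta>. norm (z - z0) < d \<longrightarrow>
       (\<forall>\<theta>. norm \<theta> \<le> \<tau> \<longrightarrow> norm (f_tilde g z (slope_of g z) \<theta> - f_tilde g z0 (slope_of g z0) \<theta>) < e)"
proof -
  note inner = bspec[OF inner']
  \<comment> \<open>If |e^(i\<theta>) - 1| \<le> \<kappa>, rotation moves a point of modulus at most
    |z0| + \<beta>1 by at most \<beta>1/4; with \<beta> = \<beta>1/2 the rotated point stays in the
    ball.\<close>
  define \<kappa> where "\<kappa> = \<beta>1 / (4 * (norm z0 + \<beta>1))"
  have pos: "0 < norm z0 + \<beta>1" using \<beta>1 by (simp add: add_nonneg_pos)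
  have \<kappa>: "0 < \<kappa>" using \<beta>1 pos by (simp add: \<kappa>_def)
  have "isCont (\<lambda>\<theta>::complex. exp (\<i> * \<theta>)) 0" by (intro continuous_intros)
  then obtain \<tau>0 where \<tau>0: "0 < \<tau>0" "\<And>\<theta>::complex. norm \<theta> < \<tau>0 \<Longrightarrow> norm (exp (\<i> * \<theta>) - 1) < \<kappa>"
    using \<kappa> unfolding continuous_at_eps_delta by (auto simp: dist_norm)
  define \<tau> where "\<tau> = \<tau>0 / 2"
  define \<beta> where "\<beta> = \<beta>1 / 2"
  have \<tau>: "0 < \<tau>" "\<tau> < \<tau>0" using \<tau>0 by (auto simp: \<tau>_def)
  have \<beta>: "0 < \<beta>" "\<beta> < \<beta>1" using \<beta>1 by (auto simp: \<beta>_def)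
  have rot: "z * exp (\<i> * \<theta>) \<in> ball z0 \<beta>1" if z: "z \<in> cball z0 \<beta>" and \<theta>: "norm \<theta> \<le> \<tau>" for z \<theta>
  proof -
    have nz: "norm (z - z0) \<le> \<beta>1 / 2" using z by (simp add: \<beta>_def dist_norm norm_minus_commute)
    then have "norm z \<le> norm z0 + \<beta>1" using norm_triangle_ineq2[of z z0] \<beta>1 by linarith
    moreover have "norm (exp (\<i> * \<theta>) - 1) \<le> \<kappa>" using \<tau>0(2)[of \<theta>] \<theta> \<tau> by simp
    ultimately have "norm z * norm (exp (\<i> * \<theta>) - 1) \<le> (norm z0 + \<beta>1) * \<kappa>" using pos by (intro mult_mono) auto
    also have "\<dots> = \<beta>1 / 4"
    proof -
      have "n * (\<beta>1 / (4 * n)) = \<beta>1 / 4" if "0 < n" for n :: real using that by (simp add: field_simps)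
      from this[OF pos] show ?thesis by (simp only: \<kappa>_def)
    qed
    finally have "norm (z * (exp (\<i> * \<theta>) - 1)) \<le> \<beta>1 / 4" by (simp add: norm_mult)
    moreover have "z * exp (\<i> * \<theta>) - z0 = z * (exp (\<i> * \<theta>) - 1) + (z - z0)" by (simp add: algebra_simps)
    ultimately have "norm (z * exp (\<i> * \<theta>) - z0) \<le> \<beta>1 / 4 + \<beta>1 / 2"
      using nz by (metis norm_triangle_mono)
    then show ?thesis using \<beta>1 by (simp add: dist_norm norm_minus_commute)
  qed
  have zin: "z \<in> ball z0 \<beta>1" if "z \<in> cball z0 \<beta>" for z using that \<beta> by auto
  have gu: "3 / 4 * norm w0 \<le> norm (g u)" "g u \<noteq> 0" if "u \<in> cball z0 \<beta>1" for u
  proof -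
    have "norm w0 - norm (g u) \<le> norm (g u - w0)" using norm_triangle_ineq2[of w0 "g u"] by (simp add: norm_minus_commute)
    then show "3 / 4 * norm w0 \<le> norm (g u)" using inner[OF that] by linarith
    then show "g u \<noteq> 0" using w0 by auto
  qed
  \<comment> \<open>Both values are within |w0|/4 of w0, while |g z| is at least 3|w0|/4. So the
    quotient is within distance 1 of 1 and misses the cut of the logarithm.\<close>
  have np: "g u / g z \<notin> \<real>\<^sub>\<le>\<^sub>0" if "u \<in> cball z0 \<beta>1" "z \<in> cball z0 \<beta>1" for u z
  proof -
    have "norm (g u - g z) \<le> norm (g u - w0) + norm (g z - w0)"
      using norm_triangle_ineq4[of "g u - w0" "g z - w0"] by simp
    also have "\<dots> < norm w0 / 4 + norm w0 / 4" using inner[OF that(1)] inner[OF that(2)] by (intro add_strict_mono) auto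
    also have "\<dots> \<le> norm (g z)" using gu(1)[OF that(2)] norm_ge_zero[of w0] by linarith
    finally have "norm (g u / g z - 1) < 1"
      using gu(2)[OF that(2)] by (simp add: diff_divide_eq_iff norm_divide divide_simps)
    moreover have "Re (1 - g u / g z) \<le> norm (1 - g u / g z)" by (rule complex_Re_le_cmod)
    ultimately have "0 < Re (g u / g z)" by (simp add: norm_minus_commute)
    then show ?thesis by (auto simp: complex_nonpos_Reals_iff)
  qed
  define S where "S = cball z0 \<beta> \<times> cball (0::complex) \<tau>"
  have cS: "compact S" unfolding S_def by (intro compact_Times compact_cball)
  have contg: "continuous_on (cball z0 \<beta>1) g" using holg by (rule holomorphic_on_imp_continuous_on)
  have cu: "continuous_on S (\<lambda>q. g (fst q * exp (\<i> * snd q)))"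
  proof (rule continuous_on_compose2[OF contg])
    show "continuous_on S (\<lambda>q. fst q * exp (\<i> * snd q))" by (intro continuous_intros)
    show "(\<lambda>q. fst q * exp (\<i> * snd q)) ` S \<subseteq> cball z0 \<beta>1"
    proof
      fix x assume "x \<in> (\<lambda>q. fst q * exp (\<i> * snd q)) ` S"
      then obtain z \<theta> where "z \<in> cball z0 \<beta>" "norm \<theta> \<le> \<tau>" "x = z * exp (\<i> * \<theta>)" by (auto simp: S_def)
      then show "x \<in> cball z0 \<beta>1" using rot ball_subset_cball by blast
    qed
  qed
  have cz: "continuous_on S (\<lambda>q. g (fst q))"
    by (rule continuous_on_compose2[OF contg]) (use \<beta> in \<open>auto simp: S_def intro!: continuous_intros\<close>)
  have gz0: "g (fst q) \<noteq> 0" if "q \<in> S" for q using that gu(2) \<beta> by (auto simp: S_def)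
  have cd: "continuous_on S (\<lambda>q. deriv g (fst q))"
  proof (rule continuous_on_compose2[of "ball z0 \<beta>1" "deriv g"])
    show "continuous_on (ball z0 \<beta>1) (deriv g)"
      by (intro holomorphic_on_imp_continuous_on holomorphic_deriv holomorphic_on_subset[OF holg ball_subset_cball]) auto
  qed (use zin in \<open>auto simp: S_def intro!: continuous_intros\<close>)
  have csl: "continuous_on S (\<lambda>q. slope_of g (fst q))"
    unfolding slope_of_def by (intro continuous_intros cd cz) (use gz0 in auto)
  define \<Psi> where "\<Psi> = (\<lambda>q. f_tilde g (fst q) (slope_of g (fst q)) (snd q))"
  have c\<Psi>: "continuous_on S \<Psi>"
    unfolding \<Psi>_def f_tilde_def
  proof (intro continuous_on_add continuous_on_Ln' continuous_on_divide cu cz continuous_on_mult continuous_on_const continuous_on_of_real csl continuous_on_snd continuous_on_id)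
    show "\<forall>q\<in>S. g (fst q) \<noteq> 0" using gz0 by auto
    show "g (fst q * exp (\<i> * snd q)) / g (fst q) \<notin> \<real>\<^sub>\<le>\<^sub>0" if "q \<in> S" for q
      using that rot[of "fst q" "snd q"] zin[of "fst q"] by (intro np) (auto simp: S_def)
  qed
  have "bounded (\<Psi> ` S)" by (intro compact_imp_bounded compact_continuous_image c\<Psi> cS)
  then obtain B1 where B1: "\<forall>q\<in>S. norm (\<Psi> q) \<le> B1" by (auto simp: bounded_iff)
  have "bounded (R ` cball z0 \<beta>1)" by (intro compact_imp_bounded compact_continuous_image contR compact_cball)
  then obtain B2 where B2: "\<forall>q\<in>cball z0 \<beta>1. norm (R q) \<le> B2" by (auto simp: bounded_iff)
  have B20: "0 \<le> B2" using B2 \<beta>1 order_trans[OF norm_ge_zero] by (metis centre_in_cball less_eq_real_def)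
  define M where "M = max 1 (max B1 (B2 / (3 / 4 * norm w0)))"
  have M: "0 < M" "B1 \<le> M" "B2 / (3 / 4 * norm w0) \<le> M" by (auto simp: M_def)
  have hu: "(\<lambda>\<theta>. h (z * exp (\<i> * \<theta>))) holomorphic_on ball 0 \<tau>"
    if z: "z \<in> cball z0 \<beta>" and h: "h holomorphic_on ball z0 \<beta>1" for z h
  proof -
    have "(\<lambda>\<theta>. z * exp (\<i> * \<theta>)) ` ball 0 \<tau> \<subseteq> ball z0 \<beta>1" using rot[OF z] by auto
    moreover have "(\<lambda>\<theta>. z * exp (\<i> * \<theta>)) holomorphic_on ball 0 \<tau>" by (intro holomorphic_intros)
    ultimately show ?thesis using holomorphic_on_compose_gen[OF _ h] by (simp add: o_def)
  qed
  have holg': "g holomorphic_on ball z0 \<beta>1" using holg ball_subset_cball by (rule holomorphic_on_subset)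
  show ?thesis
  proof (rule that[OF \<beta> \<tau>(1) M(1) rot])
    fix z assume z: "z \<in> cball z0 \<beta>"
    have zz: "z \<in> cball z0 \<beta>1" using zin[OF z] by auto
    show "f_tilde g z (slope_of g z) holomorphic_on ball 0 \<tau>"
      unfolding f_tilde_def[abs_def]
    proof (intro holomorphic_on_add holomorphic_on_Ln' holomorphic_on_divide hu[OF z holg'] holomorphic_on_const holomorphic_on_mult holomorphic_on_ident)
      show "g (z * exp (\<i> * \<theta>)) / g z \<notin> \<real>\<^sub>\<le>\<^sub>0" if "\<theta> \<in> ball 0 \<tau>" for \<theta>
        using that rot[OF z, of \<theta>] zz by (intro np) auto
    qed (use gu(2)[OF zz] in auto)
    show "norm (f_tilde g z (slope_of g z) \<theta>) \<le> M" if "norm \<theta> \<le> \<tau>" for \<theta>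
    proof -
      have "(z, \<theta>) \<in> S" using z that by (simp add: S_def)
      then have "norm (\<Psi> (z, \<theta>)) \<le> B1" using B1 by blast
      then show ?thesis using M(2) by (simp add: \<Psi>_def)
    qed
    have pe: "psi F g u = - R u / g u" if "u \<in> ball z0 \<beta>1" for u
      using inner[of u] gu(2)[of u] that by (intro psi_eq) auto
    have "(\<lambda>u. - R u / g u) holomorphic_on ball z0 \<beta>1"
      using gu(2) by (intro holomorphic_on_divide holomorphic_on_minus holR holg') auto
    then have "psi F g holomorphic_on ball z0 \<beta>1" by (rule holomorphic_transform) (simp add: pe)
    then have h1: "psi_tilde F g z holomorphic_on ball 0 \<tau>"
      using hu[OF z] by (simp add: psi_tilde_def[abs_def])
    have "norm (psi_tilde F g z \<theta>) \<le> M" if "norm \<theta> < \<tau>" for \<theta>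
    proof -
      have u: "z * exp (\<i> * \<theta>) \<in> ball z0 \<beta>1" using rot[OF z] that by simp
      then have uc: "z * exp (\<i> * \<theta>) \<in> cball z0 \<beta>1" by auto
      have "norm (R (z * exp (\<i> * \<theta>))) / norm (g (z * exp (\<i> * \<theta>))) \<le> B2 / (3 / 4 * norm w0)"
        using B2 uc gu(1)[OF uc] w0 B20 by (intro frac_le) auto
      then show ?thesis using M(3) by (simp add: psi_tilde_def pe[OF u] norm_divide)
    qed
    with h1 show "psi_tilde F g z \<in> amplitude_class \<tau> M" by (simp add: amplitude_class_def)
  next
    fix e :: real assume e: "0 < e"
    have "uniformly_continuous_on S \<Psi>" using c\<Psi> cS by (rule compact_uniformly_continuous)
    then obtain d where d: "0 < d" "\<And>q q'. q \<in> S \<Longrightarrow> q' \<in> S \<Longrightarrow> dist q' q < d \<Longrightarrow> dist (\<Psi> q') (\<Psi> q) < e"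
      using e unfolding uniformly_continuous_on_def by metis
    show "\<exists>d>0. \<forall>z\<in>cball z0 \<beta>. norm (z - z0) < d \<longrightarrow>
       (\<forall>\<theta>. norm \<theta> \<le> \<tau> \<longrightarrow> norm (f_tilde g z (slope_of g z) \<theta> - f_tilde g z0 (slope_of g z0) \<theta>) < e)"
    proof (intro exI[of _ d] conjI ballI impI allI)
      fix z \<theta> assume z: "z \<in> cball z0 \<beta>" "norm (z - z0) < d" and \<theta>: "norm (\<theta>::complex) \<le> \<tau>"
      have "dist (z, \<theta>) (z0, \<theta>) < d" using z by (simp add: dist_Pair_Pair dist_norm)
      moreover have "(z, \<theta>) \<in> S" "(z0, \<theta>) \<in> S" using z \<theta> \<beta> by (auto simp: S_def)
      ultimately have "dist (\<Psi> (z, \<theta>)) (\<Psi> (z0, \<theta>)) < e" by (intro d(2))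
      then show "norm (f_tilde g z (slope_of g z) \<theta> - f_tilde g z0 (slope_of g z0) \<theta>) < e"
        by (simp add: \<Psi>_def dist_norm)
    qed (rule d(1))
  qed
qed

text \<open>The angles are cut at \<plusminus>\<epsilon>. Outside, \<open>far\<close> bounds the
  coefficient function; inside, \<open>near\<close> replaces it by -R/g^(s+1), which after
  multiplication by g(z)^s is exactly the integrand exp(-s f) \<psi>, up to the rotation factor. The
  errors are left as powers of |g z|/\<rho>1 and |g z|/\<rho>2, so that the range of z can be fixed
  afterwards.\<close>

lemma coefficient_integral_approx:
  assumes series: "has_power_series a F (0, 0)"
    and holg: "g holomorphic_on cball z0 \<beta>1" and contR: "continuous_on (cball z0 \<beta>1) R"
    and inner: "\<And>u. u \<in> cball z0 \<beta>1 \<Longrightarrow>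
        (u, g u) \<in> U \<and> H (u, g u) = 0 \<and> partial2 H (u, g u) \<noteq> 0 \<and> norm (g u - w0) < norm w0 / 4"
    and near: "\<And>u s. u \<in> cball z0 \<beta>1 \<Longrightarrow> norm (taylor_coeff (\<lambda>v. F (u, v)) s + R u / g u ^ Suc s) \<le> M1 / \<rho>1 ^ s"
    and far: "\<And>u s. norm u \<le> norm z0 + \<delta>2 \<Longrightarrow> b \<le> norm (u - z0) \<Longrightarrow> norm (taylor_coeff (\<lambda>v. F (u, v)) s) \<le> M2 / \<rho>2 ^ s"
    and hol: "\<And>s. (\<lambda>u. taylor_coeff (\<lambda>v. F (u, v)) s) holomorphic_on ball 0 \<rho>0"
    and z: "z \<noteq> 0" "norm z < \<rho>0" "norm z \<le> norm z0 + \<delta>2" "z \<in> cball z0 \<beta>1"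
    and \<epsilon>: "0 < \<epsilon>" "\<epsilon> < pi"
    and arc1: "\<And>\<theta>. \<bar>\<theta>\<bar> \<le> \<epsilon> \<Longrightarrow> z * exp (\<i> * of_real \<theta>) \<in> cball z0 \<beta>1"
    and arc2: "\<And>\<theta>. \<epsilon> \<le> \<bar>\<theta>\<bar> \<Longrightarrow> \<bar>\<theta>\<bar> \<le> pi \<Longrightarrow> b \<le> norm (z * exp (\<i> * of_real \<theta>) - z0)"
    and slope: "real s * slope = real r" and \<rho>: "0 < \<rho>1" "0 < \<rho>2"
  shows "norm (a r s * z ^ r * g z ^ s - of_real (1 / (2 * pi)) *
      integral {-\<epsilon>..\<epsilon>} (\<lambda>\<theta>. exp (- (of_real (real s) * f_tilde g z slope (of_real \<theta>))) * psi_tilde F g z (of_real \<theta>)))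
    \<le> \<bar>M1\<bar> * (norm (g z) / \<rho>1) ^ s + \<bar>M2\<bar> * (norm (g z) / \<rho>2) ^ s"
proof -
  define A where "A = (\<lambda>u. taylor_coeff (\<lambda>v. F (u, v)) s)"
  define e where "e = (\<lambda>\<theta>::real. z * exp (\<i> * of_real \<theta>))"
  define h where "h = (\<lambda>\<theta>. A (e \<theta>) * exp (- (\<i> * of_nat r * of_real \<theta>)))"
  have ars: "a r s = taylor_coeff A r" unfolding A_def using power_series_taylor_coeff[OF series] by simp
  have tor: "a r s * z ^ r = of_real (1 / (2 * pi)) * integral {-pi..pi} h"
    unfolding ars h_def e_def using taylor_coeff_torus_integral[OF _ z(2,1)] hol by (simp add: A_def)
  have ce: "continuous_on X e" for X unfolding e_def by (intro continuous_intros)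
  have ne: "norm (e \<theta>) = norm z" for \<theta> by (simp add: e_def norm_mult)
  have ch: "continuous_on X h" for X
  proof -
    have "continuous_on X (\<lambda>\<theta>. A (e \<theta>))"
    proof (rule continuous_on_compose2[OF _ ce])
      show "continuous_on (ball 0 \<rho>0) A"
        unfolding A_def by (rule holomorphic_on_imp_continuous_on[OF hol])
    qed (use ne z in auto)
    then show ?thesis unfolding h_def by (intro continuous_intros)
  qed
  define W where "W = (\<lambda>\<theta>. exp (- (of_real (real s) * f_tilde g z slope (of_real \<theta>))) * psi_tilde F g z (of_real \<theta>))"
  have gz: "g u \<noteq> 0" if "u \<in> cball z0 \<beta>1" for u using inner[OF that] w0 by auto
  \<comment> \<open>exp(-s Ln X) = X^(-s) for every branch because s is an integer. The linear term
    of the phase contributes e^(-ir\<theta>), since s times the slope is r, and \<psi> = -R/g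
    supplies one more power of g in the denominator.\<close>
  have Weq: "W \<theta> = g z ^ s * (- R (e \<theta>) / g (e \<theta>) ^ Suc s) * exp (- (\<i> * of_nat r * of_real \<theta>))" if \<theta>: "\<bar>\<theta>\<bar> \<le> \<epsilon>" for \<theta>
  proof -
    have u: "e \<theta> \<in> cball z0 \<beta>1" using arc1[OF \<theta>] by (simp add: e_def)
    define X where "X = g (e \<theta>) / g z"
    have X: "X \<noteq> 0" using gz[OF u] gz[OF z(4)] by (simp add: X_def)
    have sl: "complex_of_real (real s) * (\<i> * of_real slope * of_real \<theta>) = \<i> * of_nat r * of_real \<theta>"
    proof -
      have "complex_of_real (real s) * of_real slope = of_nat r" using slope by (metis of_real_mult of_real_of_nat_eq)
      then show ?thesis by (metis mult.assoc mult.commute)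
    qed
    have "exp (- (of_real (real s) * f_tilde g z slope (of_real \<theta>))) =
       exp (- (of_nat s * Ln X)) * exp (- (\<i> * of_nat r * of_real \<theta>))"
      unfolding f_tilde_def X_def[unfolded e_def, symmetric] distrib_left sl by (simp add: exp_add exp_diff exp_minus divide_inverse)
    also have "exp (- (of_nat s * Ln X)) = inverse (X ^ s)"
      using X by (simp add: exp_minus exp_of_nat_mult)
    finally have "W \<theta> = inverse (X ^ s) * exp (- (\<i> * of_nat r * of_real \<theta>)) * psi F g (e \<theta>)"
      by (simp add: W_def psi_tilde_def e_def)
    also have "psi F g (e \<theta>) = - R (e \<theta>) / g (e \<theta>)" using inner[OF u] gz[OF u] by (intro psi_eq) auto
    finally show ?thesis using gz[OF u] gz[OF z(4)] by (simp add: X_def power_divide divide_simps mult_ac)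
  qed
  have cW: "continuous_on {-\<epsilon>..\<epsilon>} W"
  proof (rule continuous_on_eq)
    have im: "e ` {-\<epsilon>..\<epsilon>} \<subseteq> cball z0 \<beta>1" using arc1 by (auto simp: e_def abs_le_iff)
    have c1: "continuous_on {-\<epsilon>..\<epsilon>} (\<lambda>\<theta>. R (e \<theta>))" by (rule continuous_on_compose2[OF contR ce im])
    have c2: "continuous_on {-\<epsilon>..\<epsilon>} (\<lambda>\<theta>. g (e \<theta>))"
      by (rule continuous_on_compose2[OF holomorphic_on_imp_continuous_on[OF holg] ce im])
    show "continuous_on {-\<epsilon>..\<epsilon>} (\<lambda>\<theta>. g z ^ s * (- R (e \<theta>) / g (e \<theta>) ^ Suc s) * exp (- (\<i> * of_nat r * of_real \<theta>)))"
      by (intro continuous_intros c1 c2) (use gz im in auto)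
    show "g z ^ s * (- R (e \<theta>) / g (e \<theta>) ^ Suc s) * exp (- (\<i> * of_nat r * of_real \<theta>)) = W \<theta>" if "\<theta> \<in> {-\<epsilon>..\<epsilon>}" for \<theta>
      using Weq[of \<theta>] that by (simp add: abs_le_iff)
  qed
  have hint: "h integrable_on {x..y}" for x y by (rule integrable_continuous_interval[OF ch])
  have "integral {-pi..pi} h = integral {-pi..-\<epsilon>} h + integral {-\<epsilon>..pi} h"
    using \<epsilon> by (intro Henstock_Kurzweil_Integration.integral_combine[symmetric] hint) auto
  also have "integral {-\<epsilon>..pi} h = integral {-\<epsilon>..\<epsilon>} h + integral {\<epsilon>..pi} h"
    using \<epsilon> by (intro Henstock_Kurzweil_Integration.integral_combine[symmetric] hint) auto
  finally have split: "integral {-pi..pi} h = integral {-pi..-\<epsilon>} h + (integral {-\<epsilon>..\<epsilon>} h + integral {\<epsilon>..pi} h)" .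
  have hfar: "norm (h \<theta>) \<le> M2 / \<rho>2 ^ s" if "\<epsilon> \<le> \<bar>\<theta>\<bar>" "\<bar>\<theta>\<bar> \<le> pi" for \<theta>
    using far[of "e \<theta>" s] arc2[OF that] z(3) ne[of \<theta>] by (simp add: h_def A_def e_def norm_mult)
  have M2: "0 \<le> M2 / \<rho>2 ^ s" using hfar[of pi] \<epsilon> order_trans[OF norm_ge_zero] by auto
  have o1: "norm (integral {-pi..-\<epsilon>} h) \<le> M2 / \<rho>2 ^ s * (-\<epsilon> - -pi)"
    using \<epsilon> by (intro integral_bound ch hfar) auto
  have o2: "norm (integral {\<epsilon>..pi} h) \<le> M2 / \<rho>2 ^ s * (pi - \<epsilon>)"
    using \<epsilon> by (intro integral_bound ch hfar) auto
  have err: "norm (g z ^ s * h \<theta> - W \<theta>) \<le> norm (g z) ^ s * (M1 / \<rho>1 ^ s)" if "\<theta> \<in> {-\<epsilon>..\<epsilon>}" for \<theta>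
  proof -
    have \<theta>: "\<bar>\<theta>\<bar> \<le> \<epsilon>" using that by auto
    have "g z ^ s * h \<theta> - W \<theta> = g z ^ s * ((A (e \<theta>) + R (e \<theta>) / g (e \<theta>) ^ Suc s) * exp (- (\<i> * of_nat r * of_real \<theta>)))"
      unfolding Weq[OF \<theta>] h_def by (simp add: algebra_simps)
    also have "norm \<dots> = norm (g z) ^ s * norm (A (e \<theta>) + R (e \<theta>) / g (e \<theta>) ^ Suc s)"
      by (simp add: norm_mult norm_power)
    also have "\<dots> \<le> norm (g z) ^ s * (M1 / \<rho>1 ^ s)"
      using near[of "e \<theta>" s] arc1[OF \<theta>] by (intro mult_left_mono) (auto simp: A_def e_def)
    finally show ?thesis .
  qed
  have M1: "0 \<le> norm (g z) ^ s * (M1 / \<rho>1 ^ s)" using err[of 0] \<epsilon> order_trans[OF norm_ge_zero] by auto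
  have "norm (integral {-\<epsilon>..\<epsilon>} (\<lambda>\<theta>. g z ^ s * h \<theta> - W \<theta>)) \<le> norm (g z) ^ s * (M1 / \<rho>1 ^ s) * (\<epsilon> - -\<epsilon>)"
    using \<epsilon> by (intro integral_bound continuous_intros ch cW err) auto
  moreover have "integral {-\<epsilon>..\<epsilon>} (\<lambda>\<theta>. g z ^ s * h \<theta> - W \<theta>) = g z ^ s * integral {-\<epsilon>..\<epsilon>} h - integral {-\<epsilon>..\<epsilon>} W"
    by (subst Henstock_Kurzweil_Integration.integral_diff)
       (auto intro!: integrable_continuous_interval continuous_intros ch cW)
  ultimately have i1: "norm (g z ^ s * integral {-\<epsilon>..\<epsilon>} h - integral {-\<epsilon>..\<epsilon>} W) \<le> norm (g z) ^ s * (M1 / \<rho>1 ^ s) * (2 * \<epsilon>)"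
    by simp
  have "norm (g z ^ s * integral {-pi..pi} h - integral {-\<epsilon>..\<epsilon>} W) =
     norm ((g z ^ s * integral {-\<epsilon>..\<epsilon>} h - integral {-\<epsilon>..\<epsilon>} W) + g z ^ s * (integral {-pi..-\<epsilon>} h + integral {\<epsilon>..pi} h))"
    unfolding split by (simp add: algebra_simps)
  also have "\<dots> \<le> norm (g z) ^ s * (M1 / \<rho>1 ^ s) * (2 * \<epsilon>) + norm (g z) ^ s * (M2 / \<rho>2 ^ s * (-\<epsilon> - -pi) + M2 / \<rho>2 ^ s * (pi - \<epsilon>))"
    by (rule norm_triangle_mono[OF i1], unfold norm_mult norm_power, rule mult_left_mono, rule norm_triangle_mono[OF o1 o2]) auto
  \<comment> \<open>Both total lengths are enlarged to 2\<pi>, which cancels the prefactor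
    1/(2\<pi>).\<close>
  also have "\<dots> \<le> norm (g z) ^ s * (M1 / \<rho>1 ^ s) * (2 * pi) + norm (g z) ^ s * (M2 / \<rho>2 ^ s * (2 * pi))"
  proof (intro add_mono mult_left_mono)
    show "M2 / \<rho>2 ^ s * (-\<epsilon> - -pi) + M2 / \<rho>2 ^ s * (pi - \<epsilon>) \<le> M2 / \<rho>2 ^ s * (2 * pi)"
      unfolding distrib_left[symmetric] using \<epsilon> M2 by (intro mult_left_mono) auto
  qed (use \<epsilon> M1 in auto)
  also have "\<dots> = (2 * pi) * (norm (g z) ^ s * (M1 / \<rho>1 ^ s) + norm (g z) ^ s * (M2 / \<rho>2 ^ s))"
    by (simp add: algebra_simps)
  also have "\<dots> \<le> (2 * pi) * (\<bar>M1\<bar> * (norm (g z) / \<rho>1) ^ s + \<bar>M2\<bar> * (norm (g z) / \<rho>2) ^ s)"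
  proof (intro mult_left_mono add_mono)
    have *: "norm (g z) ^ s * (m / x ^ s) = m * (norm (g z) / x) ^ s" for m x by (simp add: power_divide)
    show "norm (g z) ^ s * (M1 / \<rho>1 ^ s) \<le> \<bar>M1\<bar> * (norm (g z) / \<rho>1) ^ s"
      unfolding * using \<rho> by (intro mult_right_mono) auto
    show "norm (g z) ^ s * (M2 / \<rho>2 ^ s) \<le> \<bar>M2\<bar> * (norm (g z) / \<rho>2) ^ s"
      unfolding * using \<rho> by (intro mult_right_mono) auto
  qed auto
  finally have fin: "norm (g z ^ s * integral {-pi..pi} h - integral {-\<epsilon>..\<epsilon>} W) \<le>
     (2 * pi) * (\<bar>M1\<bar> * (norm (g z) / \<rho>1) ^ s + \<bar>M2\<bar> * (norm (g z) / \<rho>2) ^ s)" .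
  have "a r s * z ^ r * g z ^ s - of_real (1 / (2 * pi)) * integral {-\<epsilon>..\<epsilon>} W =
     of_real (1 / (2 * pi)) * (g z ^ s * integral {-pi..pi} h - integral {-\<epsilon>..\<epsilon>} W)"
    unfolding tor by (simp add: algebra_simps)
  then have "norm (a r s * z ^ r * g z ^ s - of_real (1 / (2 * pi)) * integral {-\<epsilon>..\<epsilon>} W) =
     (1 / (2 * pi)) * norm (g z ^ s * integral {-pi..pi} h - integral {-\<epsilon>..\<epsilon>} W)"
    by (simp only: norm_mult norm_of_real) simp
  also have "\<dots> \<le> (1 / (2 * pi)) * ((2 * pi) * (\<bar>M1\<bar> * (norm (g z) / \<rho>1) ^ s + \<bar>M2\<bar> * (norm (g z) / \<rho>2) ^ s))"
    by (intro mult_left_mono fin) auto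
  finally show ?thesis by (simp add: W_def)
qed

end

context smooth_point
begin

lemma Re_f_tilde:
  assumes "g u \<noteq> 0" "g z \<noteq> 0" "u = z * exp (\<i> * of_real \<theta>)"
  shows "Re (f_tilde g z slope (of_real \<theta>)) = ln (norm (g u) / norm (g z))"
  using assms by (simp add: f_tilde_def norm_divide)

text \<open>All choices are made at p0 and survive a small move of the pole: the leading coefficient
  and the lower bound for Re f at the ends lose at most half their size, and |g z| stays below the
  radii of the coefficient estimates. The neighbourhood is independent of N; only the constant
  depends on it.\<close>

lemma local_expansion:
  assumes series: "has_power_series a F (0, 0)"
    and K: "\<And>p. p \<in> K \<Longrightarrow> strictly_minimal H p \<and> p \<in> zero_set H \<and> parametrizes (gg p) H p"
    and p0: "(z0, w0) \<in> K" and gg0: "gg (z0, w0) = g"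
    and order: "\<And>p r s. p \<in> K \<Longrightarrow> (r, s) \<in> dir H p \<Longrightarrow> s \<noteq> 0 \<Longrightarrow>
              is_order_at_0 (f_tilde (gg p) (fst p) (r / s)) k"
  obtains O' where "open O'" "(z0, w0) \<in> O'"
    "\<And>N. \<exists>C. \<forall>p\<in>K \<inter> O'. \<forall>r s. 1 \<le> s \<longrightarrow> (real r, real s) \<in> dir H p \<longrightarrow>
       fst p \<noteq> 0 \<and> snd p \<noteq> 0 \<and>
       norm (a r s * fst p ^ r * snd p ^ s - of_real (1 / (2 * pi)) *
         (\<Sum>l<N. of_real (real s powr (- (real l + 1) / real k)) *
            (calA (taylor_coeff (f_tilde (gg p) (fst p) (real r / real s)) k) k l *
             b_coeff (psi_tilde F (gg p) (fst p)) (f_tilde (gg p) (fst p) (real r / real s)) k l)))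
       \<le> C * real s powr (- (real N + 1) / real k)"
    "\<And>r s l l0. 1 \<le> s \<Longrightarrow> (real r, real s) \<in> dir H (z0, w0) \<Longrightarrow>
       vanishes_to_order_on G (zero_set H) (z0, w0) l0 \<Longrightarrow> l < l0 \<Longrightarrow>
       b_coeff (psi_tilde F g z0) (f_tilde g z0 (real r / real s)) k l = 0"
    "0 < k"
proof -
  obtain \<beta>1 \<rho>1 M1 where \<beta>1: "0 < \<beta>1" and \<rho>1: "norm w0 < \<rho>1" and holg: "g holomorphic_on cball z0 \<beta>1"
    and holR: "R holomorphic_on ball z0 \<beta>1" and contR: "continuous_on (cball z0 \<beta>1) R"
    and inner: "\<And>u. u \<in> cball z0 \<beta>1 \<Longrightarrow> (u, g u) \<in> U \<and> H (u, g u) = 0 \<and> partial2 H (u, g u) \<noteq> 0 \<and> norm (g u - w0) < norm w0 / 4"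
    and near: "\<And>u s. u \<in> cball z0 \<beta>1 \<Longrightarrow> norm (taylor_coeff (\<lambda>v. F (u, v)) s + R u / g u ^ Suc s) \<le> M1 / \<rho>1 ^ s"
    by (fact inner_structure)
  have inner': "\<forall>u\<in>cball z0 \<beta>1. (u, g u) \<in> U \<and> H (u, g u) = 0 \<and> partial2 H (u, g u) \<noteq> 0 \<and> norm (g u - w0) < norm w0 / 4"
    using inner by blast
  obtain \<beta> \<tau> M where \<beta>: "0 < \<beta>" "\<beta> < \<beta>1" and \<tau>: "0 < \<tau>" and M: "0 < M"
    and rot: "\<And>z \<theta>. z \<in> cball z0 \<beta> \<Longrightarrow> norm \<theta> \<le> \<tau> \<Longrightarrow> z * exp (\<i> * \<theta>) \<in> ball z0 \<beta>1"
    and holf: "\<And>z. z \<in> cball z0 \<beta> \<Longrightarrow> f_tilde g z (slope_of g z) holomorphic_on ball 0 \<tau>"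
    and bdf: "\<And>z \<theta>. z \<in> cball z0 \<beta> \<Longrightarrow> norm \<theta> \<le> \<tau> \<Longrightarrow> norm (f_tilde g z (slope_of g z) \<theta>) \<le> M"
    and amp: "\<And>z. z \<in> cball z0 \<beta> \<Longrightarrow> psi_tilde F g z \<in> amplitude_class \<tau> M"
    and unif: "\<And>e. 0 < e \<Longrightarrow> \<exists>d>0. \<forall>z\<in>cball z0 \<beta>. norm (z - z0) < d \<longrightarrow>
       (\<forall>\<theta>. norm \<theta> \<le> \<tau> \<longrightarrow> norm (f_tilde g z (slope_of g z) \<theta> - f_tilde g z0 (slope_of g z0) \<theta>) < e)"
    by (fact phase_data[OF \<beta>1 holg holR contR inner'])
  define f where "f = (\<lambda>z. f_tilde g z (slope_of g z))"
  have gu: "g u \<noteq> 0" if "u \<in> cball z0 \<beta>1" for u using inner[OF that] w0 by auto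
  have zin: "z \<in> ball z0 \<beta>1" "z \<in> cball z0 \<beta>1" if "z \<in> cball z0 \<beta>" for z using that \<beta> by auto
  have z0in: "z0 \<in> cball z0 \<beta>" using \<beta> by simp
  have evH: "\<forall>\<^sub>F u in nhds z. H (u, g u) = 0" if "z \<in> ball z0 \<beta>1" for z
    using eventually_nhds_in_open[OF open_ball that] by eventually_elim (use inner in auto)
  have ang: "g analytic_on {z}" if "z \<in> ball z0 \<beta>1" for z
    using that holomorphic_on_subset[OF holg ball_subset_cball] by (auto simp: analytic_at)
  have "\<forall>\<^sub>F q in nhds (z0, w0). H q = 0 \<longleftrightarrow> snd q = g (fst q)"
    using g by (simp add: parametrizes_def zero_set_def)
  then obtain N1 where N1: "open N1" "(z0, w0) \<in> N1" "\<And>q. q \<in> N1 \<Longrightarrow> H q = 0 \<longleftrightarrow> snd q = g (fst q)"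
    by (auto simp: eventually_nhds)
  \<comment> \<open>What minimality and the direction say about a pole near p0, expressed through
    the single function \<open>g\<close>. The order hypothesis is invoked at the real pair (slope,
    1).\<close>
  have at_point: "snd p = g z \<and> (slope_of g z, 1) \<in> dir H p \<and>
      (\<forall>r s. (r, s) \<in> dir H p \<longrightarrow> s \<noteq> 0 \<longrightarrow> r / s = slope_of g z) \<and>
      (\<forall>\<^sub>F u in nhds z. gg p u = g u) \<and> is_order_at_0 (f z) k \<and>
      (\<forall>u\<in>cball z0 \<beta>1. norm u = norm z \<longrightarrow> u \<noteq> z \<longrightarrow> norm (g z) < norm (g u))"
    if p: "p \<in> K" "p \<in> N1" "fst p \<in> cball z0 \<beta>" and z: "z = fst p" for p z
  proof -
    have zz: "z \<in> ball z0 \<beta>1" "z \<in> cball z0 \<beta>1" using zin p z by auto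
    have sp: "snd p = g z" using K[OF p(1)] N1(3)[OF p(2)] by (simp add: zero_set_def z)
    then have pe: "p = (z, g z)" by (simp add: z prod_eq_iff)
    have sm: "strictly_minimal H (z, g z)" and par: "parametrizes (gg p) H (z, g z)" using K[OF p(1)] by (auto simp: pe)
    have iz: "(z, g z) \<in> U" "partial2 H (z, g z) \<noteq> 0" using inner[OF zz(2)] by auto
    note D = dir_iff[OF sm evH[OF zz(1)] ang[OF zz(1)] gu[OF zz(2)] iz]
    have eqg: "\<forall>\<^sub>F u in nhds z. gg p u = g u" by (rule parametrizes_unique[OF ang[OF zz(1)] par evH[OF zz(1)]])
    have d1: "(slope_of g z, 1) \<in> dir H p" using D(1) by (simp only: pe)
    have d2: "\<forall>r s. (r, s) \<in> dir H p \<longrightarrow> s \<noteq> 0 \<longrightarrow> r / s = slope_of g z" using D(2) by (auto simp: pe)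
    have "is_order_at_0 (f_tilde (gg p) z (slope_of g z)) k" using order[OF p(1) d1] by (simp add: z)
    then have "is_order_at_0 (f z) k"
      using is_order_at_0_cong[OF tilde_cong(1)[OF eqg]] by (simp add: f_def)
    moreover have "\<forall>u\<in>cball z0 \<beta>1. norm u = norm z \<longrightarrow> u \<noteq> z \<longrightarrow> norm (g z) < norm (g u)"
      using minimal_on_circle[OF sm] inner by auto
    ultimately show ?thesis using sp d1 d2 eqg by blast
  qed
  have at0: "(slope_of g z0, 1) \<in> dir H (z0, w0)" "is_order_at_0 (f z0) k"
    "\<And>u. u \<in> cball z0 \<beta>1 \<Longrightarrow> norm u = norm z0 \<Longrightarrow> u \<noteq> z0 \<Longrightarrow> norm (g z0) < norm (g u)"
    using at_point[OF p0 N1(2), of z0] z0in by auto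
  have f0: "f z 0 = 0" if "z \<in> cball z0 \<beta>" for z
    using gu[OF zin(2)[OF that]] by (simp add: f_def f_tilde_def)
  \<comment> \<open>The phase vanishes at angle 0, so order 0 is excluded.\<close>
  have k: "0 < k"
    using at0(2) f0[OF z0in] by (cases k) (auto simp: is_order_at_0_def)
  define m where "m = norm (taylor_coeff (f z0) k) / 2"
  have m: "0 < m" using at0(2) by (simp add: m_def is_order_at_0_def)
  \<comment> \<open>Cauchy's estimate multiplies by (2/\<tau>)^k, so this threshold limits the
    change of the leading coefficient to m, half its size at z0.\<close>
  obtain d1 where d1: "0 < d1" "\<And>z \<theta>. z \<in> cball z0 \<beta> \<Longrightarrow> norm (z - z0) < d1 \<Longrightarrow> norm \<theta> \<le> \<tau> \<Longrightarrow> norm (f z \<theta> - f z0 \<theta>) < m * (\<tau> / 2) ^ k"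
    using unif[of "m * (\<tau> / 2) ^ k"] m \<tau> unfolding f_def by auto
  have cm: "m \<le> norm (taylor_coeff (f z) k)" if z: "z \<in> cball z0 \<beta>" "norm (z - z0) < d1" for z
  proof -
    have h: "f z holomorphic_on ball 0 \<tau>" "f z0 holomorphic_on ball 0 \<tau>" using holf z0in z by (auto simp: f_def)
    have "norm (taylor_coeff (\<lambda>x. f z x - f z0 x) k) \<le> (m * (\<tau> / 2) ^ k) * (2 / \<tau>) ^ k"
      using d1(2)[OF z] by (intro taylor_coeff_bound holomorphic_on_diff h \<tau>) (auto intro: less_imp_le)
    also have "\<dots> = m" using \<tau> by (simp add: power_divide)
    finally have "norm (taylor_coeff (f z) k - taylor_coeff (f z0) k) \<le> m"
      using taylor_coeff_diff[OF h \<tau>] by simp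
    then show ?thesis
      using norm_triangle_ineq2[of "taylor_coeff (f z0) k" "taylor_coeff (f z0) k - taylor_coeff (f z) k"]
      by (simp add: m_def norm_minus_commute)
  qed
  obtain \<epsilon>0 where \<epsilon>0: "0 < \<epsilon>0" "\<epsilon>0 < \<tau>" and two:
    "\<And>\<epsilon> \<delta> N. \<lbrakk>0 < \<epsilon>; \<epsilon> \<le> \<epsilon>0; 0 < \<delta>\<rbrakk> \<Longrightarrow>
       \<exists>C. \<forall>f\<in>phase_class \<tau> M m k. \<forall>\<psi>\<in>amplitude_class \<tau> M. \<forall>s\<ge>1.
         0 \<le> Re ((- 1) ^ k * taylor_coeff f k) \<longrightarrow> \<delta> \<le> Re (f (of_real \<epsilon>)) \<longrightarrow> \<delta> \<le> Re (f (of_real (- \<epsilon>))) \<longrightarrow>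
         norm (integral {- \<epsilon>..\<epsilon>} (\<lambda>x. exp (- (of_real s * f (of_real x))) * \<psi> (of_real x))
           - (\<Sum>l<N. of_real (s powr (- (real l + 1) / real k)) * (calA (taylor_coeff f k) k l * b_coeff \<psi> f k l)))
         \<le> C * s powr (- (real N + 1) / real k)"
    by (fact two_sided_laplace[OF \<tau> M m k])
  define \<epsilon> where "\<epsilon> = min \<epsilon>0 1"
  have \<epsilon>: "0 < \<epsilon>" "\<epsilon> \<le> \<epsilon>0" "\<epsilon> \<le> 1" "\<epsilon> < \<tau>" "\<epsilon> < pi" using \<epsilon>0 pi_gt3 by (auto simp: \<epsilon>_def)
  have circ: "norm (exp (\<i> * of_real \<theta>) - 1) = 2 * \<bar>sin (\<theta> / 2)\<bar>" for \<theta> :: real by (rule dist_exp_i_1)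
  have sin\<epsilon>: "0 < sin (\<epsilon> / 2)" using \<epsilon> by (intro sin_gt_zero) auto
  have sinmono: "sin (\<epsilon> / 2) \<le> \<bar>sin (\<theta> / 2)\<bar>" if "\<epsilon> \<le> \<bar>\<theta>\<bar>" "\<bar>\<theta>\<bar> \<le> pi" for \<theta>
  proof -
    have "sin (\<epsilon> / 2) \<le> sin (\<bar>\<theta>\<bar> / 2)" using that \<epsilon> by (intro sin_monotone_2pi_le) auto
    also have "\<dots> \<le> \<bar>sin (\<bar>\<theta>\<bar> / 2)\<bar>" by simp
    also have "\<dots> = \<bar>sin (\<theta> / 2)\<bar>" by (cases "\<theta> \<ge> 0") auto
    finally show ?thesis .
  qed
  have Repos: "0 < Re (f z0 (of_real \<theta>))" if "\<bar>\<theta>\<bar> = \<epsilon>" for \<theta>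
  proof -
    define u where "u = z0 * exp (\<i> * of_real \<theta>)"
    have ub: "u \<in> cball z0 \<beta>1" using rot[OF z0in, of "of_real \<theta>"] that \<epsilon> by (auto simp: u_def)
    have "0 < norm (exp (\<i> * of_real \<theta>) - 1)" unfolding circ using sinmono[of \<theta>] that \<epsilon> sin\<epsilon> by auto
    then have "u \<noteq> z0" using z0 by (auto simp: u_def)
    then have "norm (g z0) < norm (g u)" using at0(3)[OF ub] by (simp add: u_def norm_mult)
    then have "1 < norm (g u) / norm (g z0)" using gu[OF zin(2)[OF z0in]] by (simp add: less_divide_eq)
    then have "0 < ln (norm (g u) / norm (g z0))" by (rule ln_gt_zero)
    then show ?thesis using Re_f_tilde[OF gu[OF ub] gu[OF zin(2)[OF z0in]] u_def] by (simp add: f_def)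
  qed
  \<comment> \<open>Half of the smaller end value, so that \<delta> is still a lower bound after a
    perturbation of size \<delta>. It is positive by strict minimality on the circle through
    z0.\<close>
  define \<delta> where "\<delta> = min (Re (f z0 (of_real \<epsilon>))) (Re (f z0 (of_real (- \<epsilon>)))) / 2"
  have \<delta>: "0 < \<delta>" "2 * \<delta> \<le> Re (f z0 (of_real \<epsilon>))" "2 * \<delta> \<le> Re (f z0 (of_real (- \<epsilon>)))"
    using Repos[of \<epsilon>] Repos[of "- \<epsilon>"] \<epsilon>(1) by (auto simp: \<delta>_def)
  obtain d2 where d2: "0 < d2" "\<And>z \<theta>. z \<in> cball z0 \<beta> \<Longrightarrow> norm (z - z0) < d2 \<Longrightarrow> norm \<theta> \<le> \<tau> \<Longrightarrow> norm (f z \<theta> - f z0 \<theta>) < \<delta>"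
    using unif[OF \<delta>(1)] unfolding f_def by auto
  \<comment> \<open>On the circle |u| = |z0| a point at angle between \<epsilon> and \<pi> from z0
    is at distance at least 2b; the other b is reserved for the movement of z.\<close>
  define b where "b = norm z0 * sin (\<epsilon> / 2)"
  have b: "0 < b" using z0 sin\<epsilon> by (simp add: b_def)
  obtain \<rho>2 \<delta>2 M2 where \<rho>2: "norm w0 < \<rho>2" and \<delta>2: "0 < \<delta>2"
    and far: "\<And>u s. norm u \<le> norm z0 + \<delta>2 \<Longrightarrow> b \<le> norm (u - z0) \<Longrightarrow> norm (taylor_coeff (\<lambda>v. F (u, v)) s) \<le> M2 / \<rho>2 ^ s"
    by (fact outer_bound[OF b])
  obtain \<rho>0 where \<rho>0: "norm z0 < \<rho>0" and hol: "\<And>s. (\<lambda>u. taylor_coeff (\<lambda>v. F (u, v)) s) holomorphic_on ball 0 \<rho>0"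
    by (fact coefficient_holomorphic)
  define \<rho> where "\<rho> = min \<rho>1 \<rho>2"
  \<comment> \<open>The neighbourhood lets |g z| grow up to the midpoint of |w0| and \<rho>, so |g
    z|/\<rho> stays at most q < 1.\<close>
  define q where "q = ((norm w0 + \<rho>) / 2) / \<rho>"
  have \<rho>: "norm w0 < \<rho>" "\<rho> \<le> \<rho>1" "\<rho> \<le> \<rho>2" using \<rho>1 \<rho>2 by (auto simp: \<rho>_def)
  have \<rho>pos: "0 < \<rho>" using \<rho>(1) norm_ge_zero[of w0] by linarith
  have "0 < norm w0 + \<rho>" using \<rho>pos norm_ge_zero[of w0] by linarith
  then have h1: "0 < (norm w0 + \<rho>) / 2" and h2: "(norm w0 + \<rho>) / 2 < 1 * \<rho>" using \<rho>(1) by simp_all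
  have q: "0 < q" "q < 1"
    unfolding q_def by (fact divide_pos_pos[OF h1 \<rho>pos], fact iffD2[OF pos_divide_less_eq[OF \<rho>pos] h2])
  \<comment> \<open>All radii that bound the movement of z: \<open>norm z0\<close> keeps z away from
    0, \<open>\<rho>0 - norm z0\<close> keeps it in the domain of the coefficient function, and the
    others preserve the estimates made at z0.\<close>
  define X where "X = {\<beta>, d1, d2, b, \<delta>2, \<rho>0 - norm z0, norm z0}"
  define d where "d = Min X"
  have X: "finite X" "X \<noteq> {}" "\<forall>x\<in>X. 0 < x" using \<beta>(1) d1(1) d2(1) b \<delta>2 \<rho>0 z0 by (auto simp: X_def)
  have dX: "d \<le> x" if "x \<in> X" for x unfolding d_def by (rule Min_le[OF X(1) that])
  have "0 < d" unfolding d_def using X(3) by (simp only: Min_gr_iff[OF X(1,2)])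
  moreover have "d \<le> \<beta>" "d \<le> d1" "d \<le> d2" "d \<le> b" "d \<le> \<delta>2" "d \<le> \<rho>0 - norm z0" "d \<le> norm z0"
    by (rule dX, simp add: X_def)+
  ultimately have d: "0 < d" "d \<le> \<beta>" "d \<le> d1" "d \<le> d2" "d \<le> b" "d \<le> \<delta>2" "d \<le> \<rho>0 - norm z0" "d \<le> norm z0" .
  define O' where "O' = N1 \<inter> (ball z0 d \<times> ball w0 ((\<rho> - norm w0) / 2))"
  have opO: "open O'" unfolding O'_def by (intro open_Int N1 open_Times open_ball)
  have p0O: "(z0, w0) \<in> O'" using N1 d(1) \<rho>(1) by (auto simp: O'_def)
  \<comment> \<open>On the circle through z the modulus of g is smallest at z, so Re f \<ge> 0 on
    both sides of angle 0. Applied to f(x) and to f(-x), this gives both sign conditions on the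
    leading coefficient.\<close>
  have phase: "f z \<in> phase_class \<tau> M m k \<and> 0 \<le> Re ((- 1) ^ k * taylor_coeff (f z) k)"
    if p: "p \<in> K \<inter> O'" and z: "z = fst p" for p z
  proof -
    have zb: "norm (z - z0) < d" using p by (cases p) (auto simp: O'_def z dist_norm norm_minus_commute)
    then have zc: "z \<in> cball z0 \<beta>" using d by (simp add: dist_norm norm_minus_commute)
    note AP = at_point[of p z] 
    have AP': "is_order_at_0 (f z) k" "\<And>u. u\<in>cball z0 \<beta>1 \<Longrightarrow> norm u = norm z \<Longrightarrow> u \<noteq> z \<Longrightarrow> norm (g z) < norm (g u)"
      using AP p zc z by (auto simp: O'_def)
    have hz: "f z holomorphic_on ball 0 \<tau>" using holf[OF zc] by (simp add: f_def)
    have bz: "norm (f z x) \<le> M" if "norm x < \<tau>" for x using bdf[OF zc, of x] that by (simp add: f_def)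
    have Re0: "0 \<le> Re (f z (of_real x))" if "\<bar>x\<bar> < \<tau>" for x
    proof -
      define u where "u = z * exp (\<i> * of_real x)"
      have ub: "u \<in> cball z0 \<beta>1" using rot[OF zc, of "of_real x"] that by (auto simp: u_def)
      have "norm (g z) \<le> norm (g u)"
      proof (cases "u = z")
        case False
        then show ?thesis using AP'(2)[OF ub] by (simp add: u_def norm_mult)
      qed simp
      then have "0 \<le> ln (norm (g u) / norm (g z))" using gu[OF zin(2)[OF zc]] by simp
      then show ?thesis using Re_f_tilde[OF gu[OF ub] gu[OF zin(2)[OF zc]] u_def] by (simp add: f_def)
    qed
    have c1: "0 \<le> Re (taylor_coeff (f z) k)"
      by (rule Re_leading_coeff_nonneg[OF hz bz \<tau> AP'(1)]) (auto intro!: Re0)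
    have anz: "f z analytic_on {0}" unfolding analytic_at using hz \<tau> by (intro exI[of _ "ball 0 \<tau>"]) auto
    have "0 \<le> Re (taylor_coeff (\<lambda>x. f z (- x)) k)"
    proof (rule Re_leading_coeff_nonneg[OF holomorphic_on_reflect[OF hz] _ \<tau>])
      show "norm (f z (- x)) \<le> M" if "norm x < \<tau>" for x using bz[of "- x"] that by simp
      show "is_order_at_0 (\<lambda>x. f z (- x)) k"
        using AP'(1) by (simp add: is_order_at_0_def taylor_coeff_reflect[OF anz])
      show "0 \<le> Re (f z (- of_real x))" if "0 < x" "x < \<tau>" for x using Re0[of "- x"] that by simp
    qed
    then have "0 \<le> Re ((- 1) ^ k * taylor_coeff (f z) k)" by (simp add: taylor_coeff_reflect[OF anz])
    moreover have "m \<le> norm (taylor_coeff (f z) k)" using cm[OF zc] zb d by simp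
    ultimately show ?thesis using hz bz AP'(1) c1 by (simp add: phase_class_def)
  qed
  have slope_eq: "f_tilde (gg p) z (real r / real s) = f_tilde (gg p) z (slope_of g z) \<and> real s * slope_of g z = real r"
    if p: "p \<in> K \<inter> O'" and z: "z = fst p" and rs: "(real r, real s) \<in> dir H p" "1 \<le> s" for p z r s
  proof -
    have zb: "norm (z - z0) < d" using p by (cases p) (auto simp: O'_def z dist_norm norm_minus_commute)
    then have zc: "z \<in> cball z0 \<beta>" using d by (simp add: dist_norm norm_minus_commute)
    have "real r / real s = slope_of g z" using at_point[of p z] p zc z rs by (auto simp: O'_def)
    then show ?thesis using rs by (auto simp: field_simps)
  qed
  have expansion: "\<exists>C. \<forall>p\<in>K \<inter> O'. \<forall>r s. 1 \<le> s \<longrightarrow> (real r, real s) \<in> dir H p \<longrightarrow>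
       fst p \<noteq> 0 \<and> snd p \<noteq> 0 \<and>
       norm (a r s * fst p ^ r * snd p ^ s - of_real (1 / (2 * pi)) *
         (\<Sum>l<N. of_real (real s powr (- (real l + 1) / real k)) *
            (calA (taylor_coeff (f_tilde (gg p) (fst p) (real r / real s)) k) k l *
             b_coeff (psi_tilde F (gg p) (fst p)) (f_tilde (gg p) (fst p) (real r / real s)) k l)))
       \<le> C * real s powr (- (real N + 1) / real k)" for N
  proof -
    from two[OF \<epsilon>(1,2) \<delta>(1), of N] obtain C1 where C1': "\<forall>f\<in>phase_class \<tau> M m k. \<forall>\<psi>\<in>amplitude_class \<tau> M. \<forall>s\<ge>1.
         0 \<le> Re ((- 1) ^ k * taylor_coeff f k) \<longrightarrow> \<delta> \<le> Re (f (of_real \<epsilon>)) \<longrightarrow> \<delta> \<le> Re (f (of_real (- \<epsilon>))) \<longrightarrow>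
         norm (integral {- \<epsilon>..\<epsilon>} (\<lambda>x. exp (- (of_real s * f (of_real x))) * \<psi> (of_real x))
           - (\<Sum>l<N. of_real (s powr (- (real l + 1) / real k)) * (calA (taylor_coeff f k) k l * b_coeff \<psi> f k l)))
         \<le> C1 * s powr (- (real N + 1) / real k)" ..
    note C1 = C1'[rule_format]
    have "0 < - ln q" using q by simp
    then obtain C2 where C2: "0 < C2" "\<And>s. 1 \<le> s \<Longrightarrow> exp (- (s * (- ln q))) \<le> C2 * s powr (- ((real N + 1) / real k))"
      using exp_decay_powr_bound by blast
    define C where "C = (\<bar>M1\<bar> + \<bar>M2\<bar>) * C2 + (1 / (2 * pi)) * C1"
    show ?thesis
    proof (intro exI[of _ C] ballI allI impI)
      fix p r s assume p: "p \<in> K \<inter> O'" and s: "1 \<le> s" and rs: "(real r, real s) \<in> dir H p"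
      define z where "z = fst p"
      have zb: "norm (z - z0) < d" and wb: "norm (snd p - w0) < (\<rho> - norm w0) / 2"
        using p by (cases p; auto simp: O'_def z_def dist_norm norm_minus_commute)+
      then have zc: "z \<in> cball z0 \<beta>" using d by (simp add: dist_norm norm_minus_commute)
      have pp: "p \<in> K" "p \<in> N1" "fst p \<in> cball z0 \<beta>" using p zc by (auto simp: O'_def z_def)
      have AP: "snd p = g z" "\<forall>\<^sub>F u in nhds z. gg p u = g u" using at_point[OF pp z_def] by auto
      have nz: "z \<noteq> 0" using zb d by auto
      have gz: "g z \<noteq> 0" using gu zin(2)[OF zc] by blast
      note ph = phase[OF p z_def]
      note sl = slope_eq[OF p z_def rs s]
      have nzle: "norm z \<le> norm z0 + d" using zb norm_triangle_ineq2[of z z0] by linarith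
      define I where "I = integral {-\<epsilon>..\<epsilon>} (\<lambda>\<theta>. exp (- (of_real (real s) * f z (of_real \<theta>))) * psi_tilde F g z (of_real \<theta>))"
      have approx: "norm (a r s * z ^ r * g z ^ s - of_real (1 / (2 * pi)) * I)
          \<le> \<bar>M1\<bar> * (norm (g z) / \<rho>1) ^ s + \<bar>M2\<bar> * (norm (g z) / \<rho>2) ^ s"
        unfolding I_def f_def
      proof (rule coefficient_integral_approx[OF series holg contR inner near far hol nz])
        show "norm z < \<rho>0" using d(7) zb norm_triangle_ineq2[of z z0] by linarith
        show "norm z \<le> norm z0 + \<delta>2" using nzle d(6) by linarith
        show "z \<in> cball z0 \<beta>1" by (rule zin(2)[OF zc])
        show "z * exp (\<i> * of_real \<theta>) \<in> cball z0 \<beta>1" if "\<bar>\<theta>\<bar> \<le> \<epsilon>" for \<theta>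
          using rot[OF zc, of "of_real \<theta>"] that \<epsilon> ball_subset_cball by auto
        show "b \<le> norm (z * exp (\<i> * of_real \<theta>) - z0)" if "\<epsilon> \<le> \<bar>\<theta>\<bar>" "\<bar>\<theta>\<bar> \<le> pi" for \<theta>
        proof -
          define e where "e = exp (\<i> * complex_of_real \<theta>)"
          \<comment> \<open>Write z0(e - 1) = (ze - z0) - (z - z0)e and use |z - z0| < d \<le>
            b.\<close>
          have "2 * b \<le> norm z0 * norm (e - 1)" unfolding e_def circ b_def
            using mult_left_mono[OF sinmono[OF that] norm_ge_zero[of z0]] by simp
          also have "\<dots> = norm ((z * e - z0) - (z - z0) * e)" unfolding norm_mult[symmetric] by (simp add: algebra_simps)
          also have "\<dots> \<le> norm (z * e - z0) + norm ((z - z0) * e)" by (rule norm_triangle_ineq4)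
          also have "norm ((z - z0) * e) = norm (z - z0)" by (simp add: e_def norm_mult)
          finally show ?thesis using zb d(5) by (simp add: e_def)
        qed
        show "real s * slope_of g z = real r" using sl by blast
      qed (use \<epsilon> \<rho> \<rho>pos in auto)
      have qs: "(norm (g z) / x) ^ s \<le> C2 * real s powr (- (real N + 1) / real k)" if "\<rho> \<le> x" for x
      proof -
        have "norm (g z) \<le> (norm w0 + \<rho>) / 2" using wb AP(1) norm_triangle_ineq2[of "g z" w0] by (simp add: field_simps)
        then have "norm (g z) / x \<le> q" unfolding q_def using that \<rho>pos by (intro frac_le) auto
        then have "(norm (g z) / x) ^ s \<le> q ^ s" using that \<rho>pos by (intro power_mono) auto
        also have "q ^ s = exp (- (real s * (- ln q)))" using q by (simp add: exp_of_nat_mult)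
        also have "\<dots> \<le> C2 * real s powr (- ((real N + 1) / real k))" using s by (intro C2(2)) simp
        finally show ?thesis by (simp only: minus_divide_left)
      qed
      have "\<bar>M1\<bar> * (norm (g z) / \<rho>1) ^ s + \<bar>M2\<bar> * (norm (g z) / \<rho>2) ^ s
          \<le> \<bar>M1\<bar> * (C2 * real s powr (- (real N + 1) / real k)) + \<bar>M2\<bar> * (C2 * real s powr (- (real N + 1) / real k))"
        by (intro add_mono mult_left_mono qs \<rho>) auto
      then have approx': "norm (a r s * z ^ r * g z ^ s - of_real (1 / (2 * pi)) * I)
          \<le> (\<bar>M1\<bar> + \<bar>M2\<bar>) * C2 * real s powr (- (real N + 1) / real k)"
        using approx by (simp add: algebra_simps)
      define S where "S = (\<Sum>l<N. of_real (real s powr (- (real l + 1) / real k)) * (calA (taylor_coeff (f z) k) k l * b_coeff (psi_tilde F g z) (f z) k l))"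
      have ReE: "\<delta> \<le> Re (f z (of_real x))" if "x = \<epsilon> \<or> x = - \<epsilon>" for x
      proof -
        have "norm (complex_of_real x) \<le> \<tau>" using that \<epsilon> by auto
        then have "norm (f z (of_real x) - f z0 (of_real x)) < \<delta>" using zb d by (intro d2(2)[OF zc]) auto
        moreover have "Re (f z0 (of_real x) - f z (of_real x)) \<le> norm (f z0 (of_real x) - f z (of_real x))"
          by (rule complex_Re_le_cmod)
        moreover have "2 * \<delta> \<le> Re (f z0 (of_real x))" using that \<delta> by blast
        ultimately show ?thesis by (simp add: norm_minus_commute)
      qed
      have lap: "norm (I - S) \<le> C1 * real s powr (- (real N + 1) / real k)"
        unfolding I_def S_def using ph s ReE[of \<epsilon>] ReE[of "- \<epsilon>"] by (intro C1 amp[OF zc]) auto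
      \<comment> \<open>The coefficients in the claim use the parametrization attached to p. They
        depend only on germs, so they equal those computed with \<open>g\<close>.\<close>
      have tc: "taylor_coeff (f_tilde (gg p) z (real r / real s)) k = taylor_coeff (f z) k"
        using taylor_coeff_cong[OF tilde_cong(1)[OF AP(2), of "slope_of g z"]] sl by (simp add: f_def)
      have bc: "b_coeff (psi_tilde F (gg p) z) (f_tilde (gg p) z (real r / real s)) k l = b_coeff (psi_tilde F g z) (f z) k l" for l
      proof -
        have "f z \<in> phase_class \<tau> M m k" using ph by blast
        then show ?thesis
          using b_coeff_cong[OF _ \<tau> M m k tilde_cong(1)[OF AP(2), of "slope_of g z"] tilde_cong(2)[OF AP(2), of F], folded f_def] sl
          by (simp add: f_def)
      qed
      have "a r s * z ^ r * g z ^ s - of_real (1 / (2 * pi)) * S = (a r s * z ^ r * g z ^ s - of_real (1 / (2 * pi)) * I) + of_real (1 / (2 * pi)) * (I - S)"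
        by (simp only: right_diff_distrib add_diff_eq diff_add_cancel)
      also have "norm \<dots> \<le> (\<bar>M1\<bar> + \<bar>M2\<bar>) * C2 * real s powr (- (real N + 1) / real k) + (1 / (2 * pi)) * (C1 * real s powr (- (real N + 1) / real k))"
      proof (rule norm_triangle_mono[OF approx'])
        have "norm (of_real (1 / (2 * pi)) * (I - S)) = (1 / (2 * pi)) * norm (I - S)"
          unfolding norm_mult norm_of_real by simp
        also have "\<dots> \<le> (1 / (2 * pi)) * (C1 * real s powr (- (real N + 1) / real k))" by (intro mult_left_mono lap) auto
        finally show "norm (of_real (1 / (2 * pi)) * (I - S)) \<le> (1 / (2 * pi)) * (C1 * real s powr (- (real N + 1) / real k))" .
      qed
      also have "\<dots> = C * real s powr (- (real N + 1) / real k)" by (simp only: C_def distrib_right mult.assoc)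
      finally show "fst p \<noteq> 0 \<and> snd p \<noteq> 0 \<and> norm (a r s * fst p ^ r * snd p ^ s - of_real (1 / (2 * pi)) *
         (\<Sum>l<N. of_real (real s powr (- (real l + 1) / real k)) *
            (calA (taylor_coeff (f_tilde (gg p) (fst p) (real r / real s)) k) k l *
             b_coeff (psi_tilde F (gg p) (fst p)) (f_tilde (gg p) (fst p) (real r / real s)) k l)))
       \<le> C * real s powr (- (real N + 1) / real k)"
        unfolding z_def[symmetric] tc bc AP(1) S_def using nz gz by blast
    qed
  qed
  \<comment> \<open>Stated for the centre alone; every pole will be the centre of its own
    neighbourhood.\<close>
  have vanish: "b_coeff (psi_tilde F g z0) (f_tilde g z0 (real r / real s)) k l = 0"
    if rs: "1 \<le> s" "(real r, real s) \<in> dir H (z0, w0)" and v: "vanishes_to_order_on G (zero_set H) (z0, w0) l0" "l < l0" for r s l l0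
  proof -
    have "f_tilde g z0 (real r / real s) = f z0"
      using slope_eq[of "(z0, w0)" z0 r s] p0 p0O rs by (simp add: gg0 f_def)
    moreover have "psi_tilde F g z0 analytic_on {0}"
      unfolding analytic_at using amp[OF z0in] \<tau> by (intro exI[of _ "ball 0 \<tau>"]) (auto simp: amplitude_class_def)
    moreover have "f z0 \<in> phase_class \<tau> M m k" using phase[of "(z0, w0)" z0] p0 p0O by simp
    ultimately show ?thesis using b_coeff_eq_0[OF _ \<tau> M m k _ psi_tilde_bigo[OF v(1)] v(2)] by simp
  qed
  show ?thesis by (rule that[OF opO p0O expansion vanish k])
qed

end

section \<open>Uniformity on compact sets\<close>

theorem theorem3p3:
  fixes F G H :: "complex \<times> complex \<Rightarrow> complex"
    and a :: "nat \<Rightarrow> nat \<Rightarrow> complex"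
    and K :: "(complex \<times> complex) set"
    and g :: "complex \<times> complex \<Rightarrow> complex \<Rightarrow> complex"
    and k l0 :: nat
  assumes F: "F = (\<lambda>p. G p / H p)"
    and series: "has_power_series a F (0, 0)"
    and "compact K"
    and analytic: "\<And>p. p \<in> K \<Longrightarrow> analytic2_on G (polydisk p) \<and> analytic2_on H (polydisk p)"
    and pole: "\<And>p. p \<in> K \<Longrightarrow> strictly_minimal H p \<and> simple_pole H p"
    and nonzero: "\<And>p. p \<in> K \<Longrightarrow> snd p * partial2 H p \<noteq> 0"
    and g: "\<And>p. p \<in> K \<Longrightarrow> parametrizes (g p) H p"
    and k: "\<And>p r s. p \<in> K \<Longrightarrow> (r, s) \<in> dir H p \<Longrightarrow> s \<noteq> 0 \<Longrightarrow>
              is_order_at_0 (f_tilde (g p) (fst p) (r / s)) k"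
    and l0: "\<And>p. p \<in> K \<Longrightarrow> is_vanishing_order_on G (zero_set H) p l0"
  shows "asymptotic_expansion (dir_filter H K)
           (\<lambda>(p, r, s). a r s)
           l0
           (\<lambda>l (p, r, s).
              let f = f_tilde (g p) (fst p) (real r / real s)
              in calA (taylor_coeff f k) k l * b_coeff (psi_tilde F (g p) (fst p)) f k l)
           (\<lambda>l (p, r, s).
              complex_of_real (1 / (2 * pi)) * fst p powi (- int r) * snd p powi (- int s) *
              complex_of_real (real s powr (- (real l + 1) / real k)))"
proof -
  note param = g
  define f where "f = (\<lambda>(p, r::nat, s::nat). f_tilde (g p) (fst p) (real r / real s))"
  define \<beta> where "\<beta> = (\<lambda>l (p, r::nat, s::nat). calA (taylor_coeff (f (p, r, s)) k) k l * b_coeff (psi_tilde F (g p) (fst p)) (f (p, r, s)) k l)"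
  define P where "P = (\<lambda>l s. real s powr (- (real l + 1) / real k))"
  define D where "D = {(p, r, s). p \<in> K \<and> (real r, real s) \<in> dir H p}"
  \<comment> \<open>The remainder bound on a set of poles with one constant, multiplied through by
    z^r w^s. Its sum starts at 0; \<open>Vz\<close> later removes the terms below l0.\<close>
  define Bd where "Bd = (\<lambda>X N C. \<forall>p\<in>X. \<forall>r s. 1 \<le> s \<longrightarrow> (real r, real s) \<in> dir H p \<longrightarrow>
         fst p \<noteq> 0 \<and> snd p \<noteq> 0 \<and>
         norm (a r s * fst p ^ r * snd p ^ s - of_real (1 / (2 * pi)) * (\<Sum>l<N. of_real (P l s) * \<beta> l (p, r, s))) \<le> C * P N s)"
  define Vz where "Vz = (\<lambda>p. \<forall>r s l. 1 \<le> s \<longrightarrow> (real r, real s) \<in> dir H p \<longrightarrow> l < l0 \<longrightarrow> \<beta> l (p, r, s) = 0)"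
  \<comment> \<open>At a pole with first coordinate 0 the rotation is constant and (0, 1) lies in
    the direction. The phase would then vanish identically, contradicting the existence of its
    order.\<close>
  have fst_nz: "fst p \<noteq> 0" if p: "p \<in> K" for p
  proof
    assume 0: "fst p = 0"
    then have "(0, 1) \<in> dir H p" using nonzero[OF p] by (auto simp: dir_def intro!: exI[of _ "1 / (snd p * partial2 H p)"])
    then have ord: "is_order_at_0 (f_tilde (g p) 0 0) k" using k[OF p, of 0 1] by (simp add: 0)
    have "snd p \<noteq> 0" using nonzero[OF p] by auto
    then have "g p 0 \<noteq> 0" using g[OF p] 0 by (simp add: parametrizes_def)
    then have "f_tilde (g p) 0 0 = (\<lambda>_. 0)" by (auto simp: f_tilde_def)
    then have "taylor_coeff (f_tilde (g p) 0 0) k = 0" by (simp add: taylor_coeff_def)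
    then show False using ord by (simp add: is_order_at_0_def)
  qed
  have loc: "\<exists>O'. open O' \<and> p0 \<in> O' \<and>
      (\<forall>N. \<exists>C. Bd (K \<inter> O') N C) \<and>
      Vz p0 \<and> 0 < k"
    if p0: "p0 \<in> K" for p0
  proof -
    obtain z0 w0 where zw: "p0 = (z0, w0)" by force
    obtain U1 where U1: "polydisk p0 \<subseteq> U1" "sep_hol G U1" using analytic2_on_imp_sep_hol analytic[OF p0] by metis
    obtain U2 where U2: "polydisk p0 \<subseteq> U2" "sep_hol H U2" using analytic2_on_imp_sep_hol analytic[OF p0] by metis
    have op: "open (U1 \<inter> U2)" using U1 U2 by (auto simp: sep_hol_def)
    interpret smooth_point F G H "U1 \<inter> U2" z0 w0 "g p0"
    proof
      show "sep_hol G (U1 \<inter> U2)" "sep_hol H (U1 \<inter> U2)"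
        using sep_hol_subset[OF U1(2) op] sep_hol_subset[OF U2(2) op] by auto
      show "polydisk (z0, w0) \<subseteq> U1 \<inter> U2" using U1 U2 by (auto simp: zw)
      show "strictly_minimal H (z0, w0)" using pole[OF p0] by (simp add: zw)
      show "partial2 H (z0, w0) \<noteq> 0" "w0 \<noteq> 0" using nonzero[OF p0] by (auto simp: zw)
      show "z0 \<noteq> 0" using fst_nz[OF p0] by (simp add: zw)
      show "parametrizes (g p0) H (z0, w0)" using g[OF p0] by (simp add: zw)
    qed (rule F)
    have Kp: "strictly_minimal H p \<and> p \<in> zero_set H \<and> parametrizes (g p) H p" if "p \<in> K" for p
      using pole[OF that] param[OF that] by (simp add: simple_pole_def)
    have p0': "(z0, w0) \<in> K" "g (z0, w0) = g p0" using p0 by (simp_all add: zw)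
    obtain O' where O': "open O'" "(z0, w0) \<in> O'"
      and ex: "\<And>N. \<exists>C. \<forall>p\<in>K \<inter> O'. \<forall>r s. 1 \<le> s \<longrightarrow> (real r, real s) \<in> dir H p \<longrightarrow>
       fst p \<noteq> 0 \<and> snd p \<noteq> 0 \<and>
       norm (a r s * fst p ^ r * snd p ^ s - of_real (1 / (2 * pi)) *
         (\<Sum>l<N. of_real (real s powr (- (real l + 1) / real k)) *
            (calA (taylor_coeff (f_tilde (g p) (fst p) (real r / real s)) k) k l *
             b_coeff (psi_tilde F (g p) (fst p)) (f_tilde (g p) (fst p) (real r / real s)) k l)))
       \<le> C * real s powr (- (real N + 1) / real k)"
      and van: "\<And>r s l l0. 1 \<le> s \<Longrightarrow> (real r, real s) \<in> dir H (z0, w0) \<Longrightarrow>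
       vanishes_to_order_on G (zero_set H) (z0, w0) l0 \<Longrightarrow> l < l0 \<Longrightarrow>
       b_coeff (psi_tilde F (g p0) z0) (f_tilde (g p0) z0 (real r / real s)) k l = 0"
      and k0: "0 < k"
      using local_expansion[OF series Kp p0' k] by blast
    have v0: "vanishes_to_order_on G (zero_set H) (z0, w0) l0"
      using l0[OF p0] by (simp add: is_vanishing_order_on_def zw)
    show ?thesis
    proof (intro exI[of _ O'] conjI allI impI)
      show "p0 \<in> O'" using O' by (simp add: zw)
      show "\<exists>C. Bd (K \<inter> O') N C" for N
        using ex[of N] by (simp only: Bd_def P_def \<beta>_def f_def prod.case)
      show "Vz p0"
        unfolding Vz_def
      proof (intro allI impI)
        fix r s l assume "1 \<le> s" "(real r, real s) \<in> dir H p0" "l < l0"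
        then show "\<beta> l (p0, r, s) = 0"
          using van[OF _ _ v0, of s r l] by (simp add: \<beta>_def f_def zw)
      qed
    qed (use O' k0 in auto)
  qed
  show ?thesis
  proof (cases "K = {}")
    case True
    \<comment> \<open>For empty K the filter is trivial, so every asymptotic claim holds along it;
      in the other case some pole yields k > 0.\<close>
    have "dir_filter H K = bot" by (simp add: dir_filter_def True case_prod_unfold)
    then show ?thesis by (simp add: asymptotic_expansion_def)
  next
    case False
    then have k0: "0 < k" using loc by blast
    from loc obtain Nb where Nb: "\<And>p. p \<in> K \<Longrightarrow> open (Nb p)" "\<And>p. p \<in> K \<Longrightarrow> p \<in> Nb p"
      and exN: "\<And>p0 N. p0 \<in> K \<Longrightarrow> \<exists>C. Bd (K \<inter> Nb p0) N C"
      by metis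
    obtain T where T: "T \<subseteq> K" "finite T" "K \<subseteq> (\<Union>p\<in>T. Nb p)"
      using compactE_image[OF \<open>compact K\<close>, of K Nb] Nb by blast
    have unif: "\<exists>C. Bd K N C" for N
    proof -
      obtain C where C: "\<And>p0. p0 \<in> K \<Longrightarrow> Bd (K \<inter> Nb p0) N (C p0)"
        using exN[of _ N] by metis
      \<comment> \<open>The sum of absolute values over the finite subcover dominates every local
        constant.\<close>
      define CC where "CC = (\<Sum>p\<in>T. \<bar>C p\<bar>)"
      show ?thesis
        unfolding Bd_def
      proof (intro exI[of _ CC] ballI allI impI)
        fix p r s assume p: "p \<in> K" "1 \<le> s" "(real r, real s) \<in> dir H p"
        obtain p0 where p0: "p0 \<in> T" "p \<in> Nb p0" using T p by blast
        have c: "fst p \<noteq> 0 \<and> snd p \<noteq> 0 \<and>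
           norm (a r s * fst p ^ r * snd p ^ s - of_real (1 / (2 * pi)) * (\<Sum>l<N. of_real (P l s) * \<beta> l (p, r, s))) \<le> C p0 * P N s"
        proof -
          have "Bd (K \<inter> Nb p0) N (C p0)" using C p0 T by blast
          then show ?thesis unfolding Bd_def using p p0 by blast
        qed
        have "C p0 \<le> CC" unfolding CC_def using member_le_sum[of p0 T "\<lambda>p. \<bar>C p\<bar>"] T p0 by fastforce
        then have "C p0 * P N s \<le> CC * P N s" by (intro mult_right_mono) (simp_all add: P_def)
        then show "fst p \<noteq> 0 \<and> snd p \<noteq> 0 \<and>
           norm (a r s * fst p ^ r * snd p ^ s - of_real (1 / (2 * pi)) * (\<Sum>l<N. of_real (P l s) * \<beta> l (p, r, s))) \<le> CC * P N s"
          using c by linarith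
      qed
    qed
    \<comment> \<open>A threshold on s alone suffices, valid for all p in K and all r in the
      direction of p; this is the uniformity of the expansion.\<close>
    have ev: "\<forall>\<^sub>F x in dir_filter H K. Q x"
      if Q: "\<And>p r s. p \<in> K \<Longrightarrow> (real r, real s) \<in> dir H p \<Longrightarrow> S \<le> s \<Longrightarrow> Q (p, r, s)" for Q and S :: nat
      unfolding dir_filter_def eventually_inf_principal eventually_filtercomap
      by (rule exI[of _ "\<lambda>s. S \<le> s"]) (use Q in \<open>auto simp: eventually_ge_at_top\<close>)
    define E where "E = (\<lambda>l (p, r, s). complex_of_real (1 / (2 * pi)) * fst p powi (- int r) * snd p powi (- int s) * complex_of_real (P l s))"
    have normE: "norm (E l (p, r, s)) = (1 / (2 * pi)) * inverse (norm (fst p) ^ r * norm (snd p) ^ s) * P l s" for l p r s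
      by (simp add: E_def norm_mult norm_divide norm_inverse norm_power power_int_minus P_def)
    \<comment> \<open>Consecutive scale functions have ratio s^(-1/k), which involves neither p nor
      r, so their little-o relation is uniform.\<close>
    have Plim: "\<exists>S\<ge>1. \<forall>s\<ge>S. P (Suc l) s \<le> c * P l s" if c: "0 < c" for c l
    proof -
      have "((\<lambda>s. real s powr (- 1 / real k)) \<longlongrightarrow> 0) sequentially"
        using k0 by (intro tendsto_neg_powr filterlim_real_sequentially) (auto simp: divide_neg_pos)
      then have "\<forall>\<^sub>F s in sequentially. real s powr (- 1 / real k) < c" using c by (rule order_tendstoD)
      then obtain S where S: "\<And>s. S \<le> s \<Longrightarrow> real s powr (- 1 / real k) < c" by (auto simp: eventually_sequentially)
      have "P (Suc l) s \<le> c * P l s" if "max 1 S \<le> s" for s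
      proof -
        have "- (real (Suc l) + 1) / real k = - 1 / real k + - (real l + 1) / real k" unfolding add_divide_distrib[symmetric] by simp
        then have "P (Suc l) s = real s powr (- 1 / real k) * P l s" unfolding P_def by (simp only: powr_add)
        also have "\<dots> \<le> c * P l s" using S[of s] that by (intro mult_right_mono) (auto simp: P_def)
        finally show ?thesis .
      qed
      then show ?thesis by (intro exI[of _ "max 1 S"]) auto
    qed
    have step: "E (Suc l) \<in> o[dir_filter H K](E l)" for l
    proof (rule landau_o.smallI)
      fix c :: real assume "0 < c"
      then obtain S where S: "1 \<le> S" "\<And>s. S \<le> s \<Longrightarrow> P (Suc l) s \<le> c * P l s" using Plim by blast
      show "\<forall>\<^sub>F x in dir_filter H K. norm (E (Suc l) x) \<le> c * norm (E l x)"
      proof (rule ev)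
        fix p r s assume "S \<le> s"
        from mult_left_mono[OF S(2)[OF this], of "(1 / (2 * pi)) * inverse (norm (fst p) ^ r * norm (snd p) ^ s)"]
        show "norm (E (Suc l) (p, r, s)) \<le> c * norm (E l (p, r, s))" unfolding normE by (simp add: mult_ac)
      qed
    qed
    have rem: "(\<lambda>x. (case x of (p, r, s) \<Rightarrow> a r s) - (\<Sum>l = l0..N. \<beta> l x * E l x)) \<in> o[dir_filter H K](E N)" if N: "l0 \<le> N" for N
    proof (rule landau_o.smallI)
      fix c :: real assume c: "0 < c"
      \<comment> \<open>The terms up to N leave a remainder of the order of the scale function N +
        1, which is little-o of the N-th. The bound with one term fewer would give only
        big-O.\<close>
      from unif obtain C where "Bd K (Suc N) C" by blast
      then have C: "\<And>p r s. p \<in> K \<Longrightarrow> 1 \<le> s \<Longrightarrow> (real r, real s) \<in> dir H p \<Longrightarrow>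
         fst p \<noteq> 0 \<and> snd p \<noteq> 0 \<and>
         norm (a r s * fst p ^ r * snd p ^ s - of_real (1 / (2 * pi)) * (\<Sum>l<Suc N. of_real (P l s) * \<beta> l (p, r, s))) \<le> C * P (Suc N) s"
        unfolding Bd_def by blast
      \<comment> \<open>Chosen so that (|C| + 1) c' = c/(2\<pi>), the 1/(2\<pi>) being the prefactor
        contained in \<open>E N\<close>.\<close>
      define c' where "c' = c / (2 * pi * (\<bar>C\<bar> + 1))"
      have c': "0 < c'" using c by (simp add: c'_def)
      then obtain S where S: "1 \<le> S" "\<And>s. S \<le> s \<Longrightarrow> P (Suc N) s \<le> c' * P N s" using Plim by blast
      show "\<forall>\<^sub>F x in dir_filter H K. norm ((case x of (p, r, s) \<Rightarrow> a r s) - (\<Sum>l = l0..N. \<beta> l x * E l x)) \<le> c * norm (E N x)"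
      proof (rule ev)
        fix p r s assume p: "p \<in> K" "(real r, real s) \<in> dir H p" "S \<le> s"
        then have s1: "1 \<le> s" using S by simp
        note Cp = C[OF p(1) s1 p(2)]
        define Z where "Z = fst p ^ r * snd p ^ s"
        have nz: "fst p \<noteq> 0" "snd p \<noteq> 0" using Cp by blast+
        then have Z: "Z \<noteq> 0" by (simp add: Z_def)
        have Eeq: "E l (p, r, s) = of_real (1 / (2 * pi)) * of_real (P l s) / Z" for l
          using nz by (simp add: E_def Z_def power_int_minus field_simps)
        have "Vz p" using loc[OF p(1)] by blast
        \<comment> \<open>The coefficients below l0 vanish at every pole, so the sum over l \<le> N
          reduces to the one starting at l0.\<close>
        then have "\<beta> l (p, r, s) = 0" if "l < l0" for l using s1 p(2) that by (simp add: Vz_def)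
        then have "(\<Sum>l<Suc N. of_real (P l s) * \<beta> l (p, r, s)) = (\<Sum>l=l0..N. of_real (P l s) * \<beta> l (p, r, s))"
          using N by (intro sum.mono_neutral_right) auto
        moreover have "(\<Sum>l = l0..N. \<beta> l (p, r, s) * E l (p, r, s)) = of_real (1 / (2 * pi)) * (\<Sum>l=l0..N. of_real (P l s) * \<beta> l (p, r, s)) / Z"
          unfolding Eeq sum_distrib_left sum_divide_distrib by (intro sum.cong) (simp_all add: mult_ac)
        ultimately have "a r s - (\<Sum>l = l0..N. \<beta> l (p, r, s) * E l (p, r, s)) =
            (a r s * Z - of_real (1 / (2 * pi)) * (\<Sum>l<Suc N. of_real (P l s) * \<beta> l (p, r, s))) / Z"
          using Z by (simp add: diff_divide_distrib)
        then have "norm (a r s - (\<Sum>l = l0..N. \<beta> l (p, r, s) * E l (p, r, s))) \<le> C * P (Suc N) s / norm Z"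
          using Cp by (simp add: norm_divide divide_right_mono Z_def mult.assoc)
        also have "\<dots> \<le> (\<bar>C\<bar> + 1) * (c' * P N s) / norm Z"
          using S(2)[OF p(3)] by (intro divide_right_mono mult_mono) (auto simp: P_def)
        also have "(\<bar>C\<bar> + 1) * (c' * P N s) / norm Z = c * norm (E N (p, r, s))"
        proof -
          have "0 < \<bar>C\<bar> + 1" by simp
          then have "(\<bar>C\<bar> + 1) * c' = c * (1 / (2 * pi))" unfolding c'_def by (simp add: divide_simps)
          moreover have "norm (E N (p, r, s)) = (1 / (2 * pi)) * P N s / norm Z"
            unfolding Eeq norm_divide norm_mult norm_of_real by (simp add: P_def)
          ultimately show ?thesis by (metis (no_types, opaque_lifting) mult.assoc times_divide_eq_right)
        qed
        finally show "norm ((case (p, r, s) of (p, r, s) \<Rightarrow> a r s) - (\<Sum>l = l0..N. \<beta> l (p, r, s) * E l (p, r, s))) \<le> c * norm (E N (p, r, s))"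
          by simp
      qed
    qed
    have "asymptotic_expansion (dir_filter H K) (\<lambda>(p, r, s). a r s) l0 \<beta> E"
      unfolding asymptotic_expansion_def using step rem by blast
    then show ?thesis by (simp add: \<beta>_def E_def f_def P_def Let_def case_prod_unfold)
  qed
qed

end
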